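(* Let $K$ be a field, and let $G$ be a finite subgroup of $\mathrm{GL}_n(K)$ that contains no transvections, acting on the polynomial ring $R := K[x_1,\dots,x_n]$. Let $\mathfrak{m}$ and $\mathfrak{n}$ denote the homogeneous maximal ideals of $R$ and of the invariant ring $R^G$, respectively. Then there is an exact sequence $$\bigoplus_{g\in G} H^n_{\mathfrak{m}}(R)\ \xrightarrow{\ \alpha\ }\ H^n_{\mathfrak{m}}(R)\ \xrightarrow{\ \mathrm{Tr}\ }\ H^n_{\mathfrak{n}}(R^G)\ \longrightarrow\ 0,$$ where $$\alpha\colon (\eta_g)_{g\in G}\ \longmapsto\ \sum_{g\in G}\big(\eta_g - g(\eta_g)\big)$$ and $\mathrm{Tr}$ is the map on local cohomology induced by the transfer map $\mathrm{Tr}\colon R\to R^G$.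
   Context: The ring $R=K[x_1,\dots,x_n]$ has the standard grading. A matrix $M\in \mathrm{GL}_n(K)$ acts on $R$ by the degree-preserving $K$-algebra automorphism $X\mapsto MX$, where $X$ is the column vector $(x_1,\dots,x_n)^T$ (so $x_i\mapsto \sum_j M_{ij}x_j$). $R^G$ is the subring of elements fixed by all of $G$. An element $g\in \mathrm{GL}_n(K)$ of finite order is a pseudoreflection if $g-I$ has rank one. It is a transvection if it is a pseudoreflection whose Jordan form (after extending scalars) consists of a single $2\times 2$ Jordan block with eigenvalue $1$ together with $1\times 1$ blocks with eigenvalue $1$, i.e., $g-I$ has rank one and $(g-I)^2=0$; transvections of finite order exist only in positive characteristic. The transfer map $\mathrm{Tr}\colon R\to R^G$ is the $R^G$-linear map $r\mapsto\sum_{g\in G} g(r)$. Since $\mathfrak{n}R$ has radical $\mathfrak{m}$, one identifies $H^n_{\mathfrak{m}}(R)=H^n_{\mathfrak{n}}(R)$. If $y_1,\dots,y_n$ is a homogeneous system of parameters for $R^G$, then for $S=R$ or $S=R^G$, $H^n_{\mathfrak{n}}(S)$ is identified with the Čech cohomology module $S_{y_1\cdots y_n}/\sum_i S_{y_1\cdots\hat{y}_i\cdots y_n}$. Under this identification, $g\in G$ acts on $H^n_{\mathfrak{m}}(R)$ by $\left[\frac{r}{y_1^d\cdots y_n^d}\right]\mapsto\left[\frac{g(r)}{y_1^d\cdots y_n^d}\right]$, and $\mathrm{Tr}\colon H^n_{\mathfrak{m}}(R)\to H^n_{\mathfrak{n}}(R^G)$ is $\left[\frac{r}{y_1^d\cdots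 y_n^d}\right]\mapsto\left[\frac{\mathrm{Tr}(r)}{y_1^d\cdots y_n^d}\right]$. *)

theory Defs
  imports
    "HOL-Analysis.Cartesian_Space"
    "HOL-Library.Poly_Mapping"
    "HOL-Computational_Algebra.Fraction_Field"
    "HOL-Algebra.Product_Groups"
    "HOL-Algebra.Ideal"
begin

text \<open>
  The type \<open>'n\<close> is the index set of the variables and \<open>n\<close> is \<open>CARD('n)\<close>.  The linear order on
  \<open>'n\<close> is used only to make the polynomial ring an instance of \<^class>\<open>idom\<close>, so that its
  fraction field is available.
\<close>

type_synonym ('n, 'k) mpoly = "('n \<Rightarrow>\<^sub>0 nat) \<Rightarrow>\<^sub>0 'k"

definition Const :: "'k::field \<Rightarrow> ('n, 'k) mpoly" where
  "Const c = Poly_Mapping.single 0 c"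

definition Var :: "'n \<Rightarrow> ('n, 'k::field) mpoly" where
  "Var i = Poly_Mapping.single (Poly_Mapping.single i 1) 1"

definition homogeneous :: "nat \<Rightarrow> ('n::finite, 'k::field) mpoly \<Rightarrow> bool" where
  "homogeneous d p \<longleftrightarrow>
     (\<forall>m \<in> Poly_Mapping.keys p. (\<Sum>i\<in>UNIV. Poly_Mapping.lookup m i) = d)"


section \<open>Linear groups and their action on polynomials\<close>

definition GL :: "('k::field ^ 'n ^ 'n) monoid" where
  "GL = \<lparr>carrier = {A. invertible A}, monoid.mult = (**), one = mat 1\<rparr>"

definition pseudoreflection :: "'k::field ^ 'n ^ 'n \<Rightarrow> bool" where
  "pseudoreflection g \<longleftrightarrow>
     g \<in> carrier GL \<and> (\<exists>k::nat. k > 0 \<and> g [^]\<^bsub>GL\<^esub> k = \<one>\<^bsub>GL\<^esub>) \<and> rank (g - mat 1) = 1"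

definition transvection :: "'k::field ^ 'n ^ 'n \<Rightarrow> bool" where
  "transvection g \<longleftrightarrow> pseudoreflection g \<and> (g - mat 1) ** (g - mat 1) = 0"

text \<open>The \<open>K\<close>-algebra endomorphism sending the variable \<open>x\<^sub>i\<close> to \<open>\<Sum>\<^sub>j M\<^sub>i\<^sub>j x\<^sub>j\<close>.\<close>

definition act :: "'k::field ^ 'n ^ 'n \<Rightarrow> ('n::finite, 'k) mpoly \<Rightarrow> ('n, 'k) mpoly" where
  "act M p = (\<Sum>m \<in> Poly_Mapping.keys p.
     Const (Poly_Mapping.lookup p m) *
     (\<Prod>i\<in>UNIV. (\<Sum>j\<in>UNIV. Const (M $ i $ j) * Var j) ^ Poly_Mapping.lookup m i))"

definition invariants :: "('k::field ^ 'n ^ 'n) set \<Rightarrow> ('n::finite, 'k) mpoly set" where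
  "invariants G = {p. \<forall>g\<in>G. act g p = p}"

definition invariant_ring :: "('k::field ^ 'n ^ 'n) set \<Rightarrow> ('n::finite, 'k) mpoly ring" where
  "invariant_ring G =
     \<lparr>carrier = invariants G, monoid.mult = (*), one = 1, zero = 0, add = (+)\<rparr>"

definition transfer_map ::
    "('k::field ^ 'n ^ 'n) set \<Rightarrow> ('n::finite, 'k) mpoly \<Rightarrow> ('n, 'k) mpoly" where
  "transfer_map G r = (\<Sum>g\<in>G. act g r)"

text \<open>An invariant lies in the homogeneous maximal ideal iff its degree-zero part vanishes.\<close>

definition homogeneous_max_ideal ::
    "('k::field ^ 'n ^ 'n) set \<Rightarrow> ('n::finite, 'k) mpoly set" where
  "homogeneous_max_ideal G = {f \<in> invariants G. Poly_Mapping.lookup f 0 = 0}"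

text \<open>
  A homogeneous system of parameters for the invariant ring, which has Krull dimension
  \<open>n = CARD('n)\<close>: a family of \<open>n\<close> homogeneous invariants of positive degree generating an ideal
  whose radical is the homogeneous maximal ideal.
\<close>

definition hsop ::
    "('k::field ^ 'n ^ 'n) set \<Rightarrow> ('n::finite \<Rightarrow> ('n, 'k) mpoly) \<Rightarrow> bool" where
  "hsop G y \<longleftrightarrow>
     (\<forall>i. y i \<in> invariants G \<and> (\<exists>d>0. homogeneous d (y i))) \<and>
     {f \<in> invariants G. \<exists>k::nat. f ^ k \<in> Idl\<^bsub>invariant_ring G\<^esub> (range y)} =
       homogeneous_max_ideal G"


section \<open>Top local cohomology as Cech cohomology\<close>

text \<open>
  Here \<open>S\<close> is the polynomial ring \<open>UNIV\<close> or the subring \<open>invariants G\<close>.  As the polynomial ring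
  is a domain, the localization \<open>S\<^sub>f\<close> at a nonzero \<open>f \<in> S\<close> is the set of all \<open>s / f\<^sup>d\<close> inside its
  fraction field.
\<close>

definition localization ::
    "('n::{finite,linorder}, 'k::field) mpoly set \<Rightarrow> ('n, 'k) mpoly \<Rightarrow> ('n, 'k) mpoly fract set" where
  "localization S f = {Fract s (f ^ d) | s d. s \<in> S}"

definition localization_group ::
    "('n::{finite,linorder}, 'k::field) mpoly set \<Rightarrow> ('n, 'k) mpoly \<Rightarrow> ('n, 'k) mpoly fract monoid" where
  "localization_group S f = \<lparr>carrier = localization S f, monoid.mult = (+), one = 0\<rparr>"

text \<open>The sum over \<open>i\<close> of the localizations of \<open>S\<close> at \<open>\<Prod>\<^sub>j\<^sub>\<noteq>\<^sub>i y\<^sub>j\<close>.\<close>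

definition cech_boundaries ::
    "('n::{finite,linorder}, 'k::field) mpoly set \<Rightarrow> ('n \<Rightarrow> ('n, 'k) mpoly) \<Rightarrow>
     ('n, 'k) mpoly fract set" where
  "cech_boundaries S y =
     {\<Sum>i\<in>UNIV. z i | z. \<forall>i. z i \<in> localization S (\<Prod>j\<in>UNIV - {i}. y j)}"

text \<open>
  The quotient of \<open>S\<^sub>y\<^sub>1\<^sub>\<dots>\<^sub>y\<^sub>n\<close> by the group above, which is \<open>H\<^sup>n(S)\<close> with support in the homogeneous
  maximal ideal of the invariant ring if \<open>y\<close> is a homogeneous system of parameters for that ring.
  For \<open>S = UNIV\<close> this is also the local cohomology supported in the homogeneous maximal ideal of
  the polynomial ring.  The group is written multiplicatively, following \<^const>\<open>FactGroup\<close>.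
\<close>

definition local_cohomology ::
    "('n::{finite,linorder}, 'k::field) mpoly set \<Rightarrow> ('n \<Rightarrow> ('n, 'k) mpoly) \<Rightarrow>
     ('n, 'k) mpoly fract set monoid" where
  "local_cohomology S y = localization_group S (\<Prod>i\<in>UNIV. y i) Mod cech_boundaries S y"

definition cech_fraction ::
    "('n::{finite,linorder} \<Rightarrow> ('n, 'k::field) mpoly) \<Rightarrow> ('n, 'k) mpoly \<Rightarrow> nat \<Rightarrow>
     ('n, 'k) mpoly fract" where
  "cech_fraction y r d = Fract r ((\<Prod>i\<in>UNIV. y i) ^ d)"

definition cech_class ::
    "('n::{finite,linorder}, 'k::field) mpoly set \<Rightarrow> ('n \<Rightarrow> ('n, 'k) mpoly) \<Rightarrow>
     ('n, 'k) mpoly \<Rightarrow> nat \<Rightarrow> ('n, 'k) mpoly fract set" where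
  "cech_class S y r d =
     cech_boundaries S y #>\<^bsub>localization_group S (\<Prod>i\<in>UNIV. y i)\<^esub> cech_fraction y r d"

text \<open>
  The map \<open>[r / (y\<^sub>1\<dots>y\<^sub>n)\<^sup>d] \<mapsto> [\<phi>(r) / (y\<^sub>1\<dots>y\<^sub>n)\<^sup>d]\<close> on local cohomology induced by a map \<open>\<phi>\<close>
  from \<open>S\<close> to \<open>T\<close> that is linear over the invariant ring.  Linearity makes the set of which
  \<^const>\<open>the_elem\<close> is taken a singleton, as the class does not depend on the representative.
\<close>

definition induced_map ::
    "('n::{finite,linorder}, 'k::field) mpoly set \<Rightarrow> ('n, 'k) mpoly set \<Rightarrow>
     ('n \<Rightarrow> ('n, 'k) mpoly) \<Rightarrow> (('n, 'k) mpoly \<Rightarrow> ('n, 'k) mpoly) \<Rightarrow>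
     ('n, 'k) mpoly fract set \<Rightarrow> ('n, 'k) mpoly fract set" where
  "induced_map S T y \<phi> \<eta> =
     the_elem {cech_class T y (\<phi> r) d | r d. r \<in> S \<and> cech_fraction y r d \<in> \<eta>}"

text \<open>The scalar action of an invariant \<open>c\<close> on local cohomology.\<close>

definition scalar ::
    "('n::{finite,linorder}, 'k::field) mpoly set \<Rightarrow> ('n \<Rightarrow> ('n, 'k) mpoly) \<Rightarrow>
     ('n, 'k) mpoly \<Rightarrow> ('n, 'k) mpoly fract set \<Rightarrow> ('n, 'k) mpoly fract set" where
  "scalar S y c = induced_map S S y (\<lambda>r. c * r)"

definition group_action ::
    "('n::{finite,linorder} \<Rightarrow> ('n, 'k::field) mpoly) \<Rightarrow> 'k ^ 'n::{finite,linorder} ^ 'n::{finite,linorder} \<Rightarrow>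
     ('n, 'k) mpoly fract set \<Rightarrow> ('n, 'k) mpoly fract set" where
  "group_action y g = induced_map UNIV UNIV y (act g)"

definition transfer_coh ::
    "('k::field ^ 'n::{finite,linorder} ^ 'n::{finite,linorder}) set \<Rightarrow> ('n::{finite,linorder} \<Rightarrow> ('n, 'k) mpoly) \<Rightarrow>
     ('n, 'k) mpoly fract set \<Rightarrow> ('n, 'k) mpoly fract set" where
  "transfer_coh G y = induced_map UNIV (invariants G) y (transfer_map G)"

text \<open>In additive notation, \<open>\<alpha>(\<eta>) = \<Sum>\<^sub>g (\<eta>\<^sub>g - g(\<eta>\<^sub>g))\<close>.\<close>

definition alpha ::
    "('k::field ^ 'n::{finite,linorder} ^ 'n::{finite,linorder}) set \<Rightarrow> ('n::{finite,linorder} \<Rightarrow> ('n, 'k) mpoly) \<Rightarrow>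
     ('k ^ 'n::{finite,linorder} ^ 'n::{finite,linorder} \<Rightarrow> ('n, 'k) mpoly fract set) \<Rightarrow> ('n, 'k) mpoly fract set" where
  "alpha G y \<eta> =
     (let H = local_cohomology UNIV y
      in finprod H (\<lambda>g. \<eta> g \<otimes>\<^bsub>H\<^esub> inv\<^bsub>H\<^esub> (group_action y g (\<eta> g))) G)"

end

theory Submission
  imports Defs "HOL-Algebra.Sylow" "HOL-Algebra.Multiplicative_Group"
    "HOL-Computational_Algebra.Polynomial"
begin

text \<open>
  Let \<open>P\<close> be the polynomial ring over \<open>K\<close> in formal variables that are evaluated at \<open>y\<^sub>1, \<dots>, y\<^sub>n\<close>.
  A functional \<open>\<theta>\<close> on the top local cohomology of \<open>S = R\<close> or \<open>S = R\<^sup>G\<close> is the same as the \<open>P\<close>-linear map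
  from \<open>S\<close> to the power series \<open>P'\<close> that sends \<open>r\<close> to \<open>\<Sum>\<^sub>a \<theta>(r / y\<^sup>a\<^sup>+\<^sup>1) y\<^sup>a\<close>.  Hence exactness
  of the sequence is dual to the following: a \<open>P\<close>-linear map \<open>\<phi>\<close> from \<open>R\<close> to \<open>P'\<close> that is constant on
  \<open>G\<close>-orbits factors uniquely as \<open>\<psi> \<circ> Tr\<close> with a \<open>P\<close>-linear map \<open>\<psi>\<close> on \<open>R\<^sup>G\<close>.

  The identity \<open>\<phi>(Tr(z) w) = \<phi>(z Tr(w))\<close> shows that \<open>\<phi>\<close> vanishes on the kernel of \<open>Tr\<close>, as \<open>P'\<close> is
  torsion-free.  So \<open>\<psi>\<close> exists on the image \<open>I\<close> of \<open>Tr\<close>, and on all of \<open>R\<^sup>G\<close> with values in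
  fractions.  If \<open>I\<close> contains for every \<open>i\<close> the value \<open>\<rho>\<^sub>i(y)\<close> of a nonzero polynomial \<open>\<rho>\<^sub>i\<close> that does not
  involve the \<open>i\<close>-th variable, then these fractions are power series, because the \<open>\<rho>\<^sub>i\<close> have no common
  divisor.

  Such \<open>\<rho>\<^sub>i\<close> exist: replace \<open>G\<close> by a Sylow subgroup \<open>Q\<close> for the characteristic of \<open>K\<close>.  The image of
  its transfer contains a power of every invariant in the product over \<open>1 \<noteq> g \<in> Q\<close> of the ideals generated
  by the linear forms \<open>g(x\<^sub>k) - x\<^sub>k\<close>.  As \<open>g\<close> is unipotent and not a transvection, two of these forms are
  independent, and modulo them the \<open>n - 1\<close> elements \<open>y\<^sub>j\<close> with \<open>j \<noteq> i\<close> are polynomials in \<open>n - 2\<close> variables,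
  hence algebraically dependent.
\<close>

section \<open>Substitution homomorphisms\<close>

lemma Const_add: "Const (a + b) = Const a + Const b"
  by (simp add: Const_def single_add)

lemma Const_mult: "Const (a * b) = Const a * Const b"
  by (simp add: Const_def mult_single)

lemma Const_0 [simp]: "Const 0 = 0"
  by (simp add: Const_def)

lemma Const_1 [simp]: "Const 1 = 1"
  by (simp add: Const_def)

lemma Const_of_nat: "Const (of_nat k) = of_nat k"
  by (induction k) (simp_all add: Const_add)

lemma lookup_Const_mult: "Poly_Mapping.lookup (Const c * p) m = c * Poly_Mapping.lookup p m"
proof -
  have "Const c * p = Poly_Mapping.map ((*) c) p"
    by (simp add: Const_def mult_map_scale_conv_mult)
  then show ?thesis
    by (simp add: Poly_Mapping.map.rep_eq when_def)
qed

text \<open>Exponents add up to 0 only if both vanish. Hence the constant term is a ring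
  homomorphism from \<open>R\<close> to \<open>K\<close>; it is applied to coefficients in
  \<open>Var_power_invariant_combination\<close>.\<close>

lemma lookup_mult_0:
  fixes p q :: "('n, 'k::field) mpoly"
  shows "Poly_Mapping.lookup (p * q) 0 = Poly_Mapping.lookup p 0 * Poly_Mapping.lookup q 0"
proof -
  have eq0: "k + l = 0 \<longleftrightarrow> k = 0 \<and> l = 0" for k l :: "'n \<Rightarrow>\<^sub>0 nat"
    by (auto simp: poly_mapping_eq_iff fun_eq_iff lookup_add)
  have "(\<Sum>m. Poly_Mapping.lookup q m when 0 = l + m) = (Poly_Mapping.lookup q 0 when l = 0)"
    for l :: "'n \<Rightarrow>\<^sub>0 nat"
  proof -
    have "(\<lambda>m. Poly_Mapping.lookup q m when 0 = l + m) = 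
        (\<lambda>m. (Poly_Mapping.lookup q m when l = 0) when m = 0)"
      using eq0 by (auto simp: fun_eq_iff when_def eq_commute[of 0])
    then show ?thesis by (simp only: Sum_any_when_equal)
  qed
  then show ?thesis
    by (simp add: lookup_mult mult_when)
qed

lemma lookup_one_0 [simp]: "Poly_Mapping.lookup (1 :: ('n, 'k::field) mpoly) 0 = 1"
  by (simp add: lookup_one)

lemma mpoly_sum_single:
  "p = (\<Sum>m \<in> Poly_Mapping.keys p. Poly_Mapping.single m (Poly_Mapping.lookup p m))"
  by (rule poly_mapping_eqI) (auto simp: lookup_sum lookup_single when_def in_keys_iff)

lemma mpoly_add_induct [case_names single add]:
  fixes p :: "('n, 'k::field) mpoly"
  assumes "\<And>m c. P (Poly_Mapping.single m c)"
    and add: "\<And>p q. P p \<Longrightarrow> P q \<Longrightarrow> P (p + q)"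
  shows "P p"
proof -
  have P0: "P 0"
    using assms(1)[of 0 0] by simp
  have "P (\<Sum>m \<in> S. Poly_Mapping.single m (Poly_Mapping.lookup p m))" if "finite S" for S
    using that by (induction S) (auto intro: assms P0)
  from this[of "Poly_Mapping.keys p"] show ?thesis
    by (simp flip: mpoly_sum_single)
qed

text \<open>The algebra homomorphism determined by the images of the variables. Both
  \<open>act M\<close> and the evaluation \<open>subst y\<close> of formal polynomials at the
  parameters are instances.\<close>

definition subst :: "('n \<Rightarrow> ('m, 'k) mpoly) \<Rightarrow> ('n::finite, 'k::field) mpoly \<Rightarrow> ('m, 'k) mpoly" where
  "subst f p = (\<Sum>m \<in> Poly_Mapping.keys p. Const (Poly_Mapping.lookup p m) *
     (\<Prod>i\<in>UNIV. f i ^ Poly_Mapping.lookup m i))"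

lemma subst_superset:
  assumes "finite S" "Poly_Mapping.keys p \<subseteq> S"
  shows "subst f p = (\<Sum>m \<in> S. Const (Poly_Mapping.lookup p m) *
     (\<Prod>i\<in>UNIV. f i ^ Poly_Mapping.lookup m i))"
  unfolding subst_def using assms by (intro sum.mono_neutral_left) (auto simp: in_keys_iff)

lemma subst_single:
  "subst f (Poly_Mapping.single m c) = Const c * (\<Prod>i\<in>UNIV. f i ^ Poly_Mapping.lookup m i)"
  by (subst subst_superset[of "{m}"]) auto

lemma subst_zero [simp]: "subst f 0 = 0"
  by (simp add: subst_def)

lemma subst_Const [simp]: "subst f (Const c) = Const c"
  unfolding Const_def[of c] subst_single by (simp add: Const_def)

lemma subst_one [simp]: "subst f 1 = 1"
  using subst_Const[of f 1] by (simp del: subst_Const)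

lemma subst_add: "subst f (p + q) = subst f p + subst f q"
proof -
  let ?S = "Poly_Mapping.keys p \<union> Poly_Mapping.keys q"
  have "Poly_Mapping.keys (p + q) \<subseteq> ?S" by (rule keys_add)
  then show ?thesis
    by (simp add: subst_superset[of ?S] lookup_add Const_add distrib_right sum.distrib)
qed

lemma subst_sum: "subst f (sum g S) = (\<Sum>x\<in>S. subst f (g x))"
  by (induction S rule: infinite_finite_induct) (auto simp: subst_add)

lemma subst_mult: "subst f (p * q) = subst f p * subst f q"
proof (induction p rule: mpoly_add_induct)
  case (single m c)
  show ?case
  proof (induction q rule: mpoly_add_induct)
    case (single m' c')
    then show ?case
      by (simp add: mult_single subst_single Const_mult lookup_add power_add prod.distrib algebra_simps)
  qed (simp add: distrib_left subst_add)
qed (simp add: distrib_right subst_add)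

lemma subst_power: "subst f (p ^ k) = subst f p ^ k"
  by (induction k) (auto simp: subst_mult)

lemma subst_prod: "subst f (prod g S) = (\<Prod>x\<in>S. subst f (g x))"
  by (induction S rule: infinite_finite_induct) (auto simp: subst_mult)

lemma subst_uminus: "subst f (- p) = - subst f p"
  using subst_add[of f p "-p"] by (simp add: add_eq_0_iff)

lemma subst_diff: "subst f (p - q) = subst f p - subst f q"
  using subst_add[of f p "-q"] by (simp add: subst_uminus)

lemma Var_power: "Var i ^ k = Poly_Mapping.single (Poly_Mapping.single i k) 1"
proof (induction k)
  case (Suc k)
  then show ?case
    by (simp add: Var_def mult_single flip: single_add)
qed simp

lemma single_as_prod_Var:
  fixes m :: "'n::finite \<Rightarrow>\<^sub>0 nat"
  shows "Poly_Mapping.single m (c::'k::field) = Const c * (\<Prod>i\<in>UNIV. Var i ^ Poly_Mapping.lookup m i)"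
proof -
  have *: "(\<Prod>i\<in>S. Var i ^ Poly_Mapping.lookup m i) = 
      Poly_Mapping.single (\<Sum>i\<in>S. Poly_Mapping.single i (Poly_Mapping.lookup m i)) (1::'k)"
    if "finite S" for S
    using that by (induction S) (auto simp: Var_power mult_single)
  have "(\<Sum>i\<in>UNIV. Poly_Mapping.single i (Poly_Mapping.lookup m i)) = m"
    by (rule poly_mapping_eqI) (auto simp: lookup_sum lookup_single when_def)
  then show ?thesis
    by (simp add: * Const_def mult_single)
qed

lemma subst_Var [simp]: "subst f (Var i) = f i"
proof -
  have "(\<Prod>j\<in>UNIV. f j ^ Poly_Mapping.lookup (Poly_Mapping.single i 1) j) =
      (\<Prod>j\<in>UNIV. if j = i then f j else 1)"
    by (intro prod.cong) (auto simp: lookup_single)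
  then show ?thesis
    unfolding Var_def subst_single by simp
qed

lemma subst_Var_id [simp]: "subst Var p = p"
  by (induction p rule: mpoly_add_induct) (simp_all add: subst_add subst_single flip: single_as_prod_Var)

lemma subst_subst: "subst f (subst g p) = subst (\<lambda>i. subst f (g i)) p"
  by (induction p rule: mpoly_add_induct)
    (simp_all add: subst_add subst_single subst_mult subst_prod subst_power)

section \<open>The action of matrices on polynomials\<close>

lemma act_eq_subst: "act M = subst (\<lambda>i. \<Sum>j\<in>UNIV. Const (M $ i $ j) * Var j)"
  by (auto simp: act_def subst_def fun_eq_iff)

lemma act_add: "act M (p + q) = act M p + act M q"
  by (simp add: act_eq_subst subst_add)

lemma act_diff: "act M (p - q) = act M p - act M q"
  by (simp add: act_eq_subst subst_diff)

lemma act_uminus: "act M (- p) = - act M p"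
  by (simp add: act_eq_subst subst_uminus)

lemma act_mult: "act M (p * q) = act M p * act M q"
  by (simp add: act_eq_subst subst_mult)

lemma act_power: "act M (p ^ k) = act M p ^ k"
  by (simp add: act_eq_subst subst_power)

lemma act_sum: "act M (sum f S) = (\<Sum>x\<in>S. act M (f x))"
  by (simp add: act_eq_subst subst_sum)

lemma act_prod: "act M (prod f S) = (\<Prod>x\<in>S. act M (f x))"
  by (simp add: act_eq_subst subst_prod)

lemma act_Const [simp]: "act M (Const c) = Const c"
  and act_0 [simp]: "act M 0 = 0"
  and act_1 [simp]: "act M 1 = 1"
  by (simp_all add: act_eq_subst)

lemma act_Var: "act M (Var i) = (\<Sum>j\<in>UNIV. Const (M $ i $ j) * Var j)"
  by (simp add: act_eq_subst)

lemma act_mat_1 [simp]: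
  fixes p :: "('n::finite, 'k::field) mpoly"
  shows "act (mat 1) p = p"
proof -
  have "(\<lambda>i. \<Sum>j\<in>UNIV. Const ((mat 1 :: 'k::field ^ 'n ^ 'n) $ i $ j) * Var j) = Var"
    by (simp add: fun_eq_iff mat_def if_distrib[where f = Const] if_distrib[where f = "\<lambda>x. x * _"] cong: if_cong)
  then show ?thesis by (simp add: act_eq_subst)
qed

lemma Const_sum: "Const (sum f S) = (\<Sum>x\<in>S. Const (f x))"
  by (induction S rule: infinite_finite_induct) (auto simp: Const_add)

text \<open>\<open>act B\<close> replaces the vector \<open>X\<close> of variables by
  \<open>B X\<close>, and \<open>act A\<close> then replaces \<open>X\<close> by \<open>A X\<close>
  inside, so the order of the factors is reversed.\<close>

lemma act_act: "act A (act B p) = act (B ** A) p"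
proof -
  have "(\<Sum>k\<in>UNIV. Const (B $ i $ k) * (\<Sum>j\<in>UNIV. Const (A $ k $ j) * Var j)) =
      (\<Sum>j\<in>UNIV. Const (\<Sum>k\<in>UNIV. B $ i $ k * A $ k $ j) * Var j)" for i
    by (simp add: sum_distrib_left sum_distrib_right Const_sum Const_mult mult.assoc,
        subst sum.swap, simp)
  then show ?thesis
    by (simp add: act_eq_subst subst_subst subst_sum subst_mult matrix_matrix_mult_def)
qed

lemma act_subst: "act M (subst y p) = subst (\<lambda>i. act M (y i)) p"
  by (simp add: act_eq_subst subst_subst)

section \<open>Power series as a module over polynomials\<close>

definition mdvd :: "('n \<Rightarrow>\<^sub>0 nat) \<Rightarrow> ('n \<Rightarrow>\<^sub>0 nat) \<Rightarrow> bool" where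
  "mdvd m a \<longleftrightarrow> (\<forall>i. Poly_Mapping.lookup m i \<le> Poly_Mapping.lookup a i)"

lemma mdvd_add_left [simp]: "mdvd m (m + a)"
  by (simp add: mdvd_def lookup_add)

lemma mdvdE:
  assumes "mdvd m a"
  obtains b where "a = m + b"
proof
  show "a = m + (a - m)"
    by (rule poly_mapping_eqI) (use assms in \<open>simp add: mdvd_def lookup_add lookup_minus\<close>)
qed

lemma card_exponent_box:
  fixes B :: "'n::finite \<Rightarrow> nat set"
  shows "card {m. \<forall>i. Poly_Mapping.lookup m i \<in> B i} = (\<Prod>i\<in>UNIV. card (B i))"
    and "(\<And>i. finite (B i)) \<Longrightarrow> finite {m. \<forall>i. Poly_Mapping.lookup m i \<in> B i}"
proof -
  have *: "bij_betw Poly_Mapping.lookup {m. \<forall>i. Poly_Mapping.lookup m i \<in> B i} (PiE UNIV B)"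
    by (rule bij_betwI[where g = Abs_poly_mapping]) (auto simp: Poly_Mapping.lookup_inverse)
  show "card {m. \<forall>i. Poly_Mapping.lookup m i \<in> B i} = (\<Prod>i\<in>UNIV. card (B i))"
    using bij_betw_same_card[OF *] by (simp add: card_PiE)
  show "finite {m. \<forall>i. Poly_Mapping.lookup m i \<in> B i}" if "\<And>i. finite (B i)"
    using bij_betw_finite[OF *] that by (simp add: finite_PiE)
qed

definition tdeg :: "('n::finite \<Rightarrow>\<^sub>0 nat) \<Rightarrow> nat" where
  "tdeg m = (\<Sum>i\<in>UNIV. Poly_Mapping.lookup m i)"

lemma tdeg_add: "tdeg (a + b) = tdeg a + tdeg b"
  by (simp add: tdeg_def lookup_add sum.distrib)

lemma finite_tdeg: "finite {m :: 'n::finite \<Rightarrow>\<^sub>0 nat. tdeg m = d}"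
proof (rule finite_subset)
  show "{m. tdeg m = d} \<subseteq> {m. \<forall>i. Poly_Mapping.lookup m i \<in> {..d}}"
    by (auto simp: tdeg_def intro!: member_le_sum)
qed (intro card_exponent_box(2), simp)

text \<open>Only finitely many exponents share a total degree, so comparing by degree first yields a
  minimum even of an infinite set. This provides lowest terms of power series.\<close>

lemma graded_minimum:
  fixes S :: "('n::{finite,linorder} \<Rightarrow>\<^sub>0 nat) set"
  assumes "S \<noteq> {}"
  obtains m where "m \<in> S" "\<And>a. a \<in> S \<Longrightarrow> tdeg m < tdeg a \<or> tdeg m = tdeg a \<and> m \<le> a"
proof -
  define d where "d = (LEAST d. \<exists>a\<in>S. tdeg a = d)"
  have d: "\<exists>a\<in>S. tdeg a = d"
    unfolding d_def by (rule LeastI_ex) (use assms in auto)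
  have le: "d \<le> tdeg a" if "a \<in> S" for a
    unfolding d_def by (rule Least_le) (use that in auto)
  let ?T = "{a \<in> S. tdeg a = d}"
  have fin: "finite ?T"
    by (rule finite_subset[OF _ finite_tdeg[of d]]) auto
  have "?T \<noteq> {}" using d by auto
  then have min: "Min ?T \<in> ?T" using fin by (rule Min_in[rotated])
  have "Min ?T \<le> a" if "a \<in> ?T" for a
    by (rule Min_le[OF fin that])
  with min le that[of "Min ?T"] show ?thesis
    by (metis (mono_tags, lifting) mem_Collect_eq nat_less_le)
qed

text \<open>A power series is encoded as its coefficient function; this is its product with the
  monomial of exponent \<open>m\<close>.\<close>

definition shift :: "('n \<Rightarrow>\<^sub>0 nat) \<Rightarrow> (('n \<Rightarrow>\<^sub>0 nat) \<Rightarrow> 'k::field) \<Rightarrow> ('n \<Rightarrow>\<^sub>0 nat) \<Rightarrow> 'k" where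
  "shift m X a = (if mdvd m a then X (a - m) else 0)"

text \<open>The product of a polynomial with a power series. Each coefficient is a finite sum, so
  \<open>X\<close> may have infinite support.\<close>

definition pact :: "('n, 'k::field) mpoly \<Rightarrow> (('n \<Rightarrow>\<^sub>0 nat) \<Rightarrow> 'k) \<Rightarrow> ('n \<Rightarrow>\<^sub>0 nat) \<Rightarrow> 'k" where
  "pact p X a = (\<Sum>m \<in> Poly_Mapping.keys p. Poly_Mapping.lookup p m * shift m X a)"

lemma shift_linear [simp]:
  "shift m (\<lambda>a. X a + Z a) = (\<lambda>a. shift m X a + shift m Z a)"
  "shift m (\<lambda>a. X a - Z a) = (\<lambda>a. shift m X a - shift m Z a)"
  "shift m (\<lambda>a. c * X a) = (\<lambda>a. c * shift m X a)"
  "shift m (\<lambda>a. 0) = (\<lambda>a. 0)"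
  "shift m (\<lambda>a. \<Sum>t\<in>T. F t a) = (\<lambda>a. \<Sum>t\<in>T. shift m (F t) a)"
  by (auto simp: shift_def fun_eq_iff)

lemma shift_shift: "shift m (shift m' X) = shift (m + m') X"
proof
  fix a
  show "shift m (shift m' X) a = shift (m + m') X a"
  proof (cases "mdvd m a")
    case True
    then obtain b where [simp]: "a = m + b" by (rule mdvdE)
    have "a - m = b" by simp
    moreover have "m + b - (m + m') = b - m'"
      by (rule poly_mapping_eqI) (simp add: lookup_minus lookup_add)
    moreover have "mdvd (m + m') (m + b) \<longleftrightarrow> mdvd m' b"
      by (simp add: mdvd_def lookup_add)
    ultimately show ?thesis by (simp add: shift_def)
  next
    case False
    then have "\<not> mdvd (m + m') a"
      by (metis add_leE lookup_add mdvd_def)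
    with False show ?thesis by (simp add: shift_def)
  qed
qed

lemma pact_superset:
  assumes "finite S" "Poly_Mapping.keys p \<subseteq> S"
  shows "pact p X a = (\<Sum>m \<in> S. Poly_Mapping.lookup p m * shift m X a)"
  unfolding pact_def using assms by (intro sum.mono_neutral_left) (auto simp: in_keys_iff)

lemma pact_single: "pact (Poly_Mapping.single m c) X = (\<lambda>a. c * shift m X a)"
  by (rule ext, subst pact_superset[of "{m}"]) auto

lemma pact_zero_left [simp]: "pact 0 X = (\<lambda>a. 0)"
  by (simp add: pact_def fun_eq_iff)

lemma pact_add_left: "pact (p + q) X = (\<lambda>a. pact p X a + pact q X a)"
proof
  fix a
  let ?S = "Poly_Mapping.keys p \<union> Poly_Mapping.keys q"
  have "Poly_Mapping.keys (p + q) \<subseteq> ?S" by (rule keys_add)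
  then show "pact (p + q) X a = pact p X a + pact q X a"
    by (simp add: pact_superset[of ?S] lookup_add distrib_right sum.distrib)
qed

lemma pact_sum_left: "pact (\<Sum>t\<in>T. f t) X = (\<lambda>a. \<Sum>t\<in>T. pact (f t) X a)"
  by (induction T rule: infinite_finite_induct) (auto simp: pact_add_left)

lemma pact_linear [simp]:
  "pact p (\<lambda>a. X a + Z a) = (\<lambda>a. pact p X a + pact p Z a)"
  "pact p (\<lambda>a. X a - Z a) = (\<lambda>a. pact p X a - pact p Z a)"
  "pact p (\<lambda>a. c * X a) = (\<lambda>a. c * pact p X a)"
  "pact p (\<lambda>a. 0) = (\<lambda>a. 0)"
  by (auto simp: pact_def fun_eq_iff algebra_simps sum.distrib sum_subtractf sum_distrib_left)

lemma pact_sum_right: "pact p (\<lambda>a. \<Sum>t\<in>T. F t a) = (\<lambda>a. \<Sum>t\<in>T. pact p (F t) a)"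
  by (induction T rule: infinite_finite_induct) auto

lemma pact_mult: "pact (p * q) X = pact p (pact q X)"
proof (induction p rule: mpoly_add_induct)
  case (single m c)
  show ?case
    by (induction q rule: mpoly_add_induct)
      (auto simp: mult_single pact_single shift_shift mult.assoc distrib_left pact_add_left)
qed (simp add: distrib_right pact_add_left)

lemma pact_commute: "pact p (pact q X) = pact q (pact p X)"
  by (simp add: mult.commute flip: pact_mult)

text \<open>The lowest terms of \<open>p\<close> and \<open>X\<close> in the graded order multiply
  to a term that no other pair of terms reaches. Thus power series form a torsion-free
  module.\<close>

lemma pact_eq_0_iff:
  fixes p :: "('n::{finite,linorder}, 'k::field) mpoly"
  assumes "p \<noteq> 0"
  shows "pact p X = (\<lambda>a. 0) \<longleftrightarrow> X = (\<lambda>a. 0)"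
proof (rule iffI, rule ccontr)
  assume 0: "pact p X = (\<lambda>a. 0)" and X: "X \<noteq> (\<lambda>a. 0)"
  obtain b where b: "b \<in> Poly_Mapping.keys p"
    "\<And>a. a \<in> Poly_Mapping.keys p \<Longrightarrow> tdeg b < tdeg a \<or> tdeg b = tdeg a \<and> b \<le> a"
    by (rule graded_minimum[of "Poly_Mapping.keys p"]) (use assms in auto)
  obtain c where c: "X c \<noteq> 0"
    "\<And>a. X a \<noteq> 0 \<Longrightarrow> tdeg c < tdeg a \<or> tdeg c = tdeg a \<and> c \<le> a"
    by (rule graded_minimum[of "{a. X a \<noteq> 0}"]) (use X in auto)
  have "pact p X (b + c) = (\<Sum>m\<in>{b}. Poly_Mapping.lookup p m * shift m X (b + c))"
    unfolding pact_def
  proof (rule sum.mono_neutral_right)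
    show "\<forall>m \<in> Poly_Mapping.keys p - {b}. Poly_Mapping.lookup p m * shift m X (b + c) = 0"
    proof (intro ballI, rule ccontr)
      fix m
      assume m: "m \<in> Poly_Mapping.keys p - {b}" and "Poly_Mapping.lookup p m * shift m X (b + c) \<noteq> 0"
      then have "mdvd m (b + c)" and nz: "X (b + c - m) \<noteq> 0"
        by (auto simp: shift_def split: if_splits)
      then obtain a where a: "b + c = m + a" by (auto elim: mdvdE)
      with nz have "X a \<noteq> 0" by simp
      note ca = c(2)[OF this]
      from m have "m \<in> Poly_Mapping.keys p" by simp
      note bm = b(2)[OF this]
      \<comment> \<open>Neither degree can lie below its minimum, so both comparisons are ties and
        the linear order decides, as it is compatible with addition.\<close>
      have "tdeg b + tdeg c = tdeg m + tdeg a"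
        using arg_cong[OF a, of tdeg] by (simp add: tdeg_add)
      with ca bm have "b \<le> m" "c \<le> a" by auto
      moreover from this m have "b < m" by auto
      ultimately have "b + c < m + a" by (intro add_less_le_mono)
      with a show False by simp
    qed
  qed (use b in auto)
  also have "\<dots> = Poly_Mapping.lookup p b * X c"
    by (simp add: shift_def)
  finally show False
    using 0 b(1) c(1) by (simp add: in_keys_iff)
qed auto

lemma pact_cancel:
  fixes p :: "('n::{finite,linorder}, 'k::field) mpoly"
  assumes "p \<noteq> 0" "pact p X = pact p Z"
  shows "X = Z"
proof -
  have "pact p (\<lambda>a. X a - Z a) = (\<lambda>a. 0)"
    using assms by simp
  then show ?thesis
    unfolding pact_eq_0_iff[OF assms(1)] by (simp add: fun_eq_iff)
qed

section \<open>Divisibility of power series by polynomials\<close>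

definition sdvd :: "('n, 'k::field) mpoly \<Rightarrow> (('n \<Rightarrow>\<^sub>0 nat) \<Rightarrow> 'k) \<Rightarrow> bool" where
  "sdvd p X \<longleftrightarrow> (\<exists>Z. X = pact p Z)"

lemma sdvd_pact: "sdvd p X \<Longrightarrow> sdvd p (pact q X)"
  unfolding sdvd_def by (auto simp: pact_commute[of q])

lemma sdvd_diff: "sdvd p X \<Longrightarrow> sdvd p Z \<Longrightarrow> sdvd p (\<lambda>a. X a - Z a)"
  unfolding sdvd_def by (auto simp flip: pact_linear(2))

lemma sdvd_scale: "sdvd p X \<Longrightarrow> sdvd p (\<lambda>a. c * X a)"
  unfolding sdvd_def by (auto simp flip: pact_linear(3))

lemma sdvd_0: "sdvd p (\<lambda>a. 0)"
  unfolding sdvd_def by (rule exI[of _ "\<lambda>a. 0"]) simp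

lemma sdvd_sum: "(\<And>t. t \<in> T \<Longrightarrow> sdvd p (F t)) \<Longrightarrow> sdvd p (\<lambda>a. \<Sum>t\<in>T. F t a)"
proof -
  assume "\<And>t. t \<in> T \<Longrightarrow> sdvd p (F t)"
  then obtain Z where "\<And>t. t \<in> T \<Longrightarrow> F t = pact p (Z t)"
    unfolding sdvd_def by metis
  then have "(\<lambda>a. \<Sum>t\<in>T. F t a) = pact p (\<lambda>a. \<Sum>t\<in>T. Z t a)"
    by (simp add: pact_sum_right)
  then show ?thesis unfolding sdvd_def by blast
qed

lemma sdvd_shift: "sdvd p X \<Longrightarrow> sdvd p (shift m X)"
  using sdvd_pact[of p X "Poly_Mapping.single m 1"] by (simp add: pact_single)

definition vars_in :: "'n set \<Rightarrow> ('n, 'k::field) mpoly \<Rightarrow> bool" where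
  "vars_in V p \<longleftrightarrow> (\<forall>m \<in> Poly_Mapping.keys p. Poly_Mapping.keys m \<subseteq> V)"

lemma vars_in_lookup:
  "vars_in V p \<Longrightarrow> v \<notin> V \<Longrightarrow> m \<in> Poly_Mapping.keys p \<Longrightarrow> Poly_Mapping.lookup m v = 0"
  unfolding vars_in_def by (metis not_in_keys_iff_lookup_eq_zero subsetD)

text \<open>The coefficient of the \<open>k\<close>-th power of the variable \<open>v\<close>,
  viewed as a series in the other variables and therefore supported on exponents that vanish at
  \<open>v\<close>.\<close>

definition slice :: "'n \<Rightarrow> nat \<Rightarrow> (('n \<Rightarrow>\<^sub>0 nat) \<Rightarrow> 'k::field) \<Rightarrow> ('n \<Rightarrow>\<^sub>0 nat) \<Rightarrow> 'k" where
  "slice v k X a = (if Poly_Mapping.lookup a v = 0 then X (a + Poly_Mapping.single v k) else 0)"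

definition drop_var :: "'n \<Rightarrow> ('n \<Rightarrow>\<^sub>0 nat) \<Rightarrow> ('n \<Rightarrow>\<^sub>0 nat)" where
  "drop_var v m = m - Poly_Mapping.single v (Poly_Mapping.lookup m v)"

lemma lookup_drop_var:
  "Poly_Mapping.lookup (drop_var v m) i = (if i = v then 0 else Poly_Mapping.lookup m i)"
  by (simp add: drop_var_def lookup_minus lookup_single)

lemma drop_var_add: "drop_var v m + Poly_Mapping.single v (Poly_Mapping.lookup m v) = m"
  by (rule poly_mapping_eqI) (auto simp: lookup_add lookup_drop_var lookup_single)

lemma slice_shift:
  "slice v k (shift m X) = (if Poly_Mapping.lookup m v \<le> k
     then shift (drop_var v m) (slice v (k - Poly_Mapping.lookup m v) X) else (\<lambda>a. 0))"
proof
  fix a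
  let ?l = "Poly_Mapping.lookup m v"
  show "slice v k (shift m X) a = (if ?l \<le> k then shift (drop_var v m) (slice v (k - ?l) X) else (\<lambda>a. 0)) a"
  proof (cases "Poly_Mapping.lookup a v = 0")
    case True
    have 1: "mdvd m (a + Poly_Mapping.single v k) \<longleftrightarrow> ?l \<le> k \<and> mdvd (drop_var v m) a"
      using True unfolding mdvd_def by (auto simp: lookup_add lookup_drop_var lookup_single when_def)
    have 2: "a + Poly_Mapping.single v k - m = (a - drop_var v m) + Poly_Mapping.single v (k - ?l)"
      if "?l \<le> k"
      by (rule poly_mapping_eqI)
        (use that True in \<open>auto simp: lookup_add lookup_minus lookup_drop_var lookup_single when_def\<close>)
    have 3: "Poly_Mapping.lookup (a - drop_var v m) v = 0"
      using True by (simp add: lookup_minus)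
    show ?thesis
      using True by (simp add: slice_def shift_def 1 2 3)
  next
    case False
    then show ?thesis
      by (simp add: slice_def shift_def lookup_minus lookup_drop_var)
  qed
qed

lemma slice_sum: "slice v k (\<lambda>a. \<Sum>t\<in>T. c t * F t a) = (\<lambda>a. \<Sum>t\<in>T. c t * slice v k (F t) a)"
  by (auto simp: slice_def fun_eq_iff)

lemma slice_pact:
  assumes "vars_in W p" "v \<notin> W"
  shows "slice v k (pact p X) = pact p (slice v k X)"
proof -
  have "Poly_Mapping.lookup m v = 0" if "m \<in> Poly_Mapping.keys p" for m
    using vars_in_lookup[OF assms that] .
  moreover from this have "drop_var v m = m" if "m \<in> Poly_Mapping.keys p" for m
    using that by (simp add: drop_var_def)
  ultimately have *: "slice v k (shift m X) = shift m (slice v k X)" if "m \<in> Poly_Mapping.keys p" for m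
    using that by (simp add: slice_shift)
  have "slice v k (pact p X) = slice v k (\<lambda>a. \<Sum>m \<in> Poly_Mapping.keys p. Poly_Mapping.lookup p m * shift m X a)"
    by (simp add: pact_def[abs_def])
  also have "\<dots> = pact p (slice v k X)"
    by (auto simp: slice_sum pact_def fun_eq_iff * intro!: sum.cong)
  finally show ?thesis .
qed

text \<open>A polynomial free of \<open>v\<close> acts on every slice separately, so quotients
  \<open>Z k\<close> of the slices can be glued to one quotient with slices
  \<open>Z k\<close>.\<close>

lemma sdvd_if_slices:
  assumes p: "vars_in W p" "v \<notin> W" and "\<And>k. sdvd p (slice v k X)"
  shows "sdvd p X"
proof -
  from assms(3) obtain Z where Z: "\<And>k. slice v k X = pact p (Z k)"
    unfolding sdvd_def by metis
  define Z' where "Z' a = Z (Poly_Mapping.lookup a v) (drop_var v a)" for a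
  have m0: "Poly_Mapping.lookup m v = 0" if "m \<in> Poly_Mapping.keys p" for m
    using vars_in_lookup[OF p that] .
  have "X a = pact p Z' a" for a
  proof -
    let ?k = "Poly_Mapping.lookup a v"
    have "shift m Z' a = shift m (Z ?k) (drop_var v a)" if "m \<in> Poly_Mapping.keys p" for m
    proof -
      have "mdvd m a \<longleftrightarrow> mdvd m (drop_var v a)"
        using m0[OF that] unfolding mdvd_def by (auto simp: lookup_drop_var) (metis le0)+
      moreover have "drop_var v (a - m) = drop_var v a - m"
        by (rule poly_mapping_eqI) (simp add: lookup_drop_var lookup_minus)
      ultimately show ?thesis
        by (simp add: shift_def Z'_def lookup_minus m0[OF that])
    qed
    then have "pact p Z' a = pact p (Z ?k) (drop_var v a)"
      by (simp add: pact_def)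
    also have "\<dots> = X a"
      by (simp add: Z[symmetric] slice_def lookup_drop_var drop_var_add)
    finally show ?thesis by simp
  qed
  then have "X = pact p Z'" by (rule ext)
  then show ?thesis unfolding sdvd_def by blast
qed

text \<open>
  Here \<open>q'\<close> is the coefficient of the lowest power of \<open>v\<close> in \<open>q\<close>: in the product with \<open>X\<close> the higher powers
  only meet slices of \<open>X\<close> below \<open>k\<close>.
\<close>

lemma lowest_slice:
  fixes q :: "('n::{finite,linorder}, 'k::field) mpoly"
  assumes q: "q \<noteq> 0" "vars_in (insert v V) q"
  obtains q' l where "q' \<noteq> 0" "vars_in V q'" 
    "\<And>p X k. vars_in W p \<Longrightarrow> v \<notin> W \<Longrightarrow> sdvd p (pact q X) \<Longrightarrow> (\<And>j. j < k \<Longrightarrow> sdvd p (slice v j X)) \<Longrightarrow>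
       sdvd p (pact q' (slice v k X))"
proof -
  let ?v = "\<lambda>m. Poly_Mapping.lookup m v"
  let ?K = "Poly_Mapping.keys q"
  define l where "l = Min (?v ` ?K)"
  have l_le: "l \<le> ?v m" if "m \<in> ?K" for m
    unfolding l_def using that by simp
  have "l \<in> ?v ` ?K"
    unfolding l_def by (rule Min_in) (use q in auto)
  then obtain m0 where m0: "m0 \<in> ?K" "?v m0 = l" by auto
  define T where "T = {m \<in> ?K. ?v m = l}"
  have T: "finite T" "T \<subseteq> ?K" "m0 \<in> T" by (auto simp: T_def m0)
  define q' where "q' = (\<Sum>m\<in>T. Poly_Mapping.single (drop_var v m) (Poly_Mapping.lookup q m))"
  \<comment> \<open>All exponents in \<open>T\<close> agree at \<open>v\<close>, so they stay
    distinct when \<open>v\<close> is dropped and no cancellation occurs in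
    \<open>q'\<close>.\<close>
  have inj: "drop_var v m = drop_var v m' \<longleftrightarrow> m = m'" if "m \<in> T" "m' \<in> T" for m m'
    using that drop_var_add by (metis (mono_tags, lifting) T_def mem_Collect_eq)
  have "Poly_Mapping.lookup q' (drop_var v m0) = (\<Sum>m\<in>T. if m = m0 then Poly_Mapping.lookup q m else 0)"
    unfolding q'_def lookup_sum by (intro sum.cong) (auto simp: lookup_single when_def inj m0 T_def)
  also have "\<dots> = Poly_Mapping.lookup q m0"
    using T by simp
  finally have "q' \<noteq> 0"
    using m0 by (auto simp: in_keys_iff)
  moreover have "vars_in V q'"
    unfolding vars_in_def
  proof
    fix b assume "b \<in> Poly_Mapping.keys q'"
    then have "Poly_Mapping.lookup q' b \<noteq> 0" by (simp add: in_keys_iff)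
    then obtain m where m: "m \<in> T"
        "Poly_Mapping.lookup (Poly_Mapping.single (drop_var v m) (Poly_Mapping.lookup q m)) b \<noteq> 0"
      unfolding q'_def lookup_sum by (rule sum.not_neutral_contains_not_neutral)
    then have "b = drop_var v m"
      using lookup_single_not_eq[of "drop_var v m" b] by blast
    then have "Poly_Mapping.keys b \<subseteq> Poly_Mapping.keys m - {v}"
      by (auto simp: in_keys_iff lookup_drop_var split: if_splits)
    then show "Poly_Mapping.keys b \<subseteq> V"
      using q(2) T(2) m(1) unfolding vars_in_def by blast
  qed
  moreover have "sdvd p (pact q' (slice v k X))"
    if p: "vars_in W p" "v \<notin> W" "sdvd p (pact q X)" and less: "\<And>j. j < k \<Longrightarrow> sdvd p (slice v j X)" for p X k
  proof -
    let ?f = "\<lambda>m a. Poly_Mapping.lookup q m * slice v (k + l) (shift m X) a"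
    obtain Z where "pact q X = pact p Z"
      using p(3) unfolding sdvd_def by blast
    then have "sdvd p (slice v (k + l) (pact q X))"
      unfolding sdvd_def by (auto simp: slice_pact[OF p(1,2)])
    moreover have "slice v (k + l) (pact q X) = (\<lambda>a. \<Sum>m \<in> ?K. ?f m a)"
      by (simp add: pact_def[abs_def] slice_sum)
    ultimately have 1: "sdvd p (\<lambda>a. \<Sum>m \<in> ?K. ?f m a)"
      by simp
    have 2: "sdvd p (\<lambda>a. \<Sum>m \<in> ?K - T. ?f m a)"
    proof (intro sdvd_sum sdvd_scale)
      fix m assume "m \<in> ?K - T"
      then have "l < ?v m"
        using l_le[of m] by (auto simp: T_def)
      then show "sdvd p (slice v (k + l) (shift m X))"
        by (auto simp: slice_shift sdvd_0 intro!: sdvd_shift less)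
    qed
    have "pact q' (slice v k X) = (\<lambda>a. \<Sum>m\<in>T. ?f m a)"
      unfolding q'_def pact_sum_left by (auto simp: pact_single slice_shift T_def fun_eq_iff intro!: sum.cong)
    also have "\<dots> = (\<lambda>a. (\<Sum>m\<in>?K. ?f m a) - (\<Sum>m\<in>?K - T. ?f m a))"
      using T by (auto simp: fun_eq_iff sum_diff)
    finally show ?thesis
      using sdvd_diff[OF 1 2] by simp
  qed
  ultimately show ?thesis using that by metis
qed

text \<open>
  Passing from \<open>D\<close> to \<open>\<rho>\<^sub>v\<close> makes the divisor free of the variable \<open>v\<close>, so that divisibility can be
  tested on the coefficients of the powers of \<open>v\<close>.
\<close>

lemma sdvd_common_multiples:
  fixes D :: "('n::{finite,linorder}, 'k::field) mpoly"
  assumes "finite V" "D \<noteq> 0" "vars_in V D"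
    and "\<And>i. i \<in> V \<Longrightarrow> \<rho> i \<noteq> 0 \<and> vars_in (V - {i}) (\<rho> i) \<and> sdvd D (pact (\<rho> i) G)"
  shows "sdvd D G"
  using assms
proof (induction V arbitrary: D G \<rho>)
  case empty
  \<comment> \<open>Without variables \<open>D\<close> is a nonzero constant, hence
    invertible.\<close>
  then have "Poly_Mapping.keys D \<subseteq> {0}"
    unfolding vars_in_def by auto
  then have D: "D = Poly_Mapping.single 0 (Poly_Mapping.lookup D 0)"
    by (intro poly_mapping_eqI) (auto simp: lookup_single when_def in_keys_iff)
  then have "Poly_Mapping.lookup D 0 \<noteq> 0"
    using empty(1) by (metis single_zero)
  then have "G = pact D (\<lambda>a. inverse (Poly_Mapping.lookup D 0) * G a)"
    by (subst D) (simp add: pact_single shift_def mdvd_def fun_eq_iff)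
  then show ?case unfolding sdvd_def by blast
next
  case (insert v W)
  define p where "p = \<rho> v"
  have p: "p \<noteq> 0" "vars_in W p"
    using insert.prems(3)[of v] insert.hyps by (auto simp: p_def)
  obtain H where H: "pact p G = pact D H"
    using insert.prems(3)[of v] unfolding sdvd_def p_def by auto
  have pH: "sdvd p (pact (\<rho> i) H)" if iW: "i \<in> W" for i
  proof -
    obtain Hi where Hi: "pact (\<rho> i) G = pact D Hi"
      using insert.prems(3)[of i] iW unfolding sdvd_def by auto
    \<comment> \<open>Both sides are the product of \<open>p\<close>, \<open>\<rho> i\<close> and
      \<open>G\<close>. Cancelling \<open>D\<close> shows that \<open>p\<close> divides the product
      of \<open>\<rho> i\<close> and \<open>H\<close>.\<close>
    have "pact D (pact (\<rho> i) H) = pact D (pact p Hi)"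
      by (metis H Hi pact_commute)
    with pact_cancel[OF insert.prems(1)] show ?thesis
      unfolding sdvd_def by blast
  qed
  have "\<exists>q. q \<noteq> 0 \<and> vars_in (W - {i}) q \<and> 
     (\<forall>k. (\<forall>j<k. sdvd p (slice v j H)) \<longrightarrow> sdvd p (pact q (slice v k H)))" if "i \<in> W" for i
  proof -
    have "v \<noteq> i"
      using insert.hyps that by auto
    then have "vars_in (insert v (W - {i})) (\<rho> i)" "\<rho> i \<noteq> 0"
      using insert.prems(3)[of i] that by (auto simp: insert_Diff_if)
    then show ?thesis
      by (rule_tac lowest_slice[of "\<rho> i" v "W - {i}" W]) (use p(2) insert.hyps pH[OF that] in blast)+
  qed
  then have "\<exists>q. \<forall>i\<in>W. q i \<noteq> 0 \<and> vars_in (W - {i}) (q i) \<and>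
     (\<forall>k. (\<forall>j<k. sdvd p (slice v j H)) \<longrightarrow> sdvd p (pact (q i) (slice v k H)))"
    by (intro bchoice) blast
  then obtain q where q: "\<And>i. i \<in> W \<Longrightarrow> q i \<noteq> 0 \<and> vars_in (W - {i}) (q i)"
     "\<And>i k. i \<in> W \<Longrightarrow> (\<And>j. j < k \<Longrightarrow> sdvd p (slice v j H)) \<Longrightarrow> sdvd p (pact (q i) (slice v k H))"
    by blast
  \<comment> \<open>Once all lower slices are divisible by \<open>p\<close>, the lowest coefficients
    \<open>q i\<close> are multipliers for slice \<open>k\<close>, and the outer induction
    hypothesis applies over the smaller set \<open>W\<close> with divisor \<open>p\<close>.\<close>
  have "sdvd p (slice v k H)" for k
  proof (induction k rule: less_induct)
    case (less k)
    show ?case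
      by (rule insert.IH[OF p, of q]) (use q less in blast)
  qed
  then have "sdvd p H"
    using sdvd_if_slices[OF p(2)] insert.hyps by blast
  then obtain X where "H = pact p X" unfolding sdvd_def by blast
  then have "pact p G = pact p (pact D X)"
    using H by (metis pact_commute)
  then have "G = pact D X" by (rule pact_cancel[OF p(1)])
  then show ?case unfolding sdvd_def by blast
qed

section \<open>Counting monomials\<close>

text \<open>There are more unknowns than equations. Gaussian elimination with a pivot
  \<open>t\<close> removes the equation \<open>b\<close> together with one unknown.\<close>

lemma nontrivial_linear_relation:
  fixes f :: "'s \<Rightarrow> 'b \<Rightarrow> 'k::field"
  assumes "finite B" "finite S" "card B < card S"
  shows "\<exists>c. (\<exists>s\<in>S. c s \<noteq> 0) \<and> (\<forall>b\<in>B. (\<Sum>s\<in>S. c s * f s b) = 0)"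
  using assms
proof (induction B arbitrary: S f)
  case empty
  then show ?case by (intro exI[of _ "\<lambda>_. 1"]) (auto simp: card_gt_0_iff)
next
  case (insert b B)
  show ?case
  proof (cases "\<forall>s\<in>S. f s b = 0")
    case True
    have "card B < card S" using insert by simp
    from insert.IH[OF insert.prems(1) this, of f] True show ?thesis by auto
  next
    case False
    then obtain t where t: "t \<in> S" "f t b \<noteq> 0" by auto
    let ?g = "\<lambda>s x. f s x - f s b / f t b * f t x"
    have "card B < card (S - {t})" using insert t by simp
    from insert.IH[OF _ this, of ?g] insert.prems(1) obtain c
      where c: "\<exists>s\<in>S - {t}. c s \<noteq> 0" "\<And>x. x \<in> B \<Longrightarrow> (\<Sum>s\<in>S - {t}. c s * ?g s x) = 0"
      by auto
    \<comment> \<open>The value \<open>- e\<close> at the pivot is forced by the eliminated equation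
      \<open>b\<close>.\<close>
    define e where "e = (\<Sum>s\<in>S - {t}. c s * (f s b / f t b))"
    define c' where "c' = c(t := - e)"
    have sum: "(\<Sum>s\<in>S. c' s * f s x) = (\<Sum>s\<in>S - {t}. c s * ?g s x)" for x
    proof -
      have "(\<Sum>s\<in>S. c' s * f s x) = - e * f t x + (\<Sum>s\<in>S - {t}. c s * f s x)"
        using t insert.prems(1) by (subst sum.remove[of S t]) (auto simp: c'_def intro!: sum.cong)
      also have "\<dots> = (\<Sum>s\<in>S - {t}. c s * f s x - c s * (f s b / f t b) * f t x)"
        by (simp add: e_def sum_subtractf sum_distrib_right)
      finally show ?thesis by (simp add: algebra_simps)
    qed
    have "(\<Sum>s\<in>S - {t}. c s * ?g s b) = 0"
      using t by (intro sum.neutral) auto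
    with c sum show ?thesis
      by (intro exI[of _ c']) (auto simp: c'_def)
  qed
qed

section \<open>Polynomials in few variables with bounded exponents\<close>

lemma vars_in_add: "vars_in V p \<Longrightarrow> vars_in V q \<Longrightarrow> vars_in V (p + q)"
  unfolding vars_in_def using keys_add[of p q] by blast

lemma vars_in_0 [simp]: "vars_in V 0" and vars_in_Const [simp]: "vars_in V (Const c)"
  by (auto simp: vars_in_def Const_def)

lemma vars_in_1 [simp]: "vars_in V 1"
  using vars_in_Const[of V 1] by simp

lemma vars_in_mult:
  fixes p q :: "('n, 'k::field) mpoly"
  assumes "vars_in V p" "vars_in V q"
  shows "vars_in V (p * q)"
  unfolding vars_in_def
proof
  fix m assume "m \<in> Poly_Mapping.keys (p * q)"
  then obtain a b where "m = a + b" "a \<in> Poly_Mapping.keys p" "b \<in> Poly_Mapping.keys q"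
    using keys_mult[of p q] by auto
  then show "Poly_Mapping.keys m \<subseteq> V"
    using assms keys_add[of a b] unfolding vars_in_def by blast
qed

lemma vars_in_power: "vars_in V p \<Longrightarrow> vars_in V (p ^ k)"
  by (induction k) (auto intro: vars_in_mult)

lemma vars_in_prod: "(\<And>x. x \<in> S \<Longrightarrow> vars_in V (f x)) \<Longrightarrow> vars_in V (prod f S)"
  by (induction S rule: infinite_finite_induct) (auto intro: vars_in_mult)

lemma vars_in_sum: "(\<And>x. x \<in> S \<Longrightarrow> vars_in V (f x)) \<Longrightarrow> vars_in V (sum f S)"
  by (induction S rule: infinite_finite_induct) (auto intro: vars_in_add)

lemma vars_in_Var: "i \<in> V \<Longrightarrow> vars_in V (Var i)"
  by (auto simp: vars_in_def Var_def)

lemma vars_in_subst: "(\<And>i. vars_in V (f i)) \<Longrightarrow> vars_in V (subst f p)"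
  unfolding subst_def by (intro vars_in_sum vars_in_mult vars_in_prod vars_in_power vars_in_Const)

lemma Const_diff: "Const (a - b) = Const a - Const b"
  by (simp add: Const_def single_diff)

definition exponent_bound :: "nat \<Rightarrow> ('n, 'k::field) mpoly \<Rightarrow> bool" where
  "exponent_bound L p \<longleftrightarrow> (\<forall>m \<in> Poly_Mapping.keys p. \<forall>i. Poly_Mapping.lookup m i \<le> L)"

lemma exponent_bound_mult:
  fixes p q :: "('n, 'k::field) mpoly"
  assumes "exponent_bound L p" "exponent_bound L' q"
  shows "exponent_bound (L + L') (p * q)"
  unfolding exponent_bound_def
proof (intro ballI allI)
  fix m i assume "m \<in> Poly_Mapping.keys (p * q)"
  then obtain a b where "m = a + b" "a \<in> Poly_Mapping.keys p" "b \<in> Poly_Mapping.keys q"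
    using keys_mult[of p q] by auto
  then show "Poly_Mapping.lookup m i \<le> L + L'"
    using assms unfolding exponent_bound_def by (auto simp: lookup_add intro!: add_mono)
qed

lemma exponent_bound_1 [simp]: "exponent_bound L 1"
  by (simp add: exponent_bound_def)

lemma exponent_bound_power: "exponent_bound L p \<Longrightarrow> exponent_bound (k * L) (p ^ k)"
  by (induction k) (auto intro: exponent_bound_mult)

lemma exponent_bound_prod:
  "(\<And>x. x \<in> S \<Longrightarrow> exponent_bound (L x) (f x)) \<Longrightarrow> exponent_bound (sum L S) (prod f S)"
  by (induction S rule: infinite_finite_induct) (auto intro: exponent_bound_mult)

lemma exponent_bound_mono: "exponent_bound L p \<Longrightarrow> L \<le> L' \<Longrightarrow> exponent_bound L' p"
  unfolding exponent_bound_def by (meson le_trans)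

lemma exponent_bound_exists: "\<exists>L. exponent_bound L (p :: ('n::finite, 'k::field) mpoly)"
proof
  show "exponent_bound (\<Sum>m\<in>Poly_Mapping.keys p. tdeg m) p"
    unfolding exponent_bound_def tdeg_def
    by (metis (mono_tags, lifting) UNIV_I finite_code finite_keys le_trans member_le_sum zero_le)
qed

text \<open>
  The \<open>T\<^sup>n\<^sup>-\<^sup>1\<close> monomials in the \<open>f j\<close> (with \<open>j \<noteq> i\<close>) with exponents less than \<open>T\<close> lie in a space of
  dimension \<open>O(T\<^sup>n\<^sup>-\<^sup>2)\<close>.
\<close>

lemma algebraic_dependence:
  fixes f :: "'n::finite \<Rightarrow> ('n, 'k::field) mpoly"
  assumes uv: "u \<noteq> v" and f: "\<And>j. vars_in (UNIV - {u, v}) (f j)"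
  obtains \<rho> :: "('n, 'k) mpoly" where "\<rho> \<noteq> 0" "vars_in (UNIV - {i}) \<rho>" "subst f \<rho> = 0"
proof -
  let ?n = "CARD('n)"
  obtain L0 where "\<And>j. exponent_bound (L0 j) (f j)"
    using exponent_bound_exists[of "f _"] by (metis (no_types))
  define L where "L = sum L0 UNIV"
  have L: "exponent_bound L (f j)" for j
    by (rule exponent_bound_mono[OF \<open>exponent_bound (L0 j) (f j)\<close>]) (auto simp: L_def intro: member_le_sum)
  \<comment> \<open>The constants give \<open>?n * T * L + 1 \<le> C * T\<close> and
    \<open>C ^ (?n - 2) < T\<close>, whence \<open>(C * T) ^ (?n - 2) < T ^ (?n - 1)\<close>: more
    products than monomials available for them.\<close>
  define C where "C = ?n * L + 1"
  define T where "T = C ^ (?n - 2) + 1"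
  define mon where "mon m = (\<Prod>j\<in>UNIV. f j ^ Poly_Mapping.lookup m j)" for m
  \<comment> \<open>\<open>S\<close> lists the exponents of products of the \<open>f j\<close>, with
    exponent 0 at \<open>i\<close> so that the relation avoids this variable. \<open>B\<close>
    contains all exponents that occur in such products, which involve neither \<open>u\<close> nor
    \<open>v\<close>.\<close>
  define S where "S = {m. \<forall>k. Poly_Mapping.lookup m k \<in> (if k = i then {0} else {..<T})}"
  define B where "B = {m. \<forall>k. Poly_Mapping.lookup m k \<in> (if k \<in> {u, v} then {0} else {..?n * T * L})}"
  have n2: "?n \<ge> 2"
    using card_mono[of UNIV "{u, v}"] uv by simp
  have uv_set: "{x. x = u \<or> x = v} = {u, v}" by auto
  have "card B = (\<Prod>k\<in>UNIV. if k \<in> {u, v} then 1 else ?n * T * L + 1)"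
    unfolding B_def card_exponent_box by (intro prod.cong) auto
  also have "\<dots> = (?n * T * L + 1) ^ (?n - 2)"
    using uv by (subst prod.If_cases)
      (auto simp: Diff_eq[symmetric] Compl_eq_Diff_UNIV card_Diff_subset uv_set numeral_2_eq_2)
  also have "\<dots> \<le> (C * T) ^ (?n - 2)"
    by (intro power_mono) (auto simp: C_def T_def algebra_simps)
  also have "\<dots> < T * T ^ (?n - 2)"
    unfolding power_mult_distrib by (intro mult_strict_right_mono) (auto simp: T_def)
  also have "\<dots> = T ^ (?n - 1)"
  proof -
    have "?n - 1 = Suc (?n - 2)" using n2 by linarith
    then show ?thesis by simp
  qed
  also have "\<dots> = (\<Prod>k\<in>UNIV. if k = i then 1 else T)"
    by (subst prod.If_cases) (auto simp: Diff_eq[symmetric] Compl_eq_Diff_UNIV card_Diff_subset)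
  also have "\<dots> = card S"
    unfolding S_def card_exponent_box by (intro prod.cong) auto
  finally have "card B < card S" .
  moreover have fin: "finite B" "finite S"
    unfolding B_def S_def by (rule card_exponent_box(2), simp)+
  ultimately obtain c where c: "\<exists>s\<in>S. c s \<noteq> 0"
    "\<And>b. b \<in> B \<Longrightarrow> (\<Sum>s\<in>S. c s * Poly_Mapping.lookup (mon s) b) = 0"
    using nontrivial_linear_relation[of B S "\<lambda>s. Poly_Mapping.lookup (mon s)"] by blast
  define \<rho> where "\<rho> = (\<Sum>s\<in>S. Poly_Mapping.single s (c s))"
  have lookup_\<rho>: "Poly_Mapping.lookup \<rho> m = (if m \<in> S then c m else 0)" for m
    using fin by (simp add: \<rho>_def lookup_sum lookup_single when_def)
  have monB: "Poly_Mapping.keys (mon s) \<subseteq> B" if "s \<in> S" for s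
  proof
    fix b assume b: "b \<in> Poly_Mapping.keys (mon s)"
    have "vars_in (UNIV - {u, v}) (mon s)"
      unfolding mon_def by (intro vars_in_prod vars_in_power f)
    then have "Poly_Mapping.lookup b k = 0" if k: "k \<in> {u, v}" for k
      by (rule vars_in_lookup[OF _ _ b]) (use k in auto)
    moreover have "exponent_bound (?n * T * L) (mon s)"
    proof (rule exponent_bound_mono)
      show "exponent_bound (\<Sum>j\<in>UNIV. Poly_Mapping.lookup s j * L) (mon s)"
        unfolding mon_def by (intro exponent_bound_prod exponent_bound_power L)
      have "Poly_Mapping.lookup s j \<le> T" for j
        using that[unfolded S_def, simplified, rule_format, of j] by (cases "j = i") auto
      then have "(\<Sum>j\<in>UNIV. Poly_Mapping.lookup s j * L) \<le> (\<Sum>j\<in>(UNIV::'n set). T * L)"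
        by (intro sum_mono mult_right_mono) auto
      then show "(\<Sum>j\<in>UNIV. Poly_Mapping.lookup s j * L) \<le> ?n * T * L" by simp
    qed
    then have "Poly_Mapping.lookup b k \<le> ?n * T * L" for k
      using b by (simp add: exponent_bound_def)
    ultimately show "b \<in> B" by (simp add: B_def)
  qed
  show ?thesis
  proof (rule that[of \<rho>])
    show "\<rho> \<noteq> 0"
    proof
      assume "\<rho> = 0"
      then have "\<And>m. (if m \<in> S then c m else 0) = 0"
        by (simp flip: lookup_\<rho>)
      with c(1) show False by meson
    qed
    show "vars_in (UNIV - {i}) \<rho>"
      unfolding vars_in_def
    proof (intro ballI subsetI)
      fix m k assume "m \<in> Poly_Mapping.keys \<rho>" and k: "k \<in> Poly_Mapping.keys m"
      then have "m \<in> S" by (auto simp: in_keys_iff lookup_\<rho> split: if_splits)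
      then have "\<forall>k. Poly_Mapping.lookup m k \<in> (if k = i then {0} else {..<T})"
        by (simp add: S_def)
      from spec[OF this, of i] have "Poly_Mapping.lookup m i = 0" by simp
      with k show "k \<in> UNIV - {i}" by (auto simp: in_keys_iff)
    qed
    show "subst f \<rho> = 0"
    proof (rule poly_mapping_eqI)
      fix b
      have "Poly_Mapping.lookup (subst f \<rho>) b = (\<Sum>s\<in>S. c s * Poly_Mapping.lookup (mon s) b)"
        by (simp add: \<rho>_def subst_sum subst_single lookup_sum lookup_Const_mult mon_def)
      also have "\<dots> = 0"
      proof (cases "b \<in> B")
        case False
        then have "\<And>s. s \<in> S \<Longrightarrow> Poly_Mapping.lookup (mon s) b = 0"
          using monB by (meson in_keys_iff subsetD)
        then show ?thesis by simp
      qed (rule c(2))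
      finally show "Poly_Mapping.lookup (subst f \<rho>) b = Poly_Mapping.lookup 0 b" by simp
    qed
  qed
qed

text \<open>Congruence modulo the ideal \<open>I\<close> respects products, hence powers, monomials
  and finally sums of terms.\<close>

lemma subst_congruence:
  fixes p :: "('n::finite, 'k::field) mpoly" and f g :: "'n \<Rightarrow> ('m, 'k) mpoly"
  assumes I_add: "\<And>p q. p \<in> I \<Longrightarrow> q \<in> I \<Longrightarrow> p + q \<in> I" and I_mult: "\<And>p q. p \<in> I \<Longrightarrow> q * p \<in> I"
    and fg: "\<And>i. f i - g i \<in> I" and I0: "0 \<in> I"
  shows "subst f p - subst g p \<in> I"
proof -
  have mult: "a * b - a' * b' \<in> I" if "a - a' \<in> I" "b - b' \<in> I" for a b a' b'
  proof -
    have "a * b - a' * b' = b * (a - a') + a' * (b - b')" by (simp add: algebra_simps)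
    then show ?thesis using that I_add I_mult by simp
  qed
  have power: "f i ^ k - g i ^ k \<in> I" for i k
    by (induction k) (auto simp: I0 intro: mult fg)
  have prod: "(\<Prod>i\<in>S. f i ^ e i) - (\<Prod>i\<in>S. g i ^ e i) \<in> I" for S and e :: "'n \<Rightarrow> nat"
    by (induction S rule: infinite_finite_induct) (auto simp: I0 intro: mult power)
  show ?thesis
  proof (induction p rule: mpoly_add_induct)
    case (single m c)
    show ?case
      by (simp add: subst_single I_mult prod flip: right_diff_distrib)
  next
    case (add p q)
    then show ?case
      using I_add[of "subst f p - subst g p" "subst f q - subst g q"] by (simp add: subst_add algebra_simps)
  qed
qed

text \<open>Modulo two independent linear forms only \<open>n - 2\<close> variables remain.\<close>

lemma dependence_modulo_linear_forms:
  fixes y :: "'n::finite \<Rightarrow> ('n, 'k::field) mpoly" and a b :: "'n \<Rightarrow> 'k"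
  assumes \<Delta>: "a u * b v - a v * b u \<noteq> 0"
  obtains \<rho> :: "('n, 'k) mpoly" and e e' where "\<rho> \<noteq> 0" "vars_in (UNIV - {i}) \<rho>"
    "subst y \<rho> = e * (\<Sum>j\<in>UNIV. Const (a j) * Var j) + e' * (\<Sum>j\<in>UNIV. Const (b j) * Var j)"
proof -
  define \<Delta> where "\<Delta> = a u * b v - a v * b u"
  have \<Delta>0: "\<Delta> \<noteq> 0" using \<Delta> by (simp add: \<Delta>_def)
  define l where "l = (\<Sum>j\<in>UNIV. Const (a j) * Var j :: ('n, 'k) mpoly)"
  define l' where "l' = (\<Sum>j\<in>UNIV. Const (b j) * Var j :: ('n, 'k) mpoly)"
  define I where "I = {e * l + e' * l' | e e'. True}"
  have I_add: "p + q \<in> I" if "p \<in> I" "q \<in> I" for p q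
  proof -
    from that obtain e1 e1' e2 e2' where "p = e1 * l + e1' * l'" "q = e2 * l + e2' * l'"
      unfolding I_def by blast
    then have "p + q = (e1 + e2) * l + (e1' + e2') * l'" by (simp add: algebra_simps)
    then show ?thesis unfolding I_def by blast
  qed
  have I_mult: "q * p \<in> I" if "p \<in> I" for p q
  proof -
    from that obtain e1 e1' where "p = e1 * l + e1' * l'"
      unfolding I_def by blast
    then have "q * p = (q * e1) * l + (q * e1') * l'" by (simp add: algebra_simps)
    then show ?thesis unfolding I_def by blast
  qed
  have I0: "0 \<in> I"
    unfolding I_def by (auto intro!: exI[of _ 0])
  have uv: "u \<noteq> v" using \<Delta> by auto
  \<comment> \<open>Cramer's rule: for \<open>k\<close> in \<open>{u, v}\<close> the form
    \<open>Const (s k) * l + Const (t k) * l'\<close> has coefficient 1 at \<open>k\<close> and 0 at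
    the other index. Subtracting it from \<open>Var k\<close> removes both variables.\<close>
  define s t where "s k = (if k = u then b v / \<Delta> else if k = v then - b u / \<Delta> else 0)"
    and "t k = (if k = u then - a v / \<Delta> else if k = v then a u / \<Delta> else 0)" for k
  define \<sigma> where "\<sigma> k = Var k - (Const (s k) * l + Const (t k) * l')" for k
  have \<sigma>_I: "Var k - \<sigma> k \<in> I" for k
    unfolding I_def \<sigma>_def by auto
  have \<sigma>_eq: "\<sigma> k = (\<Sum>j\<in>UNIV. Const ((if j = k then 1 else 0) - (s k * a j + t k * b j)) * Var j)" for k
  proof -
    have "Var k = (\<Sum>j\<in>UNIV. Const (if j = k then 1 else 0) * Var j :: ('n, 'k) mpoly)"
      by (simp add: if_distrib[where f = Const] if_distrib[where f = "\<lambda>x. x * _"] cong: if_cong)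
    then show ?thesis
      unfolding \<sigma>_def l_def l'_def
      by (simp only: Const_diff Const_add left_diff_distrib distrib_right sum_subtractf sum.distrib sum_distrib_left Const_mult mult.assoc)
  qed
  have "s k * a j + t k * b j = (if j = k then 1 else 0)" if "j \<in> {u, v}" for j k
    using that uv \<Delta>0 by (auto simp: s_def t_def divide_simps) (simp_all add: \<Delta>_def algebra_simps)
  then have "vars_in (UNIV - {u, v}) (\<sigma> k)" for k
    unfolding \<sigma>_eq
  proof (intro vars_in_sum)
    fix j
    assume *: "\<And>j k. j \<in> {u, v} \<Longrightarrow> s k * a j + t k * b j = (if j = k then 1 else 0)"
    show "vars_in (UNIV - {u, v}) (Const ((if j = k then 1 else 0) - (s k * a j + t k * b j)) * Var j)"
    proof (cases "j \<in> {u, v}")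
      case True
      then show ?thesis by (simp only: *) simp
    next
      case False
      then show ?thesis by (intro vars_in_mult vars_in_Const vars_in_Var) auto
    qed
  qed
  then have "vars_in (UNIV - {u, v}) (subst \<sigma> (y j))" for j
    by (rule vars_in_subst)
  from algebraic_dependence[where f = "\<lambda>j. subst \<sigma> (y j)" and i = i, OF uv this]
  obtain \<rho> :: "('n, 'k) mpoly" where \<rho>: "\<rho> \<noteq> 0" "vars_in (UNIV - {i}) \<rho>" "subst (\<lambda>j. subst \<sigma> (y j)) \<rho> = 0" .
  \<comment> \<open>Modulo \<open>I\<close> the substitution \<open>\<sigma>\<close> is the
    identity, and it sends \<open>subst y \<rho>\<close> to 0.\<close>
  have "subst Var (subst y \<rho>) - subst \<sigma> (subst y \<rho>) \<in> I"
    using I_add I_mult \<sigma>_I I0 by (rule subst_congruence)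
  then have "subst y \<rho> \<in> I"
    by (simp add: subst_subst \<rho>(3))
  then show ?thesis
    using that \<rho>(1,2) unfolding I_def l_def l'_def by blast
qed

section \<open>Approximation up to terms of high degree\<close>

interpretation mpoly_space: vector_space "\<lambda>c p. Const c * p :: ('n, 'k::field) mpoly"
  by unfold_locales (simp_all add: distrib_left distrib_right Const_add Const_mult mult.assoc)

text \<open>A lower bound on degrees: membership in the \<open>k\<close>-th power of the ideal
  generated by the variables.\<close>

definition low_degree :: "nat \<Rightarrow> ('n::finite, 'k::field) mpoly \<Rightarrow> bool" where
  "low_degree k p \<longleftrightarrow> (\<forall>m \<in> Poly_Mapping.keys p. k \<le> tdeg m)"

lemma low_degree_sum: "(\<And>x. x \<in> S \<Longrightarrow> low_degree k (f x)) \<Longrightarrow> low_degree k (sum f S)"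
proof (induction S rule: infinite_finite_induct)
  case (insert x S)
  then show ?case
    using keys_add[of "f x" "sum f S"] unfolding low_degree_def by auto
qed (auto simp: low_degree_def)

lemma low_degree_mult:
  fixes p q :: "('n::finite, 'k::field) mpoly"
  assumes "low_degree k p" "low_degree l q"
  shows "low_degree (k + l) (p * q)"
  unfolding low_degree_def
proof
  fix m assume "m \<in> Poly_Mapping.keys (p * q)"
  then obtain a b where "m = a + b" "a \<in> Poly_Mapping.keys p" "b \<in> Poly_Mapping.keys q"
    using keys_mult[of p q] by auto
  then show "k + l \<le> tdeg m"
    using assms unfolding low_degree_def by (auto simp: tdeg_add intro: add_mono)
qed

lemma low_degree_1:
  assumes "Poly_Mapping.lookup p 0 = 0"
  shows "low_degree 1 p"
  unfolding low_degree_def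
proof
  fix m assume m: "m \<in> Poly_Mapping.keys p"
  with assms have "m \<noteq> 0" by (auto simp: in_keys_iff)
  then obtain i where "Poly_Mapping.lookup m i \<noteq> 0"
    by (metis lookup_zero poly_mapping_eqI)
  then show "1 \<le> tdeg m"
    unfolding tdeg_def using member_le_sum[of i UNIV "Poly_Mapping.lookup m"] by simp
qed

lemma mult_mem_span:
  assumes "\<And>v. v \<in> V \<Longrightarrow> q * v \<in> mpoly_space.span W" "s \<in> mpoly_space.span V"
  shows "q * s \<in> mpoly_space.span W"
  using assms(2)
proof (induction rule: mpoly_space.span_induct_alt)
  case (step c v s)
  have "q * (Const c * v + s) = Const c * (q * v) + q * s"
    by (simp add: algebra_simps)
  with step assms(1) show ?case
    by (auto intro: mpoly_space.span_add mpoly_space.span_scale)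
qed (simp add: mpoly_space.span_zero)

text \<open>
  If the powers of the variables lie in the ideal \<open>J\<close> generated by the \<open>y j\<close> with \<open>j \<noteq> i\<close>, then the
  space of polynomials modulo \<open>J\<^sup>k\<close> has dimension \<open>O(k\<^sup>n\<^sup>-\<^sup>1)\<close>, which is too small for the monomials of
  degree less than \<open>k\<close>.
\<close>

lemma too_few_parameters:
  fixes y :: "'n::finite \<Rightarrow> ('n, 'k::field) mpoly"
  assumes y0: "\<And>j. Poly_Mapping.lookup (y j) 0 = 0"
    and N: "\<And>k. \<exists>r. Var k ^ N = (\<Sum>j\<in>UNIV - {i}. y j * r j)"
  shows False
proof -
  let ?n = "CARD('n)"
  define J where "J = {p. \<exists>r. p = (\<Sum>j\<in>UNIV - {i}. y j * r j)}"
  \<comment> \<open>Monomials with exponents in \<open>B\<close> span \<open>R\<close> modulo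
    \<open>J\<close>, since all others are divisible by some \<open>Var k ^ N\<close>. The set
    \<open>V k\<close> multiplies them by products of the \<open>y j\<close> with
    \<open>j \<noteq> i\<close> and exponents below \<open>k\<close>.\<close>
  define B where "B = {m :: 'n \<Rightarrow>\<^sub>0 nat. \<forall>j. Poly_Mapping.lookup m j \<in> {..<N}}"
  define E where "E k = {a. \<forall>j. Poly_Mapping.lookup a j \<in> (if j = i then {0} else {..<k})}" for k :: nat
  define v where "v b a = Poly_Mapping.single b 1 * (\<Prod>j\<in>UNIV. y j ^ Poly_Mapping.lookup a j)" for b a
  define V where "V k = (\<lambda>(b, a). v b a) ` (B \<times> E k)" for k
  have J_add: "p + q \<in> J" if "p \<in> J" "q \<in> J" for p q
  proof -
    from that obtain r s where "p = (\<Sum>j\<in>UNIV - {i}. y j * r j)" "q = (\<Sum>j\<in>UNIV - {i}. y j * s j)"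
      unfolding J_def by blast
    then have "p + q = (\<Sum>j\<in>UNIV - {i}. y j * (r j + s j))"
      by (simp add: sum.distrib distrib_left)
    then show ?thesis unfolding J_def mem_Collect_eq by - (rule exI)
  qed
  have J_mult: "q * p \<in> J" if "p \<in> J" for p q
  proof -
    from that obtain r where "p = (\<Sum>j\<in>UNIV - {i}. y j * r j)"
      unfolding J_def by blast
    then have "q * p = (\<Sum>j\<in>UNIV - {i}. y j * (q * r j))"
      by (simp add: sum_distrib_left algebra_simps)
    then show ?thesis unfolding J_def mem_Collect_eq by - (rule exI)
  qed
  have J0: "0 \<in> J"
    unfolding J_def by (auto intro!: exI[of _ "\<lambda>_. 0"])
  have red: "\<exists>s \<in> mpoly_space.span ((\<lambda>b. Poly_Mapping.single b 1) ` B). p - s \<in> J" for p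
  proof (induction p rule: mpoly_add_induct)
    case (single m c)
    show ?case
    proof (cases "m \<in> B")
      case True
      then have "Const c * Poly_Mapping.single m 1 \<in> mpoly_space.span ((\<lambda>b. Poly_Mapping.single b 1) ` B)"
        by (intro mpoly_space.span_scale mpoly_space.span_base) auto
      then show ?thesis
        by (intro bexI) (auto simp: J0 Const_def mult_single)
    next
      case False
      then obtain k where k: "N \<le> Poly_Mapping.lookup m k"
        unfolding B_def by (auto simp: not_less)
      have "m = (m - Poly_Mapping.single k N) + Poly_Mapping.single k N"
        using k by (intro poly_mapping_eqI) (auto simp: lookup_add lookup_minus lookup_single when_def)
      then have "Poly_Mapping.single m c = Poly_Mapping.single (m - Poly_Mapping.single k N) c * Var k ^ N"
        by (simp add: Var_power mult_single)
      moreover have "Var k ^ N \<in> J"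
        using N[of k] unfolding J_def by simp
      ultimately have "Poly_Mapping.single m c \<in> J"
        by (simp add: J_mult)
      then show ?thesis
        by (intro bexI[of _ 0]) (auto simp: mpoly_space.span_zero)
    qed
  next
    case (add p q)
    then obtain s t where st: "s \<in> mpoly_space.span ((\<lambda>b. Poly_Mapping.single b 1) ` B)" "p - s \<in> J"
      "t \<in> mpoly_space.span ((\<lambda>b. Poly_Mapping.single b 1) ` B)" "q - t \<in> J"
      by blast
    have "(p - s) + (q - t) \<in> J" by (intro J_add st)
    moreover have "(p - s) + (q - t) = p + q - (s + t)" by simp
    ultimately have "p + q - (s + t) \<in> J" by metis
    with st show ?case
      by (intro bexI[of _ "s + t"]) (auto intro: mpoly_space.span_add)
  qed
  have V_Suc: "y j * s \<in> mpoly_space.span (V (Suc k))" if "s \<in> mpoly_space.span (V k)" "j \<noteq> i" for s k j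
  proof (rule mult_mem_span[OF _ that(1)])
    fix w assume "w \<in> V k"
    then obtain b a where ba: "b \<in> B" "a \<in> E k" "w = v b a" by (auto simp: V_def)
    let ?a = "a + Poly_Mapping.single j 1"
    have "?a \<in> E (Suc k)"
      unfolding E_def
    proof (intro CollectI allI)
      fix l
      have "\<forall>l. Poly_Mapping.lookup a l \<in> (if l = i then {0} else {..<k})"
        using ba(2) by (simp add: E_def)
      from spec[OF this, of l] show "Poly_Mapping.lookup ?a l \<in> (if l = i then {0} else {..<Suc k})"
        using that(2) by (auto simp: lookup_add lookup_single when_def)
    qed
    moreover have "(\<Prod>l\<in>UNIV. y l ^ Poly_Mapping.lookup (Poly_Mapping.single j 1) l) = 
        (\<Prod>l\<in>UNIV. if l = j then y l else 1)"
      by (intro prod.cong) (auto simp: lookup_single when_def)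
    then have "y j * w = v b ?a"
      by (simp add: ba v_def lookup_add power_add prod.distrib mult_ac)
    ultimately have "y j * w \<in> V (Suc k)"
      using ba by (auto simp: V_def)
    then show "y j * w \<in> mpoly_space.span (V (Suc k))"
      by (rule mpoly_space.span_base)
  qed
  \<comment> \<open>Reduce \<open>p\<close> modulo \<open>J\<close> and approximate the cofactors
    \<open>r j\<close> up to order \<open>k\<close>. The factor \<open>y j\<close> has no constant
    term and raises the order by one.\<close>
  have approx: "\<exists>s \<in> mpoly_space.span (V k). low_degree k (p - s)" for k p
  proof (induction k arbitrary: p)
    case 0
    then show ?case by (intro bexI[of _ 0]) (auto simp: low_degree_def mpoly_space.span_zero)
  next
    case (Suc k)
    obtain s0 r where s0: "s0 \<in> mpoly_space.span ((\<lambda>b. Poly_Mapping.single b 1) ` B)"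
      and r: "p - s0 = (\<Sum>j\<in>UNIV - {i}. y j * r j)"
      using red[of p] unfolding J_def by blast
    have "\<forall>j. \<exists>s. s \<in> mpoly_space.span (V k) \<and> low_degree k (r j - s)"
      using Suc.IH by blast
    from choice[OF this] obtain s
      where s: "\<And>j. s j \<in> mpoly_space.span (V k)" "\<And>j. low_degree k (r j - s j)"
      by blast
    have "(\<lambda>b. Poly_Mapping.single b 1) ` B \<subseteq> V (Suc k)"
    proof
      fix x :: "('n, 'k) mpoly" assume "x \<in> (\<lambda>b. Poly_Mapping.single b 1) ` B"
      then obtain b where "b \<in> B" "x = v b 0"
        by (auto simp: v_def)
      moreover have "0 \<in> E (Suc k)" by (simp add: E_def)
      ultimately show "x \<in> V (Suc k)" by (auto simp: V_def)
    qed
    with s0 have "s0 \<in> mpoly_space.span (V (Suc k))"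
      using mpoly_space.span_mono by blast
    moreover have "(\<Sum>j\<in>UNIV - {i}. y j * s j) \<in> mpoly_space.span (V (Suc k))"
      by (intro mpoly_space.span_sum V_Suc s) auto
    ultimately have "s0 + (\<Sum>j\<in>UNIV - {i}. y j * s j) \<in> mpoly_space.span (V (Suc k))"
      by (rule mpoly_space.span_add)
    moreover have "p - (s0 + (\<Sum>j\<in>UNIV - {i}. y j * s j)) = (\<Sum>j\<in>UNIV - {i}. y j * (r j - s j))"
      using r by (simp add: algebra_simps sum_subtractf)
    moreover have "low_degree (Suc k) (\<Sum>j\<in>UNIV - {i}. y j * (r j - s j))"
      using low_degree_mult[OF low_degree_1[OF y0] s(2)] by (intro low_degree_sum) simp
    ultimately show ?case
      by (intro bexI[of _ "s0 + (\<Sum>j\<in>UNIV - {i}. y j * s j)"]) simp_all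
  qed
  \<comment> \<open>\<open>T\<close> exceeds \<open>N ^ ?n * ?n ^ (?n - 1)\<close>, so that
    \<open>N ^ ?n * k ^ (?n - 1) < T ^ ?n\<close> for \<open>k = ?n * T\<close>. Monomials with
    exponents in \<open>M\<close> have degree below this \<open>k\<close>.\<close>
  define T where "T = N ^ ?n * ?n ^ (?n - 1) + 1"
  define k where "k = ?n * T"
  define M where "M = {m :: 'n \<Rightarrow>\<^sub>0 nat. \<forall>j. Poly_Mapping.lookup m j \<in> {..<T}}"
  have n: "?n > 0" by simp
  have finE: "finite (E k)" and finB: "finite B" and finM: "finite M"
    unfolding E_def B_def M_def by (rule card_exponent_box(2), simp)+
  have finV: "finite (V k)" using finE finB by (simp add: V_def)
  have "card (V k) \<le> card (B \<times> E k)"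
    unfolding V_def by (rule card_image_le) (use finE finB in simp)
  also have "\<dots> = card B * card (E k)" by (rule card_cartesian_product)
  also have "card B = N ^ ?n"
    unfolding B_def card_exponent_box by simp
  also have "card (E k) = (\<Prod>j\<in>UNIV. if j = i then 1 else k)"
    unfolding E_def card_exponent_box by (intro prod.cong) auto
  also have "\<dots> = k ^ (?n - 1)"
    by (subst prod.If_cases) (auto simp: Diff_eq[symmetric] Compl_eq_Diff_UNIV card_Diff_subset)
  also have "N ^ ?n * k ^ (?n - 1) = (N ^ ?n * ?n ^ (?n - 1)) * T ^ (?n - 1)"
    by (simp add: k_def power_mult_distrib)
  also have "\<dots> < T * T ^ (?n - 1)"
    by (intro mult_strict_right_mono) (auto simp: T_def)
  also have "\<dots> = T ^ ?n"
    using n by (metis power_eq_if less_irrefl)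
  also have "\<dots> = card M"
    unfolding M_def card_exponent_box by simp
  finally have less: "card (V k) < card M" .
  have "\<forall>m. \<exists>s. s \<in> mpoly_space.span (V k) \<and> low_degree k (Poly_Mapping.single m 1 - s)"
    using approx[of k] by blast
  from choice[OF this] obtain s
    where s: "\<And>m. s m \<in> mpoly_space.span (V k)" "\<And>m. low_degree k (Poly_Mapping.single m 1 - s m)"
    by blast
  from s(1) have "\<exists>u. s m = (\<Sum>w\<in>V k. Const (u w) * w)" for m
    using mpoly_space.span_finite[OF finV] by auto
  then have "\<forall>m. \<exists>u. s m = (\<Sum>w\<in>V k. Const (u w) * w)" ..
  from choice[OF this] obtain u where u: "\<And>m. s m = (\<Sum>w\<in>V k. Const (u m w) * w)" by blast
  from nontrivial_linear_relation[OF finV finM less, of u]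
  obtain c where c: "\<exists>m\<in>M. c m \<noteq> 0" "\<And>w. w \<in> V k \<Longrightarrow> (\<Sum>m\<in>M. c m * u m w) = 0"
    by blast
  have "(\<Sum>m\<in>M. Const (c m) * s m) = (\<Sum>m\<in>M. \<Sum>w\<in>V k. Const (c m * u m w) * w)"
    by (simp only: u sum_distrib_left Const_mult mult.assoc)
  also have "\<dots> = (\<Sum>w\<in>V k. \<Sum>m\<in>M. Const (c m * u m w) * w)"
    by (rule sum.swap)
  also have "\<dots> = (\<Sum>w\<in>V k. Const (\<Sum>m\<in>M. c m * u m w) * w)"
    by (simp only: Const_sum sum_distrib_right)
  also have "\<dots> = 0" using c(2) by simp
  finally have s0: "(\<Sum>m\<in>M. Const (c m) * s m) = 0" .
  \<comment> \<open>The approximations cancel in this combination, so a nonzero polynomial with all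
    degrees below \<open>k\<close> would have order at least \<open>k\<close>.\<close>
  have "(\<Sum>m\<in>M. Poly_Mapping.single m (c m)) = (\<Sum>m\<in>M. Const (c m) * (Poly_Mapping.single m 1 - s m))"
    unfolding right_diff_distrib sum_subtractf s0 by (simp add: Const_def mult_single)
  also have "low_degree (0 + k) \<dots>"
    by (intro low_degree_sum low_degree_mult s) (auto simp: low_degree_def)
  finally have low: "low_degree k (\<Sum>m\<in>M. Poly_Mapping.single m (c m))" by simp
  obtain m where m: "m \<in> M" "c m \<noteq> 0" using c(1) by blast
  have "Poly_Mapping.lookup (\<Sum>m\<in>M. Poly_Mapping.single m (c m)) m = c m"
    using m finM by (simp add: lookup_sum lookup_single when_def)
  with m have "m \<in> Poly_Mapping.keys (\<Sum>m\<in>M. Poly_Mapping.single m (c m))"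
    by (simp add: in_keys_iff)
  with low have "k \<le> tdeg m" by (simp add: low_degree_def)
  moreover have "tdeg m < (\<Sum>j\<in>(UNIV :: 'n set). T)"
    unfolding tdeg_def using m(1) by (intro sum_strict_mono) (auto simp: M_def)
  ultimately show False by (simp add: k_def)
qed

section \<open>The transfer of a finite linear group\<close>

lemma group_GL: "group (GL :: ('k::field ^ 'n ^ 'n) monoid)"
proof (rule groupI)
  show "\<exists>B\<in>carrier GL. B \<otimes>\<^bsub>GL\<^esub> A = \<one>\<^bsub>GL\<^esub>" if "A \<in> carrier GL" for A :: "'k ^ 'n ^ 'n"
  proof -
    from that obtain B where "A ** B = mat 1" "B ** A = mat 1"
      unfolding GL_def invertible_def by auto
    then show ?thesis
      unfolding GL_def by (intro bexI[of _ B]) (auto simp: invertible_def)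
  qed
next
  show "\<one>\<^bsub>GL\<^esub> \<in> carrier (GL :: ('k ^ 'n ^ 'n) monoid)"
    by (auto simp: GL_def invertible_def intro!: exI[of _ "mat 1"])
qed (auto simp: GL_def invertible_mult matrix_mul_assoc)

text \<open>The image of the tensor square of \<open>R\<close> among functions on matrices. Summing
  such a function over the group lands in the ideal generated by traces, and closure under products
  allows zeros at several group elements to be combined.\<close>

inductive_set twisted :: "('k::field ^ 'n ^ 'n \<Rightarrow> ('n::finite, 'k) mpoly) set" where
  base: "(\<lambda>h. a * act h b) \<in> twisted"
| add: "\<sigma> \<in> twisted \<Longrightarrow> \<tau> \<in> twisted \<Longrightarrow> (\<lambda>h. \<sigma> h + \<tau> h) \<in> twisted"

lemma twisted_mult:
  assumes "\<sigma> \<in> twisted" "\<tau> \<in> twisted"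
  shows "(\<lambda>h. \<sigma> h * \<tau> h) \<in> twisted"
  using assms(1)
proof induction
  case (base a b)
  show ?case
    using assms(2)
  proof induction
    case (base a' b')
    have "(\<lambda>h. a * act h b * (a' * act h b')) = (\<lambda>h. (a * a') * act h (b * b'))"
      by (simp add: act_mult mult_ac)
    then show ?case by (simp only: twisted.base)
  next
    case (add \<sigma> \<tau>)
    then show ?case by (simp add: distrib_left twisted.add)
  qed
next
  case (add \<sigma>1 \<sigma>2)
  then show ?case by (simp add: distrib_right twisted.add)
qed

lemma twisted_prod: "(\<And>x. x \<in> S \<Longrightarrow> \<tau> x \<in> twisted) \<Longrightarrow> (\<lambda>h. \<Prod>x\<in>S. \<tau> x h) \<in> twisted"
proof (induction S rule: infinite_finite_induct)
  case (insert x S)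
  then show ?case by (simp add: twisted_mult)
qed (use twisted.base[of 1 1] in simp_all)

locale linear_group =
  fixes G :: "('k::field ^ 'n::{finite,linorder} ^ 'n::{finite,linorder}) set"
  assumes subgroup: "subgroup G GL" and finite: "finite G"
begin

abbreviation tr :: "('n, 'k) mpoly \<Rightarrow> ('n, 'k) mpoly" where "tr \<equiv> transfer_map G"

lemma one_mem: "mat 1 \<in> G"
  using subgroup.one_closed[OF subgroup] by (simp add: GL_def)

lemma mult_mem: "A \<in> G \<Longrightarrow> B \<in> G \<Longrightarrow> A ** B \<in> G"
  using subgroup.m_closed[OF subgroup] by (simp add: GL_def)

lemma inverse_mem:
  assumes "A \<in> G"
  obtains B where "B \<in> G" "A ** B = mat 1" "B ** A = mat 1"
proof
  have "A \<in> carrier GL" using assms subgroup.mem_carrier[OF subgroup] by blast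
  then show "A ** inv\<^bsub>GL\<^esub> A = mat 1" "inv\<^bsub>GL\<^esub> A ** A = mat 1"
    using group.r_inv[OF group_GL] group.l_inv[OF group_GL] by (auto simp: GL_def)
  show "inv\<^bsub>GL\<^esub> A \<in> G"
    using assms by (rule subgroup.m_inv_closed[OF subgroup])
qed

lemma bij_mult:
  assumes "h \<in> G"
  shows "bij_betw (\<lambda>g. g ** h) G G" "bij_betw (\<lambda>g. h ** g) G G"
proof -
  obtain h' where h': "h' \<in> G" "h ** h' = mat 1" "h' ** h = mat 1"
    using assms by (rule inverse_mem)
  then have *: "(g ** h) ** h' = g" "(g ** h') ** h = g" "h ** (h' ** g) = g" "h' ** (h ** g) = g" for g
    by (metis matrix_mul_assoc matrix_mul_lid matrix_mul_rid)+
  show "bij_betw (\<lambda>g. g ** h) G G"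
    by (rule bij_betwI[where g = "\<lambda>g. g ** h'"]) (use h' assms * in \<open>auto intro: mult_mem\<close>)
  show "bij_betw (\<lambda>g. h ** g) G G"
    by (rule bij_betwI[where g = "\<lambda>g. h' ** g"]) (use h' assms * in \<open>auto intro: mult_mem\<close>)
qed

lemma invariants_act: "p \<in> invariants G \<Longrightarrow> g \<in> G \<Longrightarrow> act g p = p"
  by (simp add: invariants_def)

lemma invariants_closed:
  "0 \<in> invariants G" "1 \<in> invariants G" "Const c \<in> invariants G"
  "p \<in> invariants G \<Longrightarrow> q \<in> invariants G \<Longrightarrow> p + q \<in> invariants G"
  "p \<in> invariants G \<Longrightarrow> q \<in> invariants G \<Longrightarrow> p - q \<in> invariants G"
  "p \<in> invariants G \<Longrightarrow> - p \<in> invariants G"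
  "p \<in> invariants G \<Longrightarrow> q \<in> invariants G \<Longrightarrow> p * q \<in> invariants G"
  "p \<in> invariants G \<Longrightarrow> p ^ k \<in> invariants G"
  "(\<And>x. x \<in> S \<Longrightarrow> f x \<in> invariants G) \<Longrightarrow> sum f S \<in> invariants G"
  "(\<And>x. x \<in> S \<Longrightarrow> f x \<in> invariants G) \<Longrightarrow> prod f S \<in> invariants G"
  by (auto simp: invariants_def act_add act_diff act_uminus act_mult act_power act_sum act_prod)

lemma invariants_subst:
  assumes "\<And>i. y i \<in> invariants G"
  shows "subst y p \<in> invariants G"
  using assms by (simp add: invariants_def act_subst)

lemma tr_add: "tr (p + q) = tr p + tr q"
  by (simp add: transfer_map_def act_add sum.distrib)

lemma tr_diff: "tr (p - q) = tr p - tr q"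
  by (simp add: transfer_map_def act_diff sum_subtractf)

lemma tr_sum: "tr (sum f S) = (\<Sum>x\<in>S. tr (f x))"
  unfolding transfer_map_def act_sum by (rule sum.swap)

lemma tr_mult_invariant: "c \<in> invariants G \<Longrightarrow> tr (c * p) = c * tr p"
  by (simp add: transfer_map_def act_mult invariants_act sum_distrib_left)

lemma tr_act: "h \<in> G \<Longrightarrow> tr (act h p) = tr p"
  unfolding transfer_map_def act_act
  using sum.reindex_bij_betw[OF bij_mult(2), of h "\<lambda>g. act g p"] by simp

lemma tr_invariant: "tr p \<in> invariants G"
  unfolding invariants_def
proof (intro CollectI ballI)
  fix h assume "h \<in> G"
  then show "act h (tr p) = tr p"
    unfolding transfer_map_def act_sum act_act
    using sum.reindex_bij_betw[OF bij_mult(1), of h "\<lambda>g. act g p"] by simp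
qed

lemma tr_of_invariant_mult: "c \<in> invariants G \<Longrightarrow> tr p * c = tr (p * c)"
  by (metis mult.commute tr_mult_invariant)

text \<open>The image of the transfer is an ideal of the invariant ring. The empty product is
  excluded because 1 may fail to be a trace.\<close>

lemma prod_tr:
  assumes "finite S" "S \<noteq> {}" "\<And>x. x \<in> S \<Longrightarrow> f x \<in> range tr"
  shows "prod f S \<in> range tr"
  using assms
proof (induction S rule: finite_ne_induct)
  case (insert x S)
  have "f x \<in> range tr" "prod f S \<in> range tr"
    using insert.prems insert.IH by blast+
  then obtain p q where "f x = tr p" "prod f S = tr q" by blast
  then have "prod f (insert x S) = tr (p * tr q)"
    using insert.hyps by (simp add: tr_of_invariant_mult[OF tr_invariant])
  then show ?case by blast
qed simp

text \<open>The ideal generated by the traces in all of \<open>R\<close>;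
  \<open>invariant_power_tr\<close> leads from its invariant elements back to traces.\<close>

definition tr_ideal :: "('n, 'k) mpoly set" where
  "tr_ideal = {p. \<exists>T r. finite T \<and> T \<subseteq> range tr \<and> p = (\<Sum>t\<in>T. r t * t)}"

lemma tr_ideal_mult_tr: "a * tr b \<in> tr_ideal"
  unfolding tr_ideal_def mem_Collect_eq
  by (intro exI[of _ "{tr b}"] exI[of _ "\<lambda>_. a"]) auto

lemma tr_ideal_add:
  assumes "p \<in> tr_ideal" "q \<in> tr_ideal"
  shows "p + q \<in> tr_ideal"
proof -
  obtain T r where T: "finite T" "T \<subseteq> range tr" "p = (\<Sum>t\<in>T. r t * t)"
    using assms(1) unfolding tr_ideal_def by blast
  obtain U s where U: "finite U" "U \<subseteq> range tr" "q = (\<Sum>t\<in>U. s t * t)"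
    using assms(2) unfolding tr_ideal_def by blast
  have "p = (\<Sum>t\<in>T \<union> U. (if t \<in> T then r t else 0) * t)" "q = (\<Sum>t\<in>T \<union> U. (if t \<in> U then s t else 0) * t)"
    unfolding T(3) U(3) by (rule sum.mono_neutral_cong_left; use T U in auto)+
  then have "p + q = (\<Sum>t\<in>T \<union> U. ((if t \<in> T then r t else 0) + (if t \<in> U then s t else 0)) * t)"
    by (simp only: distrib_right sum.distrib)
  then show ?thesis
    unfolding tr_ideal_def mem_Collect_eq using T U
    by (intro exI[of _ "T \<union> U"] exI[of _ "\<lambda>t. (if t \<in> T then r t else 0) + (if t \<in> U then s t else 0)"]) auto
qed

text \<open>
  Expanding the norm \<open>s\<^sup>|\<^sup>G\<^sup>| = \<Prod>\<^sub>g g(s)\<close> of \<open>s = \<Sum>\<^sub>t r\<^sub>t t\<close> gives a polynomial in the traces \<open>t\<close> whose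
  coefficients are invariant.
\<close>

lemma invariant_power_tr:
  assumes s: "s \<in> invariants G" "s \<in> tr_ideal"
  obtains z where "s ^ card G = tr z"
proof -
  obtain T r where T: "finite T" "T \<subseteq> range tr" "s = (\<Sum>t\<in>T. r t * t)"
    using s(2) unfolding tr_ideal_def by blast
  \<comment> \<open>Expanding the norm gives one term per choice function \<open>\<kappa>\<close> in
    \<open>P\<close>. Here \<open>\<tau> \<kappa>\<close> is its product of traces,
    \<open>w \<kappa>\<close> its coefficient, and \<open>F v\<close> collects the terms with the
    same product \<open>v\<close>.\<close>
  define P where "P = (G \<rightarrow>\<^sub>E T)"
  have finP: "finite P"
    unfolding P_def by (intro finite_PiE finite T)
  define \<tau> where "\<tau> \<kappa> = (\<Prod>g\<in>G. \<kappa> g)" for \<kappa> :: "_ \<Rightarrow> ('n, 'k) mpoly"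
  define w where "w \<kappa> = (\<Prod>g\<in>G. act g (r (\<kappa> g)))" for \<kappa>
  define F where "F v = {\<kappa> \<in> P. \<tau> \<kappa> = v}" for v
  have act_s: "s = (\<Sum>t\<in>T. act g (r t) * t)" if "g \<in> G" for g
  proof -
    have "s = act g s" using s(1) that by (simp add: invariants_act)
    also have "\<dots> = (\<Sum>t\<in>T. act g (r t) * t)"
      unfolding T(3) act_sum act_mult
    proof (rule sum.cong)
      fix t assume "t \<in> T"
      then have "t \<in> invariants G" using T(2) tr_invariant by blast
      then show "act g (r t) * act g t = act g (r t) * t"
        using that by (simp add: invariants_act)
    qed simp
    finally show ?thesis .
  qed
  have "s ^ card G = (\<Prod>g\<in>G. s)" by simp
  also have "\<dots> = (\<Prod>g\<in>G. \<Sum>t\<in>T. act g (r t) * t)"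
    by (rule prod.cong) (use act_s in auto)
  also have "\<dots> = (\<Sum>\<kappa>\<in>P. w \<kappa> * \<tau> \<kappa>)"
    unfolding P_def w_def \<tau>_def using finite T(1) by (simp add: prod_sum_PiE prod.distrib)
  also have "\<dots> = (\<Sum>v\<in>\<tau> ` P. \<Sum>\<kappa>\<in>F v. w \<kappa> * \<tau> \<kappa>)"
    unfolding F_def by (rule sum.image_gen[OF finP])
  also have "\<dots> = (\<Sum>v\<in>\<tau> ` P. (\<Sum>\<kappa>\<in>F v. w \<kappa>) * v)"
    by (rule sum.cong) (auto simp: F_def sum_distrib_right)
  finally have eq: "s ^ card G = (\<Sum>v\<in>\<tau> ` P. (\<Sum>\<kappa>\<in>F v. w \<kappa>) * v)" .
  have inv: "(\<Sum>\<kappa>\<in>F v. w \<kappa>) \<in> invariants G" for v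
    unfolding invariants_def
  proof (intro CollectI ballI)
    fix h assume h: "h \<in> G"
    obtain h' where h': "h' \<in> G" "h ** h' = mat 1" "h' ** h = mat 1"
      using h by (rule inverse_mem)
    have *: "(g ** h) ** h' = g" "(g ** h') ** h = g" if "g \<in> G" for g
      using h' by (metis matrix_mul_assoc matrix_mul_rid)+
    \<comment> \<open>An element \<open>h\<close> permutes the coefficients
      \<open>w \<kappa>\<close> by translating the choice functions. Translation leaves
      \<open>\<tau> \<kappa>\<close> unchanged, so the sum of coefficients over each
      \<open>F v\<close> is invariant.\<close>
    define \<phi> where "\<phi> k \<kappa> = restrict (\<lambda>g. \<kappa> (g ** k)) G"
      for k :: "'k ^ 'n::{finite,linorder} ^ 'n::{finite,linorder}" and \<kappa> :: "_ \<Rightarrow> ('n, 'k) mpoly"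
    have \<phi>_F: "\<phi> k \<kappa> \<in> F v" if "k \<in> G" "\<kappa> \<in> F v" for k \<kappa>
    proof -
      have "\<tau> (\<phi> k \<kappa>) = (\<Prod>g\<in>G. \<kappa> (g ** k))" by (simp add: \<tau>_def \<phi>_def)
      also have "\<dots> = \<tau> \<kappa>"
        unfolding \<tau>_def by (rule prod.reindex_bij_betw[OF bij_mult(1)[OF that(1)]])
      finally show ?thesis
        using that unfolding F_def P_def by (auto simp: \<phi>_def intro: mult_mem)
    qed
    have \<phi>_inv: "\<phi> h (\<phi> h' \<kappa>) = \<kappa>" "\<phi> h' (\<phi> h \<kappa>) = \<kappa>" if "\<kappa> \<in> F v" for \<kappa>
    proof -
      have "\<kappa> \<in> extensional G" using that by (auto simp: F_def P_def PiE_iff)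
      then show "\<phi> h (\<phi> h' \<kappa>) = \<kappa>" "\<phi> h' (\<phi> h \<kappa>) = \<kappa>"
        using h h' * by (auto simp: \<phi>_def fun_eq_iff extensional_def mult_mem restrict_def)
    qed
    have bij: "bij_betw (\<phi> h') (F v) (F v)"
      by (rule bij_betwI[where g = "\<phi> h"]) (use h h' \<phi>_F \<phi>_inv in auto)
    have "act h (w \<kappa>) = w (\<phi> h' \<kappa>)" for \<kappa>
    proof -
      have "act h (w \<kappa>) = (\<Prod>g\<in>G. act (g ** h) (r (\<kappa> ((g ** h) ** h'))))"
        by (auto simp: w_def act_prod act_act * intro!: prod.cong)
      also have "\<dots> = (\<Prod>g\<in>G. act g (r (\<kappa> (g ** h'))))"
        by (rule prod.reindex_bij_betw[OF bij_mult(1)[OF h], where g = "\<lambda>g. act g (r (\<kappa> (g ** h')))"])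
      also have "\<dots> = w (\<phi> h' \<kappa>)" by (simp add: w_def \<phi>_def)
      finally show ?thesis .
    qed
    then have "act h (\<Sum>\<kappa>\<in>F v. w \<kappa>) = (\<Sum>\<kappa>\<in>F v. w (\<phi> h' \<kappa>))"
      by (simp add: act_sum)
    also have "\<dots> = (\<Sum>\<kappa>\<in>F v. w \<kappa>)"
      by (rule sum.reindex_bij_betw[OF bij])
    finally show "act h (\<Sum>\<kappa>\<in>F v. w \<kappa>) = (\<Sum>\<kappa>\<in>F v. w \<kappa>)" .
  qed
  \<comment> \<open>The value \<open>v\<close> is a product of traces indexed by \<open>G\<close>,
    which is nonempty.\<close>
  have "\<exists>b. v = tr b" if "v \<in> \<tau> ` P" for v
  proof -
    from that obtain \<kappa> where "\<kappa> \<in> P" "v = \<tau> \<kappa>" by auto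
    then have "v \<in> range tr"
      unfolding \<tau>_def using one_mem T(2) finite by (auto simp: P_def intro!: prod_tr)
    then show ?thesis by blast
  qed
  then obtain b where b: "\<And>v. v \<in> \<tau> ` P \<Longrightarrow> v = tr (b v)" by metis
  have "s ^ card G = (\<Sum>v\<in>\<tau> ` P. tr ((\<Sum>\<kappa>\<in>F v. w \<kappa>) * b v))"
    unfolding eq by (rule sum.cong) (auto simp: tr_mult_invariant[OF inv] simp flip: b)
  then have "s ^ card G = tr (\<Sum>v\<in>\<tau> ` P. (\<Sum>\<kappa>\<in>F v. w \<kappa>) * b v)"
    by (simp only: tr_sum)
  then show ?thesis by (rule that)
qed

lemma sum_twisted: "\<tau> \<in> twisted \<Longrightarrow> (\<Sum>h\<in>G. \<tau> h) \<in> tr_ideal"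
proof (induction rule: twisted.induct)
  case (base a b)
  then show ?case
    using tr_ideal_mult_tr[of a b] by (simp add: transfer_map_def sum_distrib_left)
qed (simp add: sum.distrib tr_ideal_add)

end

section \<open>Matrices of rank one\<close>

text \<open>When all two by two minors vanish, every row is a multiple of any row with a nonzero
  entry, and that row spans the row space.\<close>

lemma rank_one_factor:
  fixes N :: "'k::field ^ 'n ^ 'n"
  assumes "N \<noteq> 0" and minors: "\<And>i j u v. N $ i $ u * N $ j $ v = N $ i $ v * N $ j $ u"
  obtains s w where "\<And>i j. N $ i $ j = s i * w j" "s \<noteq> (\<lambda>_. 0)" "rank N = 1"
proof -
  obtain k u where ku: "N $ k $ u \<noteq> 0"
    using assms(1) by (metis vec_eq_iff zero_index)
  define s where "s i = N $ i $ u / N $ k $ u" for i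
  have N: "N $ i $ j = s i * N $ k $ j" for i j
    using minors[of i u k j] ku by (simp add: s_def field_simps)
  let ?w = "row k N"
  have row: "row i N = s i *s ?w" for i
    unfolding vec_eq_iff by (intro allI) (simp add: row_def, rule N)
  have "rows N \<subseteq> vec.span {?w}"
  proof
    fix x assume "x \<in> rows N"
    then obtain i where "x = row i N" by (auto simp: rows_def)
    with row[of i] have "x = s i *s ?w" by (rule trans[rotated])
    then show "x \<in> vec.span {?w}" by (simp add: vec.span_scale vec.span_base)
  qed
  moreover have "?w \<in> rows N" by (auto simp: rows_def)
  ultimately have "vec.span (rows N) = vec.span {?w}"
    unfolding vec.span_eq by (auto intro: vec.span_base)
  then have "vec.dim (rows N) = vec.dim {?w}"
    by (metis vec.dim_span)
  moreover have "?w \<noteq> 0"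
  proof
    assume "?w = 0"
    then have "?w $ u = 0" by simp
    with ku show False by (simp add: row_def)
  qed
  then have "vec.dim {?w} = 1"
    by (subst vec.dim_eq_card_independent) (auto simp: vec.independent_insert)
  ultimately have rank: "rank N = 1"
    by (simp add: row_rank_def_gen)
  have "s k = 1" using ku by (simp add: s_def)
  then have "s \<noteq> (\<lambda>_. 0)" by auto
  then show ?thesis by (rule that[OF N]) fact
qed

text \<open>
  If \<open>g - 1\<close> is a rank one matrix with eigenvalue \<open>c\<close>, then \<open>(1 + c)\<^sup>k = 1\<close> for the order \<open>k\<close> of \<open>g\<close>.
\<close>

lemma nonzero_minor:
  fixes g :: "'k::field ^ 'n ^ 'n"
  assumes g: "g \<in> carrier GL" "g \<noteq> mat 1" "\<not> transvection g"
    and k: "k > 0" "g [^]\<^bsub>GL\<^esub> k = \<one>\<^bsub>GL\<^esub>" and unip: "\<And>c::'k. (1 + c) ^ k = 1 \<Longrightarrow> c = 0"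
  obtains i j u v where "(g - mat 1) $ i $ u * (g - mat 1) $ j $ v - (g - mat 1) $ i $ v * (g - mat 1) $ j $ u \<noteq> 0"
proof (rule ccontr)
  define N where "N = g - mat 1"
  assume "\<not> thesis"
  then have minors: "N $ i $ u * N $ j $ v = N $ i $ v * N $ j $ u" for i j u v
    using that unfolding N_def by (metis right_minus_eq)
  have "N \<noteq> 0" using g(2) by (simp add: N_def)
  from rank_one_factor[OF this minors] obtain s w where
    N: "\<And>i j. N $ i $ j = s i * w j" and s: "s \<noteq> (\<lambda>_. 0)" and rank: "rank N = 1" by blast
  \<comment> \<open>With \<open>N\<close> equal to the column \<open>s\<close> times the row
    \<open>w\<close>, the vector \<open>s\<close> is an eigenvector for \<open>c\<close>, and
    \<open>N ** N\<close> is \<open>c\<close> times \<open>N\<close>. Thus \<open>c = 0\<close>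
    would make \<open>g\<close> a transvection.\<close>
  define c where "c = (\<Sum>j\<in>UNIV. w j * s j)"
  define x where "x = vec_lambda s"
  have "N *v x = c *s x"
    by (simp add: vec_eq_iff matrix_vector_mult_def x_def N c_def sum_distrib_left sum_distrib_right algebra_simps)
  moreover have "g = mat 1 + N" by (simp add: N_def)
  ultimately have gx: "g *v x = (1 + c) *s x"
    by (simp add: matrix_vector_mult_add_rdistrib vec.scale_left_distrib)
  have "(g [^]\<^bsub>GL\<^esub> m) *v x = (1 + c) ^ m *s x" for m :: nat
  proof (induction m)
    case 0
    then show ?case by (simp add: GL_def)
  next
    case (Suc m)
    have "(g [^]\<^bsub>GL\<^esub> Suc m) *v x = (g [^]\<^bsub>GL\<^esub> m) *v (g *v x)"
      by (simp add: GL_def matrix_vector_mul_assoc)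
    also have "\<dots> = (1 + c) ^ Suc m *s x"
      by (simp add: gx Suc.IH vec.scale vector_smult_assoc mult.commute matrix_vector_mult_scaleR)
    finally show ?case .
  qed
  from this[of k] have "x = (1 + c) ^ k *s x"
    unfolding k(2) by (simp add: GL_def)
  moreover obtain i where "s i \<noteq> 0" using s by auto
  ultimately have "(1 + c) ^ k = 1"
    by (auto simp: vec_eq_iff x_def)
  then have "c = 0" by (rule unip)
  have "(N ** N) $ i $ j = s i * c * w j" for i j
    by (simp add: matrix_matrix_mult_def N c_def sum_distrib_left sum_distrib_right mult_ac)
  with \<open>c = 0\<close> have "N ** N = 0"
    by (simp add: vec_eq_iff)
  then have "transvection g"
    unfolding transvection_def pseudoreflection_def using g(1) k rank by (auto simp: N_def)
  with g(3) show False ..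
qed

context linear_group
begin

text \<open>The coset of \<open>x\<close> contributes \<open>act x\<close> of the transfer from
  \<open>Q\<close>; invariance under \<open>G\<close> makes all contributions equal.\<close>

lemma tr_cosets:
  assumes Q: "subgroup Q (GL\<lparr>carrier := G\<rparr>)" and inv: "transfer_map Q r \<in> invariants G"
  shows "tr r = of_nat (card (rcosets\<^bsub>GL\<lparr>carrier := G\<rparr>\<^esub> Q)) * transfer_map Q r"
proof -
  let ?K = "GL\<lparr>carrier := G\<rparr>"
  interpret K: group ?K
    by (rule subgroup.subgroup_is_group[OF subgroup group_GL])
  have QG: "Q \<subseteq> G" using subgroup.subset[OF Q] by simp
  have U: "\<Union> (rcosets\<^bsub>?K\<^esub> Q) = G"
    using K.rcosets_part_G[OF Q] by simp
  have "(\<Sum>g\<in>C. act g r) = transfer_map Q r" if "C \<in> rcosets\<^bsub>?K\<^esub> Q" for C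
  proof -
    from that obtain x where x: "x \<in> G" "C = (\<lambda>q. q ** x) ` Q"
      unfolding RCOSETS_def r_coset_def by (auto simp: GL_def)
    have "inj_on (\<lambda>q. q ** x) Q"
      using bij_betw_imp_inj_on[OF bij_mult(1)[OF x(1)]] QG by (rule inj_on_subset)
    then have "(\<Sum>g\<in>C. act g r) = act x (transfer_map Q r)"
      by (simp add: x(2) sum.reindex transfer_map_def act_sum act_act)
    then show ?thesis
      using inv x(1) by (simp add: invariants_act)
  qed
  moreover have "tr r = (\<Sum>C\<in>rcosets\<^bsub>?K\<^esub> Q. \<Sum>g\<in>C. act g r)"
  proof -
    have "(\<Sum>g\<in>\<Union> (rcosets\<^bsub>?K\<^esub> Q). act g r) = (\<Sum>C\<in>rcosets\<^bsub>?K\<^esub> Q. \<Sum>g\<in>C. act g r)"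
    proof (subst sum.Union_disjoint)
      show "\<forall>C\<in>rcosets\<^bsub>?K\<^esub> Q. finite C"
        using U finite by (metis Union_upper finite_subset)
      show "\<forall>A\<in>rcosets\<^bsub>?K\<^esub> Q. \<forall>B\<in>rcosets\<^bsub>?K\<^esub> Q. A \<noteq> B \<longrightarrow> A \<inter> B = {}"
        using K.rcos_disjoint[OF Q] by (auto simp: pairwise_def disjnt_def)
    qed simp
    then show ?thesis unfolding U by (simp add: transfer_map_def)
  qed
  ultimately show ?thesis by simp
qed

text \<open>\<open>Q\<close> is a Sylow \<open>p\<close>-subgroup in characteristic \<open>p > 0\<close> and trivial in characteristic \<open>0\<close>.\<close>

lemma sylow_characteristic:
  obtains Q and m :: nat where "linear_group Q" "Q \<subseteq> G" "of_nat m \<noteq> (0 :: 'k)"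
    "\<And>q. q \<in> Q \<Longrightarrow> \<exists>k>0. q [^]\<^bsub>GL\<^esub> k = \<one>\<^bsub>GL\<^esub> \<and> (\<forall>c::'k. (1 + c) ^ k = 1 \<longrightarrow> c = 0)"
    "\<And>r. transfer_map Q r \<in> invariants G \<Longrightarrow> tr r = of_nat m * transfer_map Q r"
proof -
  let ?K = "GL\<lparr>carrier := G\<rparr>"
  interpret K: group ?K
    by (rule subgroup.subgroup_is_group[OF subgroup group_GL])
  have order: "Coset.order ?K = card G" "card G > 0"
    using finite one_mem by (auto simp: Coset.order_def card_gt_0_iff)
  note result = that
  have *: thesis
    if Q: "subgroup Q ?K" and m: "of_nat (card (rcosets\<^bsub>?K\<^esub> Q)) \<noteq> (0 :: 'k)"
      and k: "\<And>q. q \<in> Q \<Longrightarrow> \<exists>k>0. q [^]\<^bsub>GL\<^esub> k = \<one>\<^bsub>GL\<^esub> \<and> (\<forall>c::'k. (1 + c) ^ k = 1 \<longrightarrow> c = 0)" for Q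
  proof (rule result[OF _ _ m k tr_cosets[OF Q]])
    show "Q \<subseteq> G" using subgroup.subset[OF Q] by simp
    then show "linear_group Q"
      using group.incl_subgroup[OF group_GL subgroup Q] finite
      by (intro linear_group.intro) (auto intro: finite_subset)
  qed
  show ?thesis
  proof (cases "CHAR('k) = 0")
    case True
    show ?thesis
    proof (rule *[OF K.triv_subgroup])
      have "card (rcosets\<^bsub>?K\<^esub> {\<one>\<^bsub>?K\<^esub>}) * card {\<one>\<^bsub>?K\<^esub>} = card G"
        using K.lagrange[OF K.triv_subgroup] order by simp
      then have "card (rcosets\<^bsub>?K\<^esub> {\<one>\<^bsub>?K\<^esub>}) > 0"
        using order(2) by simp
      with True show "of_nat (card (rcosets\<^bsub>?K\<^esub> {\<one>\<^bsub>?K\<^esub>})) \<noteq> (0 :: 'k)"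
        unfolding CHAR_eq0_iff by blast
      show "\<exists>k>0. q [^]\<^bsub>GL\<^esub> k = \<one>\<^bsub>GL\<^esub> \<and> (\<forall>c::'k. (1 + c) ^ k = 1 \<longrightarrow> c = 0)"
        if "q \<in> {\<one>\<^bsub>?K\<^esub>}" for q
        using that by (intro exI[of _ "1::nat"]) (auto simp: GL_def)
    qed
  next
    case False
    then have p: "prime CHAR('k)"
      using prime_CHAR_semidom by auto
    let ?p = "CHAR('k)"
    obtain m where m: "card G = ?p ^ multiplicity ?p (card G) * m" "\<not> ?p dvd m"
      using multiplicity_decompose'[of "card G" ?p] order(2) p by (metis not_prime_unit neq0_conv)
    define a where "a = multiplicity ?p (card G)"
    obtain Q where Q: "subgroup Q ?K" "card Q = ?p ^ a"
      using sylow_thm[OF p K.group_axioms, of a m] m order finite by (auto simp: a_def)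
    show ?thesis
    proof (rule *[OF Q(1)])
      have "card (rcosets\<^bsub>?K\<^esub> Q) * ?p ^ a = ?p ^ a * m"
        using K.lagrange[OF Q(1)] m(1) order by (simp add: a_def Q(2)[unfolded a_def])
      then have "card (rcosets\<^bsub>?K\<^esub> Q) = m"
        using False by simp
      then show "of_nat (card (rcosets\<^bsub>?K\<^esub> Q)) \<noteq> (0 :: 'k)"
        using m(2) by (simp add: of_nat_eq_0_iff_char_dvd)
      have Q': "subgroup Q GL"
        by (rule group.incl_subgroup[OF group_GL subgroup Q(1)])
      show "\<exists>k>0. q [^]\<^bsub>GL\<^esub> k = \<one>\<^bsub>GL\<^esub> \<and> (\<forall>c::'k. (1 + c) ^ k = 1 \<longrightarrow> c = 0)" if "q \<in> Q" for q
      proof (intro exI[of _ "?p ^ a"] conjI allI impI)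
        show "?p ^ a > 0" using False by simp
        interpret Q: group "GL\<lparr>carrier := Q\<rparr>"
          by (rule subgroup.subgroup_is_group[OF Q' group_GL])
        have "q [^]\<^bsub>GL\<lparr>carrier := Q\<rparr>\<^esub> Coset.order (GL\<lparr>carrier := Q\<rparr>) = \<one>\<^bsub>GL\<lparr>carrier := Q\<rparr>\<^esub>"
          by (rule Q.pow_order_eq_1) (use that in simp)
        then show "q [^]\<^bsub>GL\<^esub> (?p ^ a) = \<one>\<^bsub>GL\<^esub>"
          by (simp add: Coset.order_def Q(2) flip: monoid.nat_pow_consistent[OF group.is_monoid[OF group_GL]])
        fix c :: 'k
        assume "(1 + c) ^ (?p ^ a) = 1"
        \<comment> \<open>By Frobenius, \<open>(1 + c) ^ (?p ^ a)\<close> equals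
          \<open>1 + c ^ (?p ^ a)\<close>.\<close>
        then show "c = 0"
          using freshmans_dream'[OF p refl, of 1 c a] by simp
      qed
    qed
  qed
qed

text \<open>
  Modulo traces from a Sylow subgroup \<open>Q\<close>, the product of polynomials in the ideals generated by the
  linear forms \<open>g(x\<^sub>k) - x\<^sub>k\<close> for \<open>1 \<noteq> g \<in> Q\<close> vanishes.  Without transvections each of these ideals
  contains two independent linear forms.
\<close>

lemma trace_relation:
  fixes y :: "'n \<Rightarrow> ('n, 'k) mpoly"
  assumes notrans: "\<forall>g\<in>G. \<not> transvection g" and y: "\<And>i. y i \<in> invariants G"
  obtains \<rho> z where "\<rho> \<noteq> 0" "vars_in (UNIV - {i}) \<rho>" "subst y \<rho> = tr z"
proof -
  obtain Q and m :: nat where Q: "linear_group Q" "Q \<subseteq> G" and m: "of_nat m \<noteq> (0 :: 'k)"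
    and k: "\<And>q. q \<in> Q \<Longrightarrow> \<exists>k>0. q [^]\<^bsub>GL\<^esub> k = \<one>\<^bsub>GL\<^esub> \<and> (\<forall>c::'k. (1 + c) ^ k = 1 \<longrightarrow> c = 0)"
    and trQ: "\<And>r. transfer_map Q r \<in> invariants G \<Longrightarrow> tr r = of_nat m * transfer_map Q r"
    using sylow_characteristic by blast
  interpret Q: linear_group Q by fact
  have invQ: "invariants G \<subseteq> invariants Q" using Q(2) by (auto simp: invariants_def)
  have ex: "\<exists>\<rho> \<tau>. \<rho> \<noteq> 0 \<and> vars_in (UNIV - {i}) \<rho> \<and> \<tau> \<in> twisted \<and> \<tau> q = 0 \<and> \<tau> (mat 1) = subst y \<rho>"
    if q: "q \<in> Q - {mat 1}" for q
  proof -
    obtain k where k: "k > 0" "q [^]\<^bsub>GL\<^esub> k = \<one>\<^bsub>GL\<^esub>" "\<And>c::'k. (1 + c) ^ k = 1 \<Longrightarrow> c = 0"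
      using k[of q] q by blast
    have "q \<in> carrier GL" "q \<noteq> mat 1" "\<not> transvection q"
      using q Q(2) notrans subgroup.mem_carrier[OF Q.subgroup] by auto
    from this k obtain s t u v where "(q - mat 1) $ s $ u * (q - mat 1) $ t $ v - (q - mat 1) $ s $ v * (q - mat 1) $ t $ u \<noteq> 0"
      by (rule nonzero_minor) auto
    from dependence_modulo_linear_forms[where a = "\<lambda>j. (q - mat 1) $ s $ j" and b = "\<lambda>j. (q - mat 1) $ t $ j"
        and y = y and i = i, OF this]
    obtain \<rho> e e' where \<rho>: "\<rho> \<noteq> 0" "vars_in (UNIV - {i}) \<rho>"
      "subst y \<rho> = e * (\<Sum>j\<in>UNIV. Const ((q - mat 1) $ s $ j) * Var j) + e' * (\<Sum>j\<in>UNIV. Const ((q - mat 1) $ t $ j) * Var j)" .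
    have lin: "(\<Sum>j\<in>UNIV. Const ((q - mat 1) $ l $ j) * Var j) = act q (Var l) - Var l" for l
    proof -
      have "(\<Sum>j\<in>UNIV. Const ((q - mat 1) $ l $ j) * Var j) = act q (Var l) - act (mat 1) (Var l)"
        unfolding act_Var by (simp add: Const_diff left_diff_distrib sum_subtractf)
      then show ?thesis by simp
    qed
    have tw: "(\<lambda>h. e * act q (Var l) - e * act h (Var l)) \<in> twisted" for e l
      using twisted.add[OF twisted.base[of "e * act q (Var l)" 1] twisted.base[of "- e" "Var l"]] by simp
    \<comment> \<open>The relation is a combination of \<open>act q (Var l) - Var l\<close>.
      Replacing \<open>Var l\<close> by \<open>act h (Var l)\<close> makes it a function of
      \<open>h\<close> that vanishes at \<open>q\<close> and returns the relation at the
      identity.\<close>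
    define \<tau> where "\<tau> h = (e * act q (Var s) - e * act h (Var s)) + (e' * act q (Var t) - e' * act h (Var t))" for h
    have "\<tau> \<in> twisted"
      unfolding \<tau>_def[abs_def] by (intro twisted.add tw)
    moreover have "\<tau> q = 0" by (simp add: \<tau>_def)
    moreover have "\<tau> (mat 1) = subst y \<rho>"
      unfolding \<rho>(3) lin by (simp add: \<tau>_def right_diff_distrib)
    ultimately show ?thesis using \<rho>(1,2) by blast
  qed
  have "\<forall>q\<in>Q - {mat 1}. \<exists>x. fst x \<noteq> 0 \<and> vars_in (UNIV - {i}) (fst x) \<and> 
    snd x \<in> twisted \<and> snd x q = 0 \<and> snd x (mat 1) = subst y (fst x)"
  proof
    fix q assume "q \<in> Q - {mat 1}"
    from ex[OF this] obtain \<rho> \<tau> where "\<rho> \<noteq> 0 \<and> vars_in (UNIV - {i}) \<rho> \<and> \<tau> \<in> twisted \<and>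
      \<tau> q = 0 \<and> \<tau> (mat 1) = subst y \<rho>" by (elim exE)
    then show "\<exists>x. fst x \<noteq> 0 \<and> vars_in (UNIV - {i}) (fst x) \<and> 
      snd x \<in> twisted \<and> snd x q = 0 \<and> snd x (mat 1) = subst y (fst x)"
      by (intro exI[of _ "(\<rho>, \<tau>)"]) simp
  qed
  from bchoice[OF this] obtain f where f: "\<forall>q\<in>Q - {mat 1}. fst (f q) \<noteq> 0 \<and> vars_in (UNIV - {i}) (fst (f q)) \<and> 
    snd (f q) \<in> twisted \<and> snd (f q) q = 0 \<and> snd (f q) (mat 1) = subst y (fst (f q))" ..
  define \<rho> \<tau> where "\<rho> q = fst (f q)" and "\<tau> q = snd (f q)" for q
  have \<rho>: "\<And>q. q \<in> Q - {mat 1} \<Longrightarrow> \<rho> q \<noteq> 0"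
    "\<And>q. q \<in> Q - {mat 1} \<Longrightarrow> vars_in (UNIV - {i}) (\<rho> q)"
    and \<tau>: "\<And>q. q \<in> Q - {mat 1} \<Longrightarrow> \<tau> q \<in> twisted" "\<And>q. q \<in> Q - {mat 1} \<Longrightarrow> \<tau> q q = 0"
    "\<And>q. q \<in> Q - {mat 1} \<Longrightarrow> \<tau> q (mat 1) = subst y (\<rho> q)"
    using f unfolding \<rho>_def \<tau>_def by blast+
  define P where "P = (\<Prod>q\<in>Q - {mat 1}. \<rho> q)"
  \<comment> \<open>Each \<open>h\<close> other than the identity is a zero of its own factor
    \<open>\<tau> h\<close>, so only the identity contributes.\<close>
  have "(\<Sum>h\<in>Q. \<Prod>q\<in>Q - {mat 1}. \<tau> q h) = (\<Sum>h\<in>{mat 1}. \<Prod>q\<in>Q - {mat 1}. \<tau> q h)"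
  proof (rule sum.mono_neutral_right[OF Q.finite])
    show "\<forall>h\<in>Q - {mat 1}. (\<Prod>q\<in>Q - {mat 1}. \<tau> q h) = 0"
      using \<tau>(2) Q.finite by (auto simp: prod_zero_iff)
  qed (use Q.one_mem in auto)
  also have "\<dots> = subst y P"
    by (simp add: P_def subst_prod \<tau>(3))
  finally have trP: "subst y P \<in> Q.tr_ideal"
    using Q.sum_twisted[OF twisted_prod[of "Q - {mat 1}" \<tau>, OF \<tau>(1)]] by simp
  have "subst y P \<in> invariants Q"
    using invariants_subst[of y P, OF y] invQ by blast
  from Q.invariant_power_tr[OF this trP]
  obtain z where z: "subst y P ^ card Q = transfer_map Q z" .
  \<comment> \<open>The power of \<open>subst y P\<close> is invariant under all of
    \<open>G\<close>, so its preimage \<open>z\<close> has a \<open>G\<close>-trace differing only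
    by the index \<open>m\<close>, which is invertible in the field.\<close>
  have "transfer_map Q z \<in> invariants G"
    unfolding z[symmetric] by (intro invariants_closed(8) invariants_subst y)
  from trQ[OF this] have "tr z = Const (of_nat m) * subst y (P ^ card Q)"
    by (simp add: z Const_of_nat subst_power)
  then have "Const (inverse (of_nat m)) * tr z = Const (inverse (of_nat m) * of_nat m) * subst y (P ^ card Q)"
    by (simp only: Const_mult mult.assoc)
  then have "subst y (P ^ card Q) = Const (inverse (of_nat m)) * tr z"
    using m by simp
  then have "subst y (P ^ card Q) = tr (Const (inverse (of_nat m)) * z)"
    using tr_mult_invariant[OF invariants_closed(3)] by simp
  moreover have "P ^ card Q \<noteq> 0"
    using \<rho>(1) Q.finite by (auto simp: P_def prod_zero_iff)
  moreover have "vars_in (UNIV - {i}) (P ^ card Q)"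
    unfolding P_def by (intro vars_in_power vars_in_prod \<rho>(2))
  ultimately show ?thesis using that by blast
qed

end

section \<open>Homogeneous systems of parameters\<close>

lemma map_poly_mult_hom:
  fixes h :: "'a::comm_ring_1 \<Rightarrow> 'b::comm_ring_1"
  assumes "\<And>a b. h (a + b) = h a + h b" "\<And>a b. h (a * b) = h a * h b" "h 0 = 0"
  shows "map_poly h (p * q) = map_poly h p * map_poly h q"
proof (rule poly_eqI)
  fix n
  have "h (\<Sum>i\<in>S. f i) = (\<Sum>i\<in>S. h (f i))" for S and f :: "nat \<Rightarrow> 'a"
    by (induction S rule: infinite_finite_induct) (auto simp: assms)
  then show "coeff (map_poly h (p * q)) n = coeff (map_poly h p * map_poly h q) n"
    by (simp add: coeff_map_poly assms coeff_mult)
qed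

lemma map_poly_prod_hom:
  fixes h :: "'a::comm_ring_1 \<Rightarrow> 'b::comm_ring_1"
  assumes "\<And>a b. h (a + b) = h a + h b" "\<And>a b. h (a * b) = h a * h b" "h 0 = 0" "h 1 = 1"
  shows "map_poly h (prod f S) = (\<Prod>x\<in>S. map_poly h (f x))"
  by (induction S rule: infinite_finite_induct) (auto simp: map_poly_mult_hom assms map_poly_1)

context linear_group
begin

lemma invariant_ring_simps [simp]:
  "carrier (invariant_ring G) = invariants G" "monoid.mult (invariant_ring G) = (*)"
  "one (invariant_ring G) = 1" "zero (invariant_ring G) = 0" "add (invariant_ring G) = (+)"
  by (simp_all add: invariant_ring_def)

lemma ring_invariant_ring: "ring (invariant_ring G)"
proof (intro ringI abelian_groupI monoidI)
  fix x assume "x \<in> carrier (invariant_ring G)"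
  then show "\<exists>y\<in>carrier (invariant_ring G). y \<oplus>\<^bsub>invariant_ring G\<^esub> x = \<zero>\<^bsub>invariant_ring G\<^esub>"
    by (intro bexI[of _ "- x"]) (auto intro: invariants_closed)
qed (auto intro: invariants_closed simp: algebra_simps)

text \<open>The variables are integral over the invariant ring, as roots of \<open>\<Prod>\<^sub>g (X - g(x\<^sub>k))\<close>.\<close>

lemma Var_power_invariant_combination:
  obtains c where "\<And>j. j < card G \<Longrightarrow> c j \<in> homogeneous_max_ideal G"
    "Var k ^ card G = (\<Sum>j<card G. c j * Var k ^ j)"
proof -
  define F where "F = (\<Prod>g\<in>G. [:- act g (Var k), 1:])"
  let ?\<epsilon> = "\<lambda>p :: ('n, 'k) mpoly. Poly_Mapping.lookup p 0"
  have "coeff F j \<in> invariants G" for j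
    unfolding invariants_def
  proof (intro CollectI ballI)
    fix h assume h: "h \<in> G"
    \<comment> \<open>Applying \<open>h\<close> to the coefficients permutes the linear
      factors.\<close>
    have "map_poly (act h) F = (\<Prod>g\<in>G. [:- act (g ** h) (Var k), 1:])"
      unfolding F_def
      by (subst map_poly_prod_hom) (auto simp: act_add act_mult act_uminus act_act map_poly_pCons)
    also have "\<dots> = F"
      unfolding F_def by (rule prod.reindex_bij_betw[OF bij_mult(1)[OF h], where g = "\<lambda>g. [:- act g (Var k), 1:]"])
    finally have "coeff (map_poly (act h) F) j = coeff F j" by simp
    then show "act h (coeff F j) = coeff F j" by (simp add: coeff_map_poly)
  qed
  \<comment> \<open>Linear forms have no constant term, so taking constant terms turns
    \<open>F\<close> into the power of the indeterminate with exponent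
    \<open>card G\<close>.\<close>
  moreover have "?\<epsilon> (coeff F j) = 0" if "j < card G" for j
  proof -
    have "Poly_Mapping.single i (1::nat) \<noteq> 0" for i :: 'n
      by (metis lookup_single_eq lookup_zero zero_neq_one)
    then have "?\<epsilon> (act g (Var k)) = 0" for g
      by (simp add: act_Var lookup_sum lookup_Const_mult) (simp add: Var_def lookup_single when_def)
    then have "map_poly ?\<epsilon> F = (\<Prod>g\<in>G. [:0, 1:])"
      unfolding F_def
      by (subst map_poly_prod_hom) (auto simp: lookup_add lookup_mult_0 map_poly_pCons)
    then have "map_poly ?\<epsilon> F = monom 1 (card G)"
      by (simp add: monom_altdef)
    then have "coeff (map_poly ?\<epsilon> F) j = 0"
      using that by simp
    then show ?thesis by (simp add: coeff_map_poly)
  qed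
  ultimately have coeffs: "- coeff F j \<in> homogeneous_max_ideal G" if "j < card G" for j
    using that by (auto simp: homogeneous_max_ideal_def intro: invariants_closed)
  have deg: "degree F = card G"
    unfolding F_def by (subst degree_prod_eq_sum_degree) auto
  have "lead_coeff F = 1"
    unfolding F_def lead_coeff_prod by simp
  have "poly F (Var k) = 0"
    unfolding F_def poly_prod using finite one_mem by (auto intro!: prod_zero bexI[of _ "mat 1"])
  then have "(\<Sum>j\<le>card G. coeff F j * Var k ^ j) = 0"
    by (simp add: poly_altdef deg)
  then have "(\<Sum>j<card G. coeff F j * Var k ^ j) + Var k ^ card G = 0"
    using \<open>lead_coeff F = 1\<close> by (simp add: lessThan_Suc_atMost[symmetric] deg)
  then have "Var k ^ card G = (\<Sum>j<card G. - coeff F j * Var k ^ j)"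
    by (simp add: sum_negf add_eq_0_iff)
  with coeffs show ?thesis by (rule that)
qed

text \<open>If \<open>y i\<close> were 0, the radical of the ideal of \<open>R\<close> generated by
  the other parameters would contain the homogeneous maximal ideal of the invariants and, by
  integrality, all variables. \<open>too_few_parameters\<close> excludes this.\<close>

lemma hsop_nonzero:
  assumes "hsop G y"
  shows "y i \<noteq> 0"
proof
  assume i: "y i = 0"
  have y: "y j \<in> invariants G" "\<exists>d>0. homogeneous d (y j)" for j
    using assms unfolding hsop_def by auto
  have rad: "{f \<in> invariants G. \<exists>k::nat. f ^ k \<in> Idl\<^bsub>invariant_ring G\<^esub> (range y)} = homogeneous_max_ideal G"
    using assms unfolding hsop_def by auto
  have y0: "Poly_Mapping.lookup (y j) 0 = 0" for j
  proof (rule ccontr)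
    assume "Poly_Mapping.lookup (y j) 0 \<noteq> 0"
    then have "0 \<in> Poly_Mapping.keys (y j)" by (simp add: in_keys_iff)
    with y(2)[of j] show False by (auto simp: homogeneous_def)
  qed
  define J where "J = {p. \<exists>r. p = (\<Sum>j\<in>UNIV - {i}. y j * r j)}"
  have J_add: "p + q \<in> J" if "p \<in> J" "q \<in> J" for p q
  proof -
    from that obtain r s where "p = (\<Sum>j\<in>UNIV - {i}. y j * r j)" "q = (\<Sum>j\<in>UNIV - {i}. y j * s j)"
      unfolding J_def by blast
    then have "p + q = (\<Sum>j\<in>UNIV - {i}. y j * (r j + s j))"
      by (simp add: sum.distrib distrib_left)
    then show ?thesis unfolding J_def mem_Collect_eq by - (rule exI)
  qed
  have J_mult: "q * p \<in> J" if "p \<in> J" for p q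
  proof -
    from that obtain r where "p = (\<Sum>j\<in>UNIV - {i}. y j * r j)"
      unfolding J_def by blast
    then have "q * p = (\<Sum>j\<in>UNIV - {i}. y j * (q * r j))"
      by (simp add: sum_distrib_left algebra_simps)
    then show ?thesis unfolding J_def mem_Collect_eq by - (rule exI)
  qed
  have J_mult': "p * q \<in> J" if "p \<in> J" for p q
    using J_mult[OF that, of q] by (simp add: mult.commute)
  have J0: "0 \<in> J"
    unfolding J_def by (auto intro!: exI[of _ "\<lambda>_. 0"])
  have J_uminus: "- p \<in> J" if "p \<in> J" for p
    using J_mult[OF that, of "-1"] by simp
  have yJ: "y j \<in> J" for j
  proof (cases "j = i")
    case False
    then have "y j = (\<Sum>l\<in>UNIV - {i}. y l * (if l = j then 1 else 0))"
      by (simp add: if_distrib[where f = "\<lambda>x. _ * x"] cong: if_cong)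
    then show ?thesis unfolding J_def mem_Collect_eq by - (rule exI)
  qed (simp add: i J0)
  \<comment> \<open>The contraction of \<open>J\<close> is an ideal of the invariant ring containing
    every \<open>y j\<close>, so the ideal in \<open>hsop\<close> lies in \<open>J\<close>.\<close>
  have "ideal (J \<inter> invariants G) (invariant_ring G)"
  proof (rule idealI[OF ring_invariant_ring])
    interpret ring "invariant_ring G" by (rule ring_invariant_ring)
    show "subgroup (J \<inter> invariants G) (add_monoid (invariant_ring G))"
    proof (rule add.subgroupI)
      show "J \<inter> invariants G \<noteq> {}" using J0 invariants_closed(1) by blast
      show "\<ominus>\<^bsub>invariant_ring G\<^esub> a \<in> J \<inter> invariants G" if a: "a \<in> J \<inter> invariants G" for a
      proof -
        have "\<ominus>\<^bsub>invariant_ring G\<^esub> a = - a"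
          by (rule minus_equality) (use a invariants_closed(6) in auto)
        with a show ?thesis using J_uminus invariants_closed(6) by simp
      qed
    qed (auto intro: J_add invariants_closed)
  qed (auto intro: J_mult J_mult' invariants_closed)
  then have Idl: "Idl\<^bsub>invariant_ring G\<^esub> (range y) \<subseteq> J"
    unfolding genideal_def using yJ y(1) by blast
  define RJ where "RJ = {p. \<exists>e::nat. p ^ e \<in> J}"
  have RJ_add: "p + q \<in> RJ" if "p \<in> RJ" "q \<in> RJ" for p q
  proof -
    from that obtain e f where ef: "p ^ e \<in> J" "q ^ f \<in> J" unfolding RJ_def by blast
    have term_mem: "of_nat (e + f choose l) * p ^ l * q ^ (e + f - l) \<in> J" for l
    proof (cases "l \<ge> e")
      case True
      then have "p ^ l = p ^ (l - e) * p ^ e"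
        by (simp flip: power_add)
      then have "of_nat (e + f choose l) * p ^ l * q ^ (e + f - l) = 
          (of_nat (e + f choose l) * p ^ (l - e) * q ^ (e + f - l)) * p ^ e"
        by (simp only: mult_ac)
      then show ?thesis by (simp only: J_mult[OF ef(1)])
    next
      case False
      then have "e + f - l = (e - l) + f" by simp
      then have "of_nat (e + f choose l) * p ^ l * q ^ (e + f - l) = 
          (of_nat (e + f choose l) * p ^ l * q ^ (e - l)) * q ^ f"
        by (simp only: power_add mult_ac)
      then show ?thesis by (simp only: J_mult[OF ef(2)])
    qed
    have sum_mem: "sum f S \<in> J" if "\<And>l. f l \<in> J" for f and S :: "nat set"
      by (induction S rule: infinite_finite_induct) (auto intro: J0 J_add that)
    have "(p + q) ^ (e + f) \<in> J"
      unfolding binomial_ring by (rule sum_mem, rule term_mem)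
    then show ?thesis unfolding RJ_def by blast
  qed
  have RJ0: "0 \<in> RJ"
    unfolding RJ_def by (auto simp: J0 intro!: exI[of _ "1::nat"])
  have RJ_mult: "p * q \<in> RJ" if "p \<in> RJ" for p q
  proof -
    from that obtain e where "p ^ e \<in> J" unfolding RJ_def by blast
    then have "(p * q) ^ e \<in> J" using J_mult[of "p ^ e" "q ^ e"] by (simp add: power_mult_distrib mult.commute)
    then show ?thesis unfolding RJ_def by blast
  qed
  \<comment> \<open>The coefficients of the integral equation lie in the radical \<open>RJ\<close>
    of \<open>J\<close>, hence so does a power of the variable.\<close>
  have "\<exists>e. Var k ^ e \<in> J" for k
  proof -
    obtain c where c: "\<And>j. j < card G \<Longrightarrow> c j \<in> homogeneous_max_ideal G"
      "Var k ^ card G = (\<Sum>j<card G. c j * Var k ^ j)"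
      by (rule Var_power_invariant_combination[of k]) (rule that)
    have term_mem: "c j * Var k ^ j \<in> RJ" if "j < card G" for j
      using c(1)[OF that] Idl unfolding rad[symmetric] by (intro RJ_mult) (auto simp: RJ_def)
    have sum_mem: "(\<Sum>j\<in>S. f j) \<in> RJ" if "\<And>j. j \<in> S \<Longrightarrow> f j \<in> RJ" for f and S :: "nat set"
      using that by (induction S rule: infinite_finite_induct) (auto intro: RJ_add RJ0)
    have "Var k ^ card G \<in> RJ"
      unfolding c(2) by (rule sum_mem, rule term_mem, simp)
    then show ?thesis unfolding RJ_def by (auto simp flip: power_mult)
  qed
  then have "\<forall>k. \<exists>e. Var k ^ e \<in> J" ..
  from choice[OF this] obtain e where e: "\<And>k. Var k ^ e k \<in> J" by blast
  show False
  proof (rule too_few_parameters[OF y0])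
    fix k
    have "Var k ^ (\<Sum>k\<in>UNIV. e k) = Var k ^ ((\<Sum>k\<in>UNIV. e k) - e k) * Var k ^ e k"
      by (simp add: member_le_sum flip: power_add)
    then have "Var k ^ (\<Sum>k\<in>UNIV. e k) \<in> J"
      by (rule ssubst[where P = "\<lambda>t. t \<in> J"]) (rule J_mult[OF e])
    then show "\<exists>r. Var k ^ (\<Sum>k\<in>UNIV. e k) = (\<Sum>j\<in>UNIV - {i}. y j * r j)"
      unfolding J_def by simp
  qed
qed

end

section \<open>Cech boundaries and duality\<close>

text \<open>Adjoining \<open>v\<close> to a basis of \<open>U\<close> keeps it independent, so a
  functional may be prescribed as 0 on the basis and 1 at \<open>v\<close>.\<close>

lemma (in vector_space) separating_functional:
  assumes "subspace U" "v \<notin> U"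
  obtains \<theta> where "\<And>x y. \<theta> (x + y) = \<theta> x + \<theta> y" "\<And>c x. \<theta> (scale c x) = c * \<theta> x"
    "\<And>u. u \<in> U \<Longrightarrow> \<theta> u = (0::'a)" "\<theta> v \<noteq> 0"
proof -
  interpret VP: vector_space_pair scale "(*) :: 'a \<Rightarrow> 'a \<Rightarrow> 'a"
    by unfold_locales (auto simp: algebra_simps)
  obtain B where B: "B \<subseteq> U" "independent B" "U \<subseteq> span B"
    using maximal_independent_subset by blast
  have "span B \<subseteq> U"
    using B(1) assms(1) by (rule span_minimal)
  then have v: "v \<notin> span B" using assms(2) by blast
  with B(2) have "independent (insert v B)"
    using independent_insertI by blast
  from VP.linear_independent_extend[OF this, of "\<lambda>x. if x = v then 1 else 0"]
  obtain \<theta> where \<theta>: "Vector_Spaces.linear scale (*) \<theta>" "\<And>x. x \<in> insert v B \<Longrightarrow> \<theta> x = (if x = v then 1 else 0)"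
    by blast
  have "v \<notin> B" using v span_base by blast
  then have "\<theta> x = 0" if "x \<in> B" for x
    using \<theta>(2)[of x] that by auto
  then have "\<theta> u = 0" if "u \<in> U" for u
    using VP.linear_eq_0_on_span[OF \<theta>(1), of B] B(3) that by blast
  moreover have "\<theta> v \<noteq> 0" using \<theta>(2)[of v] by simp
  ultimately show ?thesis
    using that[of \<theta>] VP.linear_add[OF \<theta>(1)] VP.linear_scale[OF \<theta>(1)] by blast
qed

interpretation fract_space: vector_space "\<lambda>c (x :: ('n::{finite,linorder}, 'k::field) mpoly fract). Fract (Const c) 1 * x"
proof
  fix a b :: 'k and x y :: "('n, 'k) mpoly fract"
  show "Fract (Const (a + b)) 1 * x = Fract (Const a) 1 * x + Fract (Const b) 1 * x"
    by (simp add: Const_add flip: distrib_right)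
  show "Fract (Const a) 1 * (Fract (Const b) 1 * x) = Fract (Const (a * b)) 1 * x"
    by (simp add: Const_mult flip: mult.assoc)
  show "Fract (Const 1) 1 * x = x"
    by (simp flip: One_fract_def)
qed (simp add: distrib_left)

lemma Fract_add_same: "d \<noteq> 0 \<Longrightarrow> Fract a d + Fract b d = Fract (a + b) (d :: 'a::idom)"
  by (simp add: eq_fract algebra_simps)

lemma Fract_0: "Fract 0 d = (0 :: 'a::idom fract)"
  by (cases "d = 0") (simp_all add: Zero_fract_def eq_fract)

lemma Fract_sum_same: "d \<noteq> 0 \<Longrightarrow> (\<Sum>x\<in>S. Fract (f x) d) = Fract (\<Sum>x\<in>S. f x) (d :: 'a::idom)"
  by (induction S rule: infinite_finite_induct) (auto simp: Fract_add_same Fract_0 simp del: add_fract)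

locale cech = linear_group G
  for G :: "('k::field ^ 'n::{finite,linorder} ^ 'n::{finite,linorder}) set" +
  fixes y :: "'n \<Rightarrow> ('n, 'k) mpoly"
  assumes y_invariant: "y i \<in> invariants G" and y_nonzero: "y i \<noteq> 0"
begin

definition Y :: "('n, 'k) mpoly" where "Y = (\<Prod>i\<in>UNIV. y i)"

definition mon :: "('n \<Rightarrow> nat) \<Rightarrow> ('n, 'k) mpoly" where "mon e = (\<Prod>i\<in>UNIV. y i ^ e i)"

lemma Y_nonzero [simp]: "Y \<noteq> 0"
  by (simp add: Y_def y_nonzero)

lemma mon_nonzero [simp]: "mon e \<noteq> 0"
  by (simp add: mon_def y_nonzero)

lemma mon_add: "mon (\<lambda>i. e i + f i) = mon e * mon f"
  by (simp add: mon_def power_add prod.distrib)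

lemma Y_power: "Y ^ N = mon (\<lambda>_. N)"
  by (simp add: Y_def mon_def prod_power_distrib)

lemma Y_remove: "Y = y i * (\<Prod>j\<in>UNIV - {i}. y j)"
  unfolding Y_def by (rule prod.remove) auto

lemma mon_invariant: "mon e \<in> invariants G" and Y_invariant: "Y \<in> invariants G"
  unfolding mon_def Y_def by (intro invariants_closed y_invariant)+

text \<open>The two coefficient rings whose cohomology is compared, treated uniformly.\<close>

definition coefficients :: "('n, 'k) mpoly set \<Rightarrow> bool" where
  "coefficients S \<longleftrightarrow> S = UNIV \<or> S = invariants G"

lemma coefficients_invariant: "coefficients S \<Longrightarrow> p \<in> invariants G \<Longrightarrow> p \<in> S"
  by (auto simp: coefficients_def)

lemma coefficients_closed:
  assumes "coefficients S"
  shows "p \<in> S \<Longrightarrow> q \<in> S \<Longrightarrow> p + q \<in> S" "p \<in> S \<Longrightarrow> q \<in> S \<Longrightarrow> p * q \<in> S"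
    "p \<in> S \<Longrightarrow> - p \<in> S" "0 \<in> S" "1 \<in> S" "Const c \<in> S"
    "(\<And>x. x \<in> T \<Longrightarrow> f x \<in> S) \<Longrightarrow> sum f T \<in> S" "(\<And>x. x \<in> T \<Longrightarrow> f x \<in> S) \<Longrightarrow> prod f T \<in> S"
    "p \<in> S \<Longrightarrow> p ^ k \<in> S" "y i \<in> S" "Y \<in> S" "mon e \<in> S"
  using assms unfolding coefficients_def
  by (auto intro: invariants_closed y_invariant Y_invariant mon_invariant)

lemma coefficients_simps [simp]: "coefficients UNIV" "coefficients (invariants G)"
  by (simp_all add: coefficients_def)

text \<open>Bringing the \<open>i\<close>-th summand to the denominator \<open>Y ^ N\<close> leaves
  a factor \<open>y i ^ N\<close> in its numerator. This is the description of top local cohomology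
  as the limit of the quotients by the ideals generated by the \<open>y i ^ N\<close>.\<close>

lemma boundaries_eq:
  assumes S: "coefficients S"
  shows "cech_boundaries S y = {Fract (\<Sum>i\<in>UNIV. s i * y i ^ N) (Y ^ N) | s N. \<forall>i. s i \<in> S}"
proof (intro Set.set_eqI iffI)
  fix x assume "x \<in> cech_boundaries S y"
  then obtain z where z: "x = (\<Sum>i\<in>UNIV. z i)" "\<And>i. z i \<in> localization S (\<Prod>j\<in>UNIV - {i}. y j)"
    unfolding cech_boundaries_def by auto
  let ?P = "\<lambda>i. \<Prod>j\<in>UNIV - {i}. y j"
  from z(2) have "\<forall>i. \<exists>s. \<exists>d. z i = Fract s (?P i ^ d) \<and> s \<in> S"
    unfolding localization_def by blast
  from choice[OF this] obtain s where "\<forall>i. \<exists>d. z i = Fract (s i) (?P i ^ d) \<and> s i \<in> S" by blast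
  from choice[OF this] obtain d where sd: "\<And>i. z i = Fract (s i) (?P i ^ d i)" "\<And>i. s i \<in> S" by blast
  define N where "N = (\<Sum>i\<in>UNIV. d i)"
  have dN: "d i \<le> N" for i unfolding N_def by (intro member_le_sum) auto
  have "z i = Fract (s i * ?P i ^ (N - d i) * y i ^ N) (Y ^ N)" for i
  proof -
    have P0: "?P i \<noteq> 0" by (simp add: y_nonzero)
    have "z i = Fract ((?P i ^ (N - d i) * y i ^ N) * s i) ((?P i ^ (N - d i) * y i ^ N) * ?P i ^ d i)"
      unfolding sd(1) by (subst mult_fract_cancel) (use P0 y_nonzero in auto)
    also have "(?P i ^ (N - d i) * y i ^ N) * ?P i ^ d i = y i ^ N * ?P i ^ (N - d i + d i)"
      unfolding power_add by (simp only: mult_ac)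
    also have "\<dots> = Y ^ N" using dN[of i] by (simp add: Y_remove[of i] power_mult_distrib)
    finally show ?thesis by (simp only: mult_ac)
  qed
  then have "x = Fract (\<Sum>i\<in>UNIV. (s i * ?P i ^ (N - d i)) * y i ^ N) (Y ^ N)"
    unfolding z(1) by (simp add: Fract_sum_same)
  moreover have "s i * ?P i ^ (N - d i) \<in> S" for i
    using sd(2) by (intro coefficients_closed[OF S])
  ultimately show "x \<in> {Fract (\<Sum>i\<in>UNIV. s i * y i ^ N) (Y ^ N) | s N. \<forall>i. s i \<in> S}"
    unfolding mem_Collect_eq by - (rule exI[of _ "\<lambda>i. s i * ?P i ^ (N - d i)"], rule exI[of _ N], simp)
next
  fix x assume "x \<in> {Fract (\<Sum>i\<in>UNIV. s i * y i ^ N) (Y ^ N) | s N. \<forall>i. s i \<in> S}"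
  then obtain s N where x: "x = Fract (\<Sum>i\<in>UNIV. s i * y i ^ N) (Y ^ N)" "\<And>i. s i \<in> S" by blast
  have "Fract (s i * y i ^ N) (Y ^ N) = Fract (s i) ((\<Prod>j\<in>UNIV - {i}. y j) ^ N)" for i
    unfolding Y_remove[of i] power_mult_distrib mult.commute[of "s i"]
    by (rule mult_fract_cancel) (simp add: y_nonzero)
  then have "x = (\<Sum>i\<in>UNIV. Fract (s i) ((\<Prod>j\<in>UNIV - {i}. y j) ^ N))"
    unfolding x(1) by (simp flip: Fract_sum_same)
  then show "x \<in> cech_boundaries S y"
    unfolding cech_boundaries_def mem_Collect_eq localization_def using x(2)
    by - (rule exI[of _ "\<lambda>i. Fract (s i) ((\<Prod>j\<in>UNIV - {i}. y j) ^ N)"], auto)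
qed

lemma boundaryI: "coefficients S \<Longrightarrow> (\<And>i. s i \<in> S) \<Longrightarrow> Fract (\<Sum>i\<in>UNIV. s i * y i ^ N) (Y ^ N) \<in> cech_boundaries S y"
  unfolding boundaries_eq by blast

lemma boundaryE:
  assumes "coefficients S" "x \<in> cech_boundaries S y"
  obtains s N where "\<And>i. s i \<in> S" "x = Fract (\<Sum>i\<in>UNIV. s i * y i ^ N) (Y ^ N)" "N \<ge> M"
proof -
  from assms obtain s N where s: "\<And>i. s i \<in> S" "x = Fract (\<Sum>i\<in>UNIV. s i * y i ^ N) (Y ^ N)"
    unfolding boundaries_eq[OF assms(1)] by blast
  have "x = Fract (Y ^ M * (\<Sum>i\<in>UNIV. s i * y i ^ N)) (Y ^ M * Y ^ N)"
    unfolding s(2) by (simp add: mult_fract_cancel)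
  also have "Y ^ M * (\<Sum>i\<in>UNIV. s i * y i ^ N) = 
      (\<Sum>i\<in>UNIV. (s i * (\<Prod>j\<in>UNIV - {i}. y j) ^ M) * y i ^ (M + N))"
    unfolding sum_distrib_left
  proof (rule sum.cong)
    fix i
    show "Y ^ M * (s i * y i ^ N) = (s i * (\<Prod>j\<in>UNIV - {i}. y j) ^ M) * y i ^ (M + N)"
      unfolding Y_remove[of i] power_mult_distrib power_add by (simp only: mult_ac)
  qed simp
  finally have "x = Fract (\<Sum>i\<in>UNIV. (s i * (\<Prod>j\<in>UNIV - {i}. y j) ^ M) * y i ^ (M + N)) (Y ^ (M + N))"
    by (simp add: power_add)
  then show ?thesis
    by (rule that[rotated]) (use s(1) in \<open>auto intro!: coefficients_closed[OF assms(1)]\<close>)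
qed

lemma boundaries_add:
  assumes S: "coefficients S" and x: "x \<in> cech_boundaries S y" "x' \<in> cech_boundaries S y"
  shows "x + x' \<in> cech_boundaries S y"
proof -
  from x(1) obtain z where z: "x = (\<Sum>i\<in>UNIV. z i)" "\<And>i. z i \<in> localization S (\<Prod>j\<in>UNIV - {i}. y j)"
    unfolding cech_boundaries_def by auto
  from x(2) obtain z' where z': "x' = (\<Sum>i\<in>UNIV. z' i)" "\<And>i. z' i \<in> localization S (\<Prod>j\<in>UNIV - {i}. y j)"
    unfolding cech_boundaries_def by auto
  have "z i + z' i \<in> localization S (\<Prod>j\<in>UNIV - {i}. y j)" for i
  proof -
    let ?P = "\<Prod>j\<in>UNIV - {i}. y j"
    have P: "?P \<noteq> 0" "?P \<in> S" using y_nonzero by (auto intro!: coefficients_closed[OF S])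
    obtain s d s' d' where sd: "s \<in> S" "s' \<in> S" "z i = Fract s (?P ^ d)" "z' i = Fract s' (?P ^ d')"
      using z(2)[of i] z'(2)[of i] unfolding localization_def by blast
    then have "z i + z' i = Fract (s * ?P ^ d' + s' * ?P ^ d) (?P ^ (d + d'))"
      using P(1) by (simp add: power_add)
    moreover have "s * ?P ^ d' + s' * ?P ^ d \<in> S"
      using sd P by (intro coefficients_closed[OF S])
    ultimately show ?thesis unfolding localization_def by blast
  qed
  moreover have "x + x' = (\<Sum>i\<in>UNIV. z i + z' i)" by (simp add: z(1) z'(1) sum.distrib)
  ultimately show ?thesis unfolding cech_boundaries_def by blast
qed

lemma boundaries_mult:
  assumes S: "coefficients S" and x: "x \<in> cech_boundaries S y" and c: "c \<in> S"
  shows "Fract c 1 * x \<in> cech_boundaries S y"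
proof -
  obtain s N where s: "\<And>i. s i \<in> S" "x = Fract (\<Sum>i\<in>UNIV. s i * y i ^ N) (Y ^ N)"
    using x unfolding boundaries_eq[OF S] by blast
  have "Fract c 1 * x = Fract (\<Sum>i\<in>UNIV. (c * s i) * y i ^ N) (Y ^ N)"
    by (simp add: s(2) sum_distrib_left mult.assoc)
  then show ?thesis
    using boundaryI[OF S, of "\<lambda>i. c * s i"] s(1) c by (simp add: coefficients_closed[OF S])
qed

lemma boundaries_0: "coefficients S \<Longrightarrow> 0 \<in> cech_boundaries S y"
  using boundaryI[of S "\<lambda>_. 0" 0] by (simp add: coefficients_closed Fract_0)

lemma boundaries_uminus:
  assumes "coefficients S" "x \<in> cech_boundaries S y"
  shows "- x \<in> cech_boundaries S y"
proof -
  have "Fract (- 1) 1 * x = - x"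
    by (simp flip: minus_fract One_fract_def)
  then show ?thesis
    using boundaries_mult[OF assms, of "- 1"] coefficients_closed(3,5)[OF assms(1)] by simp
qed

lemma Fract_boundary_iff:
  assumes S: "coefficients S"
  shows "Fract s (Y ^ d) \<in> cech_boundaries S y \<longleftrightarrow>
    (\<exists>t N. (\<forall>i. t i \<in> S) \<and> s * Y ^ N = (\<Sum>i\<in>UNIV. t i * y i ^ N) * Y ^ d)"
  unfolding boundaries_eq[OF S] by (auto simp: eq_fract)

text \<open>The power of \<open>y k\<close> in the numerator cancels the one in the denominator, so
  the fraction lies in the localization that does not invert \<open>y k\<close>.\<close>

lemma boundary_monomial:
  assumes S: "coefficients S" and r: "r \<in> S" and k: "f k \<le> e k"
  shows "Fract (mon e * r) (mon f) \<in> cech_boundaries S y"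
proof -
  define N where "N = (\<Sum>i\<in>UNIV. f i)"
  have fN: "f i \<le> N" for i unfolding N_def by (intro member_le_sum) auto
  \<comment> \<open>The truncated subtraction is exact at \<open>k\<close>, as
    \<open>f k \<le> e k\<close> and \<open>f k \<le> N\<close> give
    \<open>e k + (N - f k) \<ge> N\<close>.\<close>
  define e' where "e' i = e i + (N - f i) - (if i = k then N else 0)" for i
  have "Fract (mon e * r) (mon f) = Fract (mon (\<lambda>i. N - f i) * (mon e * r)) (mon (\<lambda>i. N - f i) * mon f)"
    by (simp add: mult_fract_cancel)
  also have "mon (\<lambda>i. N - f i) * mon f = Y ^ N"
    using fN by (simp add: Y_power flip: mon_add)
  also have "mon (\<lambda>i. N - f i) * (mon e * r) = mon (\<lambda>i. e i + (N - f i)) * r"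
    by (simp add: mon_add mult_ac)
  also have "(\<lambda>i. e i + (N - f i)) = (\<lambda>i. e' i + (if i = k then N else 0))"
    using k fN by (auto simp: e'_def)
  also have "mon \<dots> = mon e' * y k ^ N"
    unfolding mon_add by (simp add: mon_def if_distrib[where f = "\<lambda>n. _ ^ n"] cong: if_cong)
  also have "mon e' * y k ^ N * r = (\<Sum>i\<in>UNIV. (if i = k then mon e' * r else 0) * y i ^ N)"
  proof -
    have "(\<Sum>i\<in>UNIV. (if i = k then mon e' * r else 0) * y i ^ N) = (\<Sum>i\<in>UNIV. if i = k then mon e' * r * y i ^ N else 0)"
      by (rule sum.cong) auto
    then show ?thesis by (simp add: mult_ac)
  qed
  finally show ?thesis
    using boundaryI[OF S, of "\<lambda>i. if i = k then mon e' * r else 0"] r by (simp add: coefficients_closed[OF S])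
qed

end

lemma le_sum_UNIV: "f i \<le> (\<Sum>i\<in>UNIV. f i)" for f :: "'n::finite \<Rightarrow> nat"
  by (rule member_le_sum) auto

context cech
begin

lemma mon_complement:
  assumes "\<And>i. f i \<le> N"
  shows "mon (\<lambda>i. N - f i) * mon f = Y ^ N"
  unfolding Y_power mon_add[symmetric] using assms by simp

text \<open>
  A linear functional that vanishes on the boundaries assigns to every \<open>r\<close> the power series
  \<open>\<Sum>\<^sub>a \<theta>(r / y\<^sup>a\<^sup>+\<^sup>1) y\<^sup>a\<close>, and this map is linear over the polynomials in \<open>y\<close>.
\<close>

definition dual_series :: "(('n, 'k) mpoly fract \<Rightarrow> 'k) \<Rightarrow> ('n, 'k) mpoly \<Rightarrow> ('n \<Rightarrow>\<^sub>0 nat) \<Rightarrow> 'k" where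
  "dual_series \<theta> r a = \<theta> (Fract r (mon (\<lambda>i. Suc (Poly_Mapping.lookup a i))))"

text \<open>Functionals on cohomology are represented by functionals on the whole fraction field
  that vanish on boundaries, so that they apply directly to fractions.\<close>

definition boundary_functional :: "('n, 'k) mpoly set \<Rightarrow> (('n, 'k) mpoly fract \<Rightarrow> 'k) \<Rightarrow> bool" where
  "boundary_functional S \<theta> \<longleftrightarrow> (\<forall>x x'. \<theta> (x + x') = \<theta> x + \<theta> x') \<and>
     (\<forall>c x. \<theta> (Fract (Const c) 1 * x) = c * \<theta> x) \<and> (\<forall>x \<in> cech_boundaries S y. \<theta> x = 0)"

context
  fixes S \<theta>
  assumes S: "coefficients S" and \<theta>: "boundary_functional S \<theta>"
begin

lemma \<theta>_add: "\<theta> (x + x') = \<theta> x + \<theta> x'"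
  and \<theta>_scale: "\<theta> (Fract (Const c) 1 * x) = c * \<theta> x"
  and \<theta>_boundary: "x \<in> cech_boundaries S y \<Longrightarrow> \<theta> x = 0"
  using \<theta> by (auto simp: boundary_functional_def)

lemma \<theta>_0: "\<theta> 0 = 0"
  using \<theta>_scale[of 0 0] by simp

lemma dual_series_add: "dual_series \<theta> (r + s) = (\<lambda>a. dual_series \<theta> r a + dual_series \<theta> s a)"
  by (rule ext) (simp add: dual_series_def Fract_add_same flip: \<theta>_add del: add_fract)

lemma dual_series_0: "dual_series \<theta> 0 = (\<lambda>a. 0)"
  by (rule ext) (simp add: dual_series_def Fract_0 \<theta>_0)

lemma dual_series_sum: "dual_series \<theta> (\<Sum>x\<in>T. f x) = (\<lambda>a. \<Sum>x\<in>T. dual_series \<theta> (f x) a)"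
  by (induction T rule: infinite_finite_induct) (simp_all add: dual_series_0 dual_series_add)

lemma dual_series_diff: "dual_series \<theta> (r - s) = (\<lambda>a. dual_series \<theta> r a - dual_series \<theta> s a)"
proof -
  have "dual_series \<theta> r = dual_series \<theta> ((r - s) + s)" by simp
  then show ?thesis unfolding dual_series_add by (auto simp: fun_eq_iff)
qed

lemma dual_series_Const: "dual_series \<theta> (Const c * r) = (\<lambda>a. c * dual_series \<theta> r a)"
  by (rule ext) (simp add: dual_series_def flip: \<theta>_scale)

text \<open>If \<open>m\<close> divides \<open>a\<close>, the monomial cancels against the
  denominator. Otherwise some exponent satisfies \<open>Suc (lookup a k) \<le> lookup m k\<close>,
  and the fraction is a boundary.\<close>

lemma dual_series_monomial:
  assumes "r \<in> S"
  shows "dual_series \<theta> (mon (Poly_Mapping.lookup m) * r) = shift m (dual_series \<theta> r)"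
proof
  fix a
  show "dual_series \<theta> (mon (Poly_Mapping.lookup m) * r) a = shift m (dual_series \<theta> r) a"
  proof (cases "mdvd m a")
    case True
    then obtain b where a: "a = m + b" by (rule mdvdE)
    have "mon (\<lambda>i. Suc (Poly_Mapping.lookup a i)) = 
        mon (Poly_Mapping.lookup m) * mon (\<lambda>i. Suc (Poly_Mapping.lookup b i))"
      by (simp add: a lookup_add flip: mon_add)
    then show ?thesis
      by (simp add: dual_series_def shift_def mult_fract_cancel) (simp add: a)
  next
    case False
    then obtain k where "Poly_Mapping.lookup a k < Poly_Mapping.lookup m k"
      by (auto simp: mdvd_def not_le)
    then have "Fract (mon (Poly_Mapping.lookup m) * r) (mon (\<lambda>i. Suc (Poly_Mapping.lookup a i))) \<in> cech_boundaries S y"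
      by (intro boundary_monomial[OF S assms, of _ k]) simp
    with False show ?thesis
      by (simp add: dual_series_def shift_def \<theta>_boundary)
  qed
qed

lemma dual_series_subst:
  assumes "r \<in> S"
  shows "dual_series \<theta> (subst y \<rho> * r) = pact \<rho> (dual_series \<theta> r)"
proof (induction \<rho> rule: mpoly_add_induct)
  case (single m c)
  have "subst y (Poly_Mapping.single m c) * r = Const c * (mon (Poly_Mapping.lookup m) * r)"
    by (simp add: subst_single mon_def mult.assoc)
  then show ?case
    by (simp only: dual_series_Const dual_series_monomial[OF assms] pact_single)
next
  case (add p q)
  then show ?case by (simp add: subst_add distrib_right dual_series_add pact_add_left)
qed

end

lemma subst_single_Y: "subst y (Poly_Mapping.single m 1) = mon (Poly_Mapping.lookup m)"
  by (simp add: subst_single mon_def)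

definition const_exponent :: "nat \<Rightarrow> 'n \<Rightarrow>\<^sub>0 nat" where
  "const_exponent M = Abs_poly_mapping (\<lambda>_. M)"

lemma lookup_const_exponent [simp]: "Poly_Mapping.lookup (const_exponent M) i = M"
  by (simp add: const_exponent_def)

lemma dual_series_const_exponent:
  "dual_series \<theta> r (const_exponent M) = \<theta> (Fract r (Y ^ Suc M))"
  by (simp add: dual_series_def Y_power del: power_Suc)

section \<open>Exactness for representing fractions\<close>

text \<open>Otherwise a functional vanishing on boundaries and on all \<open>s - g(s)\<close> is
  nonzero at \<open>r / Y^d\<close>. Its series map is constant on orbits and factors through the
  transfer, which forces its value at \<open>r / Y^d\<close> to be 0.\<close>

lemma transfer_kernel:
  assumes notrans: "\<forall>g\<in>G. \<not> transvection g"
    and r: "Fract (tr r) (Y ^ d) \<in> cech_boundaries (invariants G) y"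
  shows "\<exists>s N. \<exists>b \<in> cech_boundaries UNIV y. Fract r (Y ^ d) = Fract (\<Sum>g\<in>G. s g - act g (s g)) (Y ^ N) + b"
proof -
  define U where "U = {Fract (\<Sum>g\<in>G. s g - act g (s g)) (Y ^ N) + b | s N b. b \<in> cech_boundaries UNIV y}"
  have UI: "Fract (\<Sum>g\<in>G. s g - act g (s g)) (Y ^ N) + b \<in> U" if "b \<in> cech_boundaries UNIV y" for s N b
    using that unfolding U_def by blast
  have B_U: "b \<in> U" if "b \<in> cech_boundaries UNIV y" for b
    using UI[OF that, of "\<lambda>_. 0" 0] by (simp add: Fract_0)
  have "fract_space.subspace U"
    unfolding fract_space.subspace_def
  proof (intro conjI ballI allI)
    show "0 \<in> U" by (rule B_U) (simp add: boundaries_0)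
  next
    fix x x' assume "x \<in> U" "x' \<in> U"
    then obtain s N b s' N' b' where x: "x = Fract (\<Sum>g\<in>G. s g - act g (s g)) (Y ^ N) + b" "b \<in> cech_boundaries UNIV y"
      "x' = Fract (\<Sum>g\<in>G. s' g - act g (s' g)) (Y ^ N') + b'" "b' \<in> cech_boundaries UNIV y"
      unfolding U_def by blast
    let ?t = "\<lambda>g. Y ^ N' * s g + Y ^ N * s' g"
    have YN: "act g (Y ^ M) = Y ^ M" if "g \<in> G" for g M
      using Y_invariant that by (simp add: act_power invariants_act)
    have "(\<Sum>g\<in>G. ?t g - act g (?t g)) = (\<Sum>g\<in>G. Y ^ N' * (s g - act g (s g)) + Y ^ N * (s' g - act g (s' g)))"
      by (rule sum.cong) (simp_all add: act_add act_mult YN algebra_simps)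
    also have "\<dots> = Y ^ N' * (\<Sum>g\<in>G. s g - act g (s g)) + Y ^ N * (\<Sum>g\<in>G. s' g - act g (s' g))"
      by (simp only: sum.distrib sum_distrib_left)
    finally have "Fract (\<Sum>g\<in>G. ?t g - act g (?t g)) (Y ^ (N + N')) = 
      Fract (\<Sum>g\<in>G. s g - act g (s g)) (Y ^ N) + Fract (\<Sum>g\<in>G. s' g - act g (s' g)) (Y ^ N')"
      by (simp add: power_add mult_ac)
    then have eq: "x + x' = Fract (\<Sum>g\<in>G. ?t g - act g (?t g)) (Y ^ (N + N')) + (b + b')"
      by (simp add: x)
    then show "x + x' \<in> U"
      unfolding eq by (intro UI boundaries_add x) simp
  next
    fix c x assume "x \<in> U"
    then obtain s N b where x: "x = Fract (\<Sum>g\<in>G. s g - act g (s g)) (Y ^ N) + b" "b \<in> cech_boundaries UNIV y"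
      unfolding U_def by blast
    have "Fract (Const c) 1 * x = Fract (\<Sum>g\<in>G. Const c * s g - act g (Const c * s g)) (Y ^ N) + Fract (Const c) 1 * b"
      by (simp add: x(1) distrib_left act_mult sum_distrib_left flip: right_diff_distrib)
    then show "Fract (Const c) 1 * x \<in> U"
      using boundaries_mult[of UNIV b "Const c"] x(2) by (simp only: UI coefficients_simps UNIV_I)
  qed
  have "Fract r (Y ^ d) \<in> U"
  proof (rule ccontr)
    assume "Fract r (Y ^ d) \<notin> U"
    then obtain \<theta> where \<theta>_add: "\<And>x x'. \<theta> (x + x') = \<theta> x + \<theta> x'" and \<theta>_scale: "\<And>c x. \<theta> (Fract (Const c) 1 * x) = c * \<theta> x"
      and \<theta>_U: "\<And>u. u \<in> U \<Longrightarrow> \<theta> u = (0 :: 'k)" and \<theta>_r: "\<theta> (Fract r (Y ^ d)) \<noteq> 0"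
      by (rule fract_space.separating_functional[OF \<open>fract_space.subspace U\<close>]) (rule that)
    have \<theta>: "boundary_functional UNIV \<theta>"
      unfolding boundary_functional_def using \<theta>_add \<theta>_scale \<theta>_U B_U by blast
    let ?\<phi> = "dual_series \<theta>"
    note subst_\<phi> = dual_series_subst[OF coefficients_simps(1) \<theta> UNIV_I]
    note diff_\<phi> = dual_series_diff[OF coefficients_simps(1) \<theta>]
    note sum_\<phi> = dual_series_sum[OF coefficients_simps(1) \<theta>]
    \<comment> \<open>Over the denominator \<open>Y ^ N\<close> the difference of \<open>w\<close>
      and \<open>act h w\<close> comes from a family concentrated at \<open>h\<close>; the
      multiplier \<open>mon\<close> is invariant and does not disturb this.\<close>
    have \<phi>_act: "?\<phi> (act h w) = ?\<phi> w" if h: "h \<in> G" for h w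
    proof
      fix a :: "'n \<Rightarrow>\<^sub>0 nat"
      define N where "N = (\<Sum>i\<in>UNIV. Suc (Poly_Mapping.lookup a i))"
      let ?e = "\<lambda>i. Suc (Poly_Mapping.lookup a i)"
      have N: "?e i \<le> N" for i unfolding N_def by (rule le_sum_UNIV[where f = ?e])
      let ?m = "mon (\<lambda>i. N - ?e i)"
      have inv: "act h ?m = ?m" using h mon_invariant by (simp add: invariants_act)
      have m: "?m * mon ?e = Y ^ N" by (rule mon_complement) (rule N)
      have eq: "Fract v (mon ?e) = Fract (?m * v) (Y ^ N)" for v
        unfolding m[symmetric] by (simp add: mult_fract_cancel)
      have "Fract (w - act h w) (mon ?e) = Fract (?m * w - act h (?m * w)) (Y ^ N)"
        unfolding eq by (simp add: act_mult inv right_diff_distrib)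
      also have "?m * w - act h (?m * w) = (\<Sum>g\<in>G. (if g = h then ?m * w else 0) - act g (if g = h then ?m * w else 0))"
      proof -
        have "(\<Sum>g\<in>G. (if g = h then ?m * w else 0) - act g (if g = h then ?m * w else 0)) =
          (\<Sum>g\<in>G. if g = h then ?m * w - act h (?m * w) else 0)"
          by (rule sum.cong) auto
        then show ?thesis using h finite by simp
      qed
      finally have "Fract (w - act h w) (mon ?e) \<in> U"
        using UI[OF boundaries_0[OF coefficients_simps(1)], of "\<lambda>g. if g = h then ?m * w else 0" N] by simp
      then have "?\<phi> (w - act h w) a = 0"
        unfolding dual_series_def by (rule \<theta>_U)
      then show "?\<phi> (act h w) a = ?\<phi> w a" by (simp add: diff_\<phi>)
    qed
    \<comment> \<open>The transfer is self-adjoint: applying the inverse of \<open>g\<close> to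
      \<open>act g z * w\<close> moves the group element to \<open>w\<close>, and inversion permutes
      \<open>G\<close>.\<close>
    have \<phi>_tr: "?\<phi> (tr z * w) = ?\<phi> (z * tr w)" for z w
    proof -
      have "?\<phi> (act g z * w) = ?\<phi> (z * act h w)" if "g \<in> G" "h \<in> G" "g ** h = mat 1" for g h
      proof -
        have "act h (act g z * w) = z * act h w"
          by (simp add: act_mult act_act that)
        then show ?thesis using \<phi>_act[OF that(2), of "act g z * w"] by simp
      qed
      note step = this
      define i where "i g = (SOME h. h \<in> G \<and> g ** h = mat 1 \<and> h ** g = mat 1)" for g :: "'k ^ 'n::{finite,linorder} ^ 'n::{finite,linorder}"
      have i: "i g \<in> G \<and> g ** i g = mat 1 \<and> i g ** g = mat 1" if "g \<in> G" for g
        unfolding i_def by (rule someI_ex) (use inverse_mem[OF that] in blast)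
      have ii: "i (i g) = g" if "g \<in> G" for g
        by (metis i matrix_mul_assoc matrix_mul_lid matrix_mul_rid that)
      have bij: "bij_betw i G G"
        by (rule bij_betwI[where g = i]) (use i ii in auto)
      have "?\<phi> (tr z * w) = (\<lambda>a. \<Sum>g\<in>G. ?\<phi> (act g z * w) a)"
        by (simp add: transfer_map_def sum_distrib_right sum_\<phi>)
      also have "\<dots> = (\<lambda>a. \<Sum>g\<in>G. ?\<phi> (z * act (i g) w) a)"
      proof -
        have "?\<phi> (act g z * w) = ?\<phi> (z * act (i g) w)" if "g \<in> G" for g
          by (rule step) (use i[OF that] that in auto)
        then show ?thesis by (intro ext sum.cong) auto
      qed
      also have "\<dots> = (\<lambda>a. \<Sum>g\<in>G. ?\<phi> (z * act g w) a)"
      proof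
        fix a
        show "(\<Sum>g\<in>G. ?\<phi> (z * act (i g) w) a) = (\<Sum>g\<in>G. ?\<phi> (z * act g w) a)"
          by (rule sum.reindex_bij_betw[OF bij, where g = "\<lambda>g. ?\<phi> (z * act g w) a"])
      qed
      also have "\<dots> = ?\<phi> (z * tr w)"
        by (simp add: transfer_map_def sum_distrib_left sum_\<phi>)
      finally show ?thesis .
    qed
    have "\<forall>i. \<exists>x. fst x \<noteq> 0 \<and> vars_in (UNIV - {i}) (fst x) \<and> subst y (fst x) = tr (snd x)"
    proof
      fix i
      obtain \<rho> z where "\<rho> \<noteq> 0" "vars_in (UNIV - {i}) \<rho>" "subst y \<rho> = tr z"
        using trace_relation[OF notrans y_invariant] .
      then show "\<exists>x. fst x \<noteq> 0 \<and> vars_in (UNIV - {i}) (fst x) \<and> subst y (fst x) = tr (snd x)"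
        by (intro exI[of _ "(\<rho>, z)"]) simp
    qed
    from choice[OF this] obtain f where f: "\<forall>i. fst (f i) \<noteq> 0 \<and> vars_in (UNIV - {i}) (fst (f i)) \<and> subst y (fst (f i)) = tr (snd (f i))" ..
    define \<rho> z where "\<rho> i = fst (f i)" and "z i = snd (f i)" for i
    have \<rho>: "\<rho> i \<noteq> 0" "vars_in (UNIV - {i}) (\<rho> i)" and z: "subst y (\<rho> i) = tr (z i)" for i
      using f by (auto simp: \<rho>_def z_def)
    \<comment> \<open>The index \<open>undefined\<close> is an arbitrary one. By self-adjointness
      the product of \<open>\<rho>\<close> with the series of \<open>w\<close> is the series of a
      multiple of \<open>tr w\<close>, and the module is torsion-free.\<close>
    have \<phi>_ker: "?\<phi> w = (\<lambda>a. 0)" if "tr w = 0" for w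
    proof -
      have "pact (\<rho> undefined) (?\<phi> w) = ?\<phi> (tr (z undefined) * w)"
        by (simp flip: z subst_\<phi>)
      also have "\<dots> = (\<lambda>a. 0)"
        unfolding \<phi>_tr that using sum_\<phi>[of "\<lambda>_. 0" "{}"] by simp
      finally show ?thesis by (simp add: pact_eq_0_iff \<rho>)
    qed
    have \<phi>_cong: "?\<phi> w = ?\<phi> w'" if "tr w = tr w'" for w w'
      using \<phi>_ker[of "w - w'"] that by (simp add: tr_diff diff_\<phi> fun_eq_iff)
    define j :: 'n where "j = undefined"
    \<comment> \<open>The quotient is the value at \<open>a\<close> of the map through which the
      series map factors. It exists because multiplying by \<open>\<rho> i\<close> turns the series
      of \<open>z j * a\<close> into \<open>\<rho> j\<close> times the series of
      \<open>z i * a\<close>.\<close>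
    have "sdvd (\<rho> j) (?\<phi> (z j * a))" if a: "a \<in> invariants G" for a
    proof (rule sdvd_common_multiples[of UNIV])
      show "vars_in UNIV (\<rho> j)" by (simp add: vars_in_def)
      fix i
      have "pact (\<rho> i) (?\<phi> (z j * a)) = ?\<phi> (tr (z i) * (z j * a))"
        by (simp flip: z subst_\<phi>)
      also have "\<dots> = ?\<phi> (tr (z j) * (z i * a))"
      proof (rule \<phi>_cong)
        have "tr (tr (z i) * (z j * a)) = tr (z i) * (tr (z j) * a)"
          using a by (simp add: tr_mult_invariant[OF tr_invariant] tr_of_invariant_mult)
        also have "\<dots> = tr (z j) * (tr (z i) * a)" by (simp only: mult_ac)
        also have "\<dots> = tr (tr (z j) * (z i * a))"
          using a by (simp add: tr_mult_invariant[OF tr_invariant] tr_of_invariant_mult)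
        finally show "tr (tr (z i) * (z j * a)) = tr (tr (z j) * (z i * a))" .
      qed
      also have "\<dots> = pact (\<rho> j) (?\<phi> (z i * a))"
        by (simp flip: z subst_\<phi>)
      finally have "sdvd (\<rho> j) (pact (\<rho> i) (?\<phi> (z j * a)))"
        unfolding sdvd_def by blast
      then show "\<rho> i \<noteq> 0 \<and> vars_in (UNIV - {i}) (\<rho> i) \<and> sdvd (\<rho> j) (pact (\<rho> i) (?\<phi> (z j * a)))"
        using \<rho> by blast
    qed (use \<rho> in auto)
    then have \<psi>: "\<exists>X. ?\<phi> (z j * a) = pact (\<rho> j) X" if "a \<in> invariants G" for a
      using that unfolding sdvd_def by blast
    obtain s M where s: "\<And>i. s i \<in> invariants G" "Fract (tr r) (Y ^ d) = Fract (\<Sum>i\<in>UNIV. s i * y i ^ M) (Y ^ M)" "M \<ge> 1"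
      by (rule boundaryE[OF coefficients_simps(2) r, where M = 1]) (rule that)
    have tr_eq: "tr r * Y ^ M = (\<Sum>i\<in>UNIV. s i * y i ^ M) * Y ^ d"
      using s(2) by (simp add: eq_fract)
    have "\<forall>i. \<exists>X. ?\<phi> (z j * s i) = pact (\<rho> j) X" using \<psi> s(1) by blast
    from choice[OF this] obtain X where X: "\<And>i. ?\<phi> (z j * s i) = pact (\<rho> j) (X i)" by blast
    let ?m = "\<lambda>i. Poly_Mapping.single i M + const_exponent d"
    have mon_m: "subst y (Poly_Mapping.single (?m i) 1) = y i ^ M * Y ^ d" for i
    proof -
      have "mon (Poly_Mapping.lookup (Poly_Mapping.single i M)) = y i ^ M"
        unfolding mon_def lookup_single when_def
        by (simp add: if_distrib[where f = "\<lambda>n. _ ^ n"] cong: if_cong)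
      moreover have "Poly_Mapping.lookup (?m i) = 
        (\<lambda>l. Poly_Mapping.lookup (Poly_Mapping.single i M) l + d)"
        by (simp add: fun_eq_iff lookup_add)
      ultimately show ?thesis
        unfolding subst_single_Y by (simp add: mon_add Y_power)
    qed
    have "pact (\<rho> j) (?\<phi> (r * Y ^ M)) = ?\<phi> (tr (z j) * (r * Y ^ M))"
      by (simp flip: z subst_\<phi>)
    also have "\<dots> = ?\<phi> (z j * (tr r * Y ^ M))"
      unfolding \<phi>_tr using Y_invariant by (simp add: tr_of_invariant_mult invariants_closed)
    also have "z j * (tr r * Y ^ M) = (\<Sum>i\<in>UNIV. subst y (Poly_Mapping.single (?m i) 1) * (z j * s i))"
      unfolding tr_eq mon_m sum_distrib_left sum_distrib_right by (rule sum.cong) (simp_all only: mult_ac)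
    also have "?\<phi> \<dots> = (\<lambda>a. \<Sum>i\<in>UNIV. pact (\<rho> j) (shift (?m i) (X i)) a)"
    proof -
      have "?\<phi> (subst y (Poly_Mapping.single (?m i) 1) * (z j * s i)) = pact (\<rho> j) (shift (?m i) (X i))" for i
        unfolding subst_\<phi> X by (subst pact_commute) (simp add: pact_single)
      then show ?thesis unfolding sum_\<phi> by simp
    qed
    also have "\<dots> = pact (\<rho> j) (\<lambda>a. \<Sum>i\<in>UNIV. shift (?m i) (X i) a)"
      by (simp only: pact_sum_right)
    finally have "?\<phi> (r * Y ^ M) = (\<lambda>a. \<Sum>i\<in>UNIV. shift (?m i) (X i) a)"
      by (rule pact_cancel[OF \<rho>(1)])
    \<comment> \<open>With \<open>M \<ge> 1\<close> this coefficient belongs to the denominator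
      \<open>Y ^ (M + d)\<close> and is the value of \<open>\<theta>\<close> at
      \<open>r / Y^d\<close>. The \<open>i\<close>-th summand only has terms with exponent at least
      \<open>M + d\<close> at \<open>i\<close>, so it contributes nothing.\<close>
    then have "?\<phi> (r * Y ^ M) (const_exponent (M + d - 1)) = 
        (\<Sum>i\<in>UNIV. shift (?m i) (X i) (const_exponent (M + d - 1)))"
      by simp
    also have "\<dots> = 0"
    proof (rule sum.neutral, intro ballI)
      fix i
      have "\<not> mdvd (?m i) (const_exponent (M + d - 1))"
        unfolding mdvd_def not_all using s(3) by (intro exI[of _ i]) (simp add: lookup_add)
      then show "shift (?m i) (X i) (const_exponent (M + d - 1)) = 0" by (simp add: shift_def)
    qed
    also have "?\<phi> (r * Y ^ M) (const_exponent (M + d - 1)) = \<theta> (Fract (Y ^ M * r) (Y ^ M * Y ^ d))"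
      using s(3) by (simp add: dual_series_const_exponent mult.commute flip: power_add del: power_Suc)
    also have "Fract (Y ^ M * r) (Y ^ M * Y ^ d) = Fract r (Y ^ d)"
      by (rule mult_fract_cancel) simp
    finally show False using \<theta>_r by simp
  qed
  then show ?thesis unfolding U_def by blast
qed

text \<open>Let a functional vanish on traces and boundaries. Since \<open>subst y \<rho>\<close> is
  a trace, so are its invariant multiples; hence \<open>\<rho>\<close> annihilates the series of
  every invariant, and torsion-freeness makes that series 0.\<close>

lemma transfer_surjective:
  assumes notrans: "\<forall>g\<in>G. \<not> transvection g" and a: "a \<in> invariants G"
  shows "\<exists>r N. \<exists>b \<in> cech_boundaries (invariants G) y. Fract a (Y ^ d) = Fract (tr r) (Y ^ N) + b"
proof -
  let ?B = "cech_boundaries (invariants G) y"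
  define U where "U = {Fract (tr r) (Y ^ N) + b | r N b. b \<in> ?B}"
  have UI: "Fract (tr r) (Y ^ N) + b \<in> U" if "b \<in> ?B" for r N b
    using that unfolding U_def by blast
  have tr0: "tr 0 = 0" by (simp add: transfer_map_def)
  have B_U: "b \<in> U" if "b \<in> ?B" for b
    using UI[OF that, of 0 0] by (simp add: Fract_0 tr0)
  have "fract_space.subspace U"
    unfolding fract_space.subspace_def
  proof (intro conjI ballI allI)
    show "0 \<in> U" by (rule B_U) (simp add: boundaries_0)
  next
    fix x x' assume "x \<in> U" "x' \<in> U"
    then obtain s N b s' N' b' where x: "x = Fract (tr s) (Y ^ N) + b" "b \<in> ?B"
      "x' = Fract (tr s') (Y ^ N') + b'" "b' \<in> ?B"
      unfolding U_def by blast
    have "tr (Y ^ N' * s + Y ^ N * s') = Y ^ N' * tr s + Y ^ N * tr s'"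
      using Y_invariant by (simp add: tr_add tr_mult_invariant invariants_closed)
    then have "Fract (tr (Y ^ N' * s + Y ^ N * s')) (Y ^ (N + N')) = Fract (tr s) (Y ^ N) + Fract (tr s') (Y ^ N')"
      by (simp add: power_add mult_ac)
    then have eq: "x + x' = Fract (tr (Y ^ N' * s + Y ^ N * s')) (Y ^ (N + N')) + (b + b')"
      by (simp add: x)
    then show "x + x' \<in> U"
      unfolding eq by (intro UI boundaries_add x) simp
  next
    fix c x assume "x \<in> U"
    then obtain s N b where x: "x = Fract (tr s) (Y ^ N) + b" "b \<in> ?B"
      unfolding U_def by blast
    have "Fract (Const c) 1 * x = Fract (tr (Const c * s)) (Y ^ N) + Fract (Const c) 1 * b"
      by (simp add: x(1) distrib_left tr_mult_invariant[OF invariants_closed(3)])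
    then show "Fract (Const c) 1 * x \<in> U"
      using boundaries_mult[of "invariants G" b "Const c"] x(2) 
      by (simp only: UI coefficients_simps invariants_closed)
  qed
  have "Fract a (Y ^ d) \<in> U"
  proof (rule ccontr)
    assume "Fract a (Y ^ d) \<notin> U"
    then obtain \<theta> where \<theta>_add: "\<And>x x'. \<theta> (x + x') = \<theta> x + \<theta> x'" and \<theta>_scale: "\<And>c x. \<theta> (Fract (Const c) 1 * x) = c * \<theta> x"
      and \<theta>_U: "\<And>u. u \<in> U \<Longrightarrow> \<theta> u = (0 :: 'k)" and \<theta>_a: "\<theta> (Fract a (Y ^ d)) \<noteq> 0"
      by (rule fract_space.separating_functional[OF \<open>fract_space.subspace U\<close>]) (rule that)
    have \<theta>: "boundary_functional (invariants G) \<theta>"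
      unfolding boundary_functional_def using \<theta>_add \<theta>_scale \<theta>_U B_U by blast
    obtain \<rho> z where \<rho>: "\<rho> \<noteq> 0" "vars_in (UNIV - {undefined}) \<rho>" "subst y \<rho> = tr z"
      using trace_relation[OF notrans y_invariant] .
    \<comment> \<open>The series of an invariant only records denominators with positive exponents,
      so \<open>a / Y^d\<close> is expanded by \<open>Y\<close>, which also covers
      \<open>d = 0\<close>.\<close>
    have aY: "Y * a \<in> invariants G" using a Y_invariant by (rule invariants_closed(7)[rotated])
    have "pact \<rho> (dual_series \<theta> (Y * a)) = dual_series \<theta> (subst y \<rho> * (Y * a))"
      by (rule dual_series_subst[OF coefficients_simps(2) \<theta> aY, symmetric])
    also have "\<dots> = (\<lambda>a. 0)"
    proof
      fix e :: "'n \<Rightarrow>\<^sub>0 nat"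
      define N where "N = (\<Sum>i\<in>UNIV. Suc (Poly_Mapping.lookup e i))"
      let ?e = "\<lambda>i. Suc (Poly_Mapping.lookup e i)"
      have N: "?e i \<le> N" for i unfolding N_def by (rule le_sum_UNIV[where f = ?e])
      let ?m = "mon (\<lambda>i. N - ?e i)"
      have m: "?m * mon ?e = Y ^ N" by (rule mon_complement) (rule N)
      have "Fract (subst y \<rho> * (Y * a)) (mon ?e) = Fract (?m * (tr z * (Y * a))) (Y ^ N)"
        unfolding m[symmetric] \<rho>(3) by (simp add: mult_fract_cancel)
      also have "?m * (tr z * (Y * a)) = tr (?m * (z * (Y * a)))"
        using aY mon_invariant by (simp add: tr_mult_invariant tr_of_invariant_mult)
      finally have "Fract (subst y \<rho> * (Y * a)) (mon ?e) \<in> U"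
        using UI[OF boundaries_0[OF coefficients_simps(2)]] by simp
      then show "dual_series \<theta> (subst y \<rho> * (Y * a)) e = 0"
        unfolding dual_series_def by (rule \<theta>_U)
    qed
    finally have "dual_series \<theta> (Y * a) = (\<lambda>a. 0)" by (simp add: pact_eq_0_iff \<rho>(1))
    then have "dual_series \<theta> (Y * a) (const_exponent d) = 0" by simp
    then have "\<theta> (Fract (Y * a) (Y * Y ^ d)) = 0"
      by (simp add: dual_series_const_exponent)
    also have "Fract (Y * a) (Y * Y ^ d) = Fract a (Y ^ d)"
      by (rule mult_fract_cancel) simp
    finally show False using \<theta>_a by simp
  qed
  then show ?thesis unfolding U_def by blast
qed

end

section \<open>Maps on local cohomology\<close>

context cech
begin

lemma localization_group_simps [simp]:
  "carrier (localization_group S f) = localization S f"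
  "monoid.mult (localization_group S f) = (+)" "one (localization_group S f) = 0"
  by (simp_all add: localization_group_def)

lemma mem_localization_Y: "x \<in> localization S Y \<longleftrightarrow> (\<exists>s d. s \<in> S \<and> x = Fract s (Y ^ d))"
  unfolding localization_def by blast

lemma local_cohomology_Y: "local_cohomology S y = localization_group S Y Mod cech_boundaries S y"
  by (simp add: local_cohomology_def Y_def)

lemma cech_fraction_Y: "cech_fraction y r d = Fract r (Y ^ d)"
  by (simp add: cech_fraction_def Y_def)

lemma cech_class_Y:
  "cech_class S y r d = cech_boundaries S y #>\<^bsub>localization_group S Y\<^esub> Fract r (Y ^ d)"
  by (simp add: cech_class_def cech_fraction_def Y_def)

context
  fixes S
  assumes S: "coefficients S"
begin

lemma localization_uminus:
  assumes "x \<in> localization S Y"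
  shows "- x \<in> localization S Y"
proof -
  from assms obtain s d where "s \<in> S" "x = Fract s (Y ^ d)" unfolding mem_localization_Y by blast
  then have "- s \<in> S" "- x = Fract (- s) (Y ^ d)" by (simp_all add: coefficients_closed[OF S])
  then show ?thesis unfolding mem_localization_Y by blast
qed

lemma comm_group_localization: "comm_group (localization_group S Y)"
proof (rule comm_groupI)
  fix x x'
  assume "x \<in> carrier (localization_group S Y)" "x' \<in> carrier (localization_group S Y)"
  then obtain s d s' d' where s: "s \<in> S" "x = Fract s (Y ^ d)" "s' \<in> S" "x' = Fract s' (Y ^ d')"
    unfolding localization_group_simps mem_localization_Y by blast
  then have "x + x' = Fract (s * Y ^ d' + s' * Y ^ d) (Y ^ (d + d'))"
    by (simp add: power_add)
  moreover have "s * Y ^ d' + s' * Y ^ d \<in> S"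
    using s by (intro coefficients_closed[OF S])
  ultimately have "x + x' \<in> localization S Y"
    unfolding mem_localization_Y by blast
  then show "x \<otimes>\<^bsub>localization_group S Y\<^esub> x' \<in> carrier (localization_group S Y)"
    by simp
next
  have "0 = Fract 0 (Y ^ 0)" by (simp add: Fract_0)
  then show "\<one>\<^bsub>localization_group S Y\<^esub> \<in> carrier (localization_group S Y)"
    unfolding localization_group_simps mem_localization_Y using coefficients_closed(4)[OF S] by blast
next
  fix x assume "x \<in> carrier (localization_group S Y)"
  then show "\<exists>x'\<in>carrier (localization_group S Y).
      x' \<otimes>\<^bsub>localization_group S Y\<^esub> x = \<one>\<^bsub>localization_group S Y\<^esub>"
    by (intro bexI[of _ "- x"]) (simp_all add: localization_uminus)
qed (simp_all add: add_ac)

interpretation L: comm_group "localization_group S Y"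
  by (rule comm_group_localization)

lemma inv_localization_group:
  assumes "x \<in> localization S Y"
  shows "inv\<^bsub>localization_group S Y\<^esub> x = - x"
  by (rule L.inv_equality) (use assms localization_uminus in simp_all)

lemma subgroup_boundaries: "subgroup (cech_boundaries S y) (localization_group S Y)"
proof (rule L.subgroupI)
  show sub: "cech_boundaries S y \<subseteq> carrier (localization_group S Y)"
  proof
    fix x assume "x \<in> cech_boundaries S y"
    then obtain s N where "\<forall>i. s i \<in> S" "x = Fract (\<Sum>i\<in>UNIV. s i * y i ^ N) (Y ^ N)"
      unfolding boundaries_eq[OF S] by blast
    moreover from this have "(\<Sum>i\<in>UNIV. s i * y i ^ N) \<in> S"
      by (intro coefficients_closed[OF S]) auto
    ultimately show "x \<in> carrier (localization_group S Y)"
      unfolding localization_group_simps mem_localization_Y by blast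
  qed
  show "cech_boundaries S y \<noteq> {}" using boundaries_0[OF S] by blast
  fix x assume x: "x \<in> cech_boundaries S y"
  with sub show "inv\<^bsub>localization_group S Y\<^esub> x \<in> cech_boundaries S y"
    by (subst inv_localization_group) (auto intro: boundaries_uminus[OF S])
  fix x' assume "x' \<in> cech_boundaries S y"
  with x show "x \<otimes>\<^bsub>localization_group S Y\<^esub> x' \<in> cech_boundaries S y"
    by (simp add: boundaries_add[OF S])
qed

interpretation B: normal "cech_boundaries S y" "localization_group S Y"
  by (rule L.subgroup_imp_normal[OF subgroup_boundaries])

lemma comm_group_local_cohomology: "comm_group (local_cohomology S y)"
  unfolding local_cohomology_Y by (rule L.abelian_FactGroup[OF subgroup_boundaries])

lemma cech_class_eq: "cech_class S y r d = (\<lambda>b. b + Fract r (Y ^ d)) ` cech_boundaries S y"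
  by (auto simp: cech_class_Y r_coset_def)

lemma cech_fraction_mem:
  "cech_fraction y r d \<in> cech_class S y r' d' \<longleftrightarrow> Fract r (Y ^ d) - Fract r' (Y ^ d') \<in> cech_boundaries S y"
proof -
  have "x \<in> (\<lambda>b. b + x') ` cech_boundaries S y \<longleftrightarrow> x - x' \<in> cech_boundaries S y" for x x'
    by (auto simp: image_iff intro!: bexI[of _ "x - x'"])
  then show ?thesis by (simp only: cech_class_eq cech_fraction_Y)
qed

lemma Fract_mem_localization: "r \<in> S \<Longrightarrow> Fract r (Y ^ d) \<in> localization S Y"
  unfolding mem_localization_Y by blast

lemma cech_class_mem: "r \<in> S \<Longrightarrow> cech_class S y r d \<in> carrier (local_cohomology S y)"
  unfolding local_cohomology_Y carrier_FactGroup cech_class_Y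
  using Fract_mem_localization by auto

lemma cech_classE:
  assumes "\<eta> \<in> carrier (local_cohomology S y)"
  obtains r d where "r \<in> S" "\<eta> = cech_class S y r d"
proof -
  from assms obtain x where "x \<in> localization S Y" "\<eta> = cech_boundaries S y #>\<^bsub>localization_group S Y\<^esub> x"
    unfolding local_cohomology_Y carrier_FactGroup by auto
  then show ?thesis
    unfolding mem_localization_Y using that by (auto simp: cech_class_Y)
qed

lemma cech_class_cong:
  assumes "Fract r (Y ^ d) - Fract r' (Y ^ d') \<in> cech_boundaries S y" "r' \<in> S"
  shows "cech_class S y r d = cech_class S y r' d'"
proof -
  have "cech_fraction y r d \<in> cech_class S y r' d'"
    using assms(1) by (simp add: cech_fraction_mem)
  then show ?thesis
    unfolding cech_class_Y cech_fraction_Y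
    by (intro L.repr_independence[symmetric] subgroup_boundaries)
      (simp_all add: Fract_mem_localization[OF assms(2)])
qed

text \<open>This brings several classes to a common exponent before they are added.\<close>

lemma cech_class_raise:
  assumes "r \<in> S"
  shows "cech_class S y r d = cech_class S y (Y ^ e * r) (e + d)"
proof (rule cech_class_cong)
  have "Fract (Y ^ e * r) (Y ^ (e + d)) = Fract r (Y ^ d)"
    unfolding power_add by (rule mult_fract_cancel) simp
  then show "Fract r (Y ^ d) - Fract (Y ^ e * r) (Y ^ (e + d)) \<in> cech_boundaries S y"
    by (simp only: diff_self boundaries_0[OF S])
qed (use assms in \<open>intro coefficients_closed[OF S]\<close>)

lemma cech_class_mult:
  assumes "r \<in> S" "r' \<in> S"
  shows "cech_class S y r d \<otimes>\<^bsub>local_cohomology S y\<^esub> cech_class S y r' d = cech_class S y (r + r') d"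
  using B.rcos_sum[of "Fract r (Y ^ d)" "Fract r' (Y ^ d)"] assms
  by (simp add: local_cohomology_Y cech_class_Y Fract_mem_localization Fract_add_same del: add_fract)

lemma cech_class_one: "Fract r (Y ^ d) \<in> cech_boundaries S y \<longleftrightarrow> cech_class S y r d = \<one>\<^bsub>local_cohomology S y\<^esub>"
  if "r \<in> S"
proof
  assume "Fract r (Y ^ d) \<in> cech_boundaries S y"
  then show "cech_class S y r d = \<one>\<^bsub>local_cohomology S y\<^esub>"
    unfolding cech_class_Y local_cohomology_Y one_FactGroup
    by (intro L.coset_join2 subgroup_boundaries) (simp_all add: Fract_mem_localization[OF that])
next
  assume "cech_class S y r d = \<one>\<^bsub>local_cohomology S y\<^esub>"
  then have "cech_class S y r d = cech_boundaries S y" by (simp add: local_cohomology_Y)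
  moreover have "Fract r (Y ^ d) \<in> cech_class S y r d"
    unfolding cech_class_eq using boundaries_0[OF S] by (auto intro: image_eqI[where x = 0])
  ultimately show "Fract r (Y ^ d) \<in> cech_boundaries S y" by simp
qed

interpretation H: comm_group "local_cohomology S y"
  by (rule comm_group_local_cohomology)

lemma cech_class_zero: "cech_class S y 0 d = \<one>\<^bsub>local_cohomology S y\<^esub>"
  using cech_class_one[of 0 d] by (simp add: Fract_0 boundaries_0[OF S] coefficients_closed[OF S])

lemma cech_class_inv:
  assumes "r \<in> S"
  shows "inv\<^bsub>local_cohomology S y\<^esub> cech_class S y r d = cech_class S y (- r) d"
proof (rule H.inv_equality)
  show "cech_class S y (- r) d \<otimes>\<^bsub>local_cohomology S y\<^esub> cech_class S y r d = \<one>\<^bsub>local_cohomology S y\<^esub>"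
    using assms by (simp add: cech_class_mult coefficients_closed[OF S] cech_class_zero)
qed (use assms in \<open>simp_all add: cech_class_mem coefficients_closed[OF S]\<close>)

lemma finprod_cech_class:
  assumes "finite T" "\<And>g. g \<in> T \<Longrightarrow> t g \<in> S"
  shows "finprod (local_cohomology S y) (\<lambda>g. cech_class S y (t g) d) T = cech_class S y (sum t T) d"
  using assms
proof (induction T rule: finite_induct)
  case empty
  then show ?case by (simp add: cech_class_zero)
next
  case (insert g T)
  then show ?case
    by (subst H.finprod_insert) (auto simp: cech_class_mem cech_class_mult coefficients_closed[OF S])
qed

end

definition invariant_linear :: "('n, 'k) mpoly set \<Rightarrow> ('n, 'k) mpoly set \<Rightarrow> (('n, 'k) mpoly \<Rightarrow> ('n, 'k) mpoly) \<Rightarrow> bool" where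
  "invariant_linear S T \<phi> \<longleftrightarrow> (\<forall>r\<in>S. \<phi> r \<in> T) \<and> (\<forall>r\<in>S. \<forall>s\<in>S. \<phi> (r + s) = \<phi> r + \<phi> s) \<and>
     (\<forall>c\<in>invariants G. \<forall>r\<in>S. \<phi> (c * r) = c * \<phi> r)"

text \<open>After clearing denominators, being a boundary is an equation with invariant coefficients
  \<open>Y ^ N\<close> and \<open>y i ^ M\<close>, which \<open>\<phi>\<close> preserves. Hence all
  representatives give the same class and \<open>the_elem\<close> is applied to a singleton.\<close>

lemma induced_map_class:
  assumes S: "coefficients S" and T: "coefficients T" and \<phi>: "invariant_linear S T \<phi>" and r: "r \<in> S"
  shows "induced_map S T y \<phi> (cech_class S y r d) = cech_class T y (\<phi> r) d"
proof -
  have \<phi>_T: "\<phi> s \<in> T" if "s \<in> S" for s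
    using \<phi> that by (simp add: invariant_linear_def)
  have \<phi>_add: "\<phi> (s + s') = \<phi> s + \<phi> s'" if "s \<in> S" "s' \<in> S" for s s'
    using \<phi> that by (simp add: invariant_linear_def)
  have \<phi>_mult: "\<phi> (c * s) = c * \<phi> s" if "c \<in> invariants G" "s \<in> S" for c s
    using \<phi> that by (simp add: invariant_linear_def)
  have \<phi>_sum: "\<phi> (sum f I) = (\<Sum>i\<in>I. \<phi> (f i))" if "\<And>i. i \<in> I \<Longrightarrow> f i \<in> S" "finite I" for f and I :: "'n set"
    using that(2,1)
  proof (induction I rule: finite_induct)
    case empty
    have "\<phi> (0 * 0) = 0" using \<phi>_mult[of 0 0] by (simp add: invariants_closed coefficients_closed[OF S])
    then show ?case by simp
  next
    case (insert i I)
    then show ?case by (simp add: \<phi>_add coefficients_closed[OF S])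
  qed
  have Y_inv: "Y ^ N \<in> invariants G" for N by (intro invariants_closed Y_invariant)
  have bdry: "Fract (\<phi> s) (Y ^ N) \<in> cech_boundaries T y" if s: "s \<in> S" "Fract s (Y ^ N) \<in> cech_boundaries S y" for s N
  proof -
    obtain t M where t: "\<And>i. t i \<in> S" "s * Y ^ M = (\<Sum>i\<in>UNIV. t i * y i ^ M) * Y ^ N"
      using s(2) unfolding Fract_boundary_iff[OF S] by blast
    have "\<phi> s * Y ^ M = \<phi> (s * Y ^ M)"
      using \<phi>_mult[OF Y_inv s(1)] by (simp add: mult.commute)
    also have "\<dots> = \<phi> (Y ^ N * (\<Sum>i\<in>UNIV. y i ^ M * t i))"
      by (simp only: t(2) mult.commute)
    also have "\<dots> = Y ^ N * (\<Sum>i\<in>UNIV. \<phi> (y i ^ M * t i))"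
      using t(1) by (simp add: \<phi>_mult[OF Y_inv] \<phi>_sum coefficients_closed[OF S])
    also have "(\<Sum>i\<in>UNIV. \<phi> (y i ^ M * t i)) = (\<Sum>i\<in>UNIV. y i ^ M * \<phi> (t i))"
      by (simp add: \<phi>_mult invariants_closed y_invariant t(1))
    finally show ?thesis
      unfolding Fract_boundary_iff[OF T] using \<phi>_T[OF t(1)]
      by (intro exI[of _ "\<lambda>i. \<phi> (t i)"] exI[of _ M]) (simp add: mult.commute)
  qed
  have eq: "cech_class T y (\<phi> r') d' = cech_class T y (\<phi> r) d"
    if r': "r' \<in> S" and mem: "cech_fraction y r' d' \<in> cech_class S y r d" for r' d'
  proof (rule cech_class_cong[OF T _ \<phi>_T[OF r]])
    have YS: "Y ^ N \<in> S" for N using coefficients_invariant[OF S Y_inv] .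
    let ?s = "Y ^ d * r' + Y ^ d' * (- r)"
    have s: "?s \<in> S" using YS r r' by (intro coefficients_closed[OF S])
    have "Fract r' (Y ^ d') - Fract r (Y ^ d) = Fract ?s (Y ^ (d' + d))"
      by (simp add: power_add mult_ac)
    then have "Fract ?s (Y ^ (d' + d)) \<in> cech_boundaries S y"
      using mem by (simp add: cech_fraction_mem[OF S])
    note bdry[OF s this]
    also have "\<phi> ?s = Y ^ d * \<phi> r' + Y ^ d' * \<phi> (- r)"
    proof -
      note closed = coefficients_closed(2)[OF S YS] and neg = coefficients_closed(3)[OF S r]
      show ?thesis
        unfolding \<phi>_add[OF closed[OF r'] closed[OF neg]] \<phi>_mult[OF Y_inv r'] \<phi>_mult[OF Y_inv neg] ..
    qed
    also have "\<phi> (- r) = - \<phi> r"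
      using \<phi>_mult[of "- 1" r] r by (simp add: invariants_closed)
    finally show "Fract (\<phi> r') (Y ^ d') - Fract (\<phi> r) (Y ^ d) \<in> cech_boundaries T y"
      by (simp add: power_add mult_ac)
  qed
  have "cech_fraction y r d \<in> cech_class S y r d"
    by (simp add: cech_fraction_mem[OF S] boundaries_0[OF S] del: diff_fract)
  with r eq have "{cech_class T y (\<phi> r') d' | r' d'. r' \<in> S \<and> cech_fraction y r' d' \<in> cech_class S y r d} = 
      {cech_class T y (\<phi> r) d}"
    by blast
  then show ?thesis unfolding induced_map_def by simp
qed

lemma scalar_class:
  assumes "coefficients S" "c \<in> invariants G" "r \<in> S"
  shows "scalar S y c (cech_class S y r d) = cech_class S y (c * r) d"
  unfolding scalar_def
  by (rule induced_map_class) 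
    (use assms in \<open>auto simp: invariant_linear_def distrib_left mult_ac coefficients_invariant coefficients_closed\<close>)

lemma group_action_class:
  assumes "g \<in> G"
  shows "group_action y g (cech_class UNIV y r d) = cech_class UNIV y (act g r) d"
  unfolding group_action_def
  by (rule induced_map_class) (use assms in \<open>auto simp: invariant_linear_def act_add act_mult invariants_act\<close>)

lemma transfer_coh_class: "transfer_coh G y (cech_class UNIV y r d) = cech_class (invariants G) y (tr r) d"
  unfolding transfer_coh_def
  by (rule induced_map_class) (auto simp: invariant_linear_def tr_add tr_mult_invariant tr_invariant)

section \<open>The homomorphisms of the sequence and its exactness\<close>

abbreviation H_R where "H_R \<equiv> local_cohomology UNIV y"
abbreviation H_I where "H_I \<equiv> local_cohomology (invariants G) y"
abbreviation D where "D \<equiv> sum_group G (\<lambda>_. H_R)"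

interpretation R: comm_group H_R
  by (rule comm_group_local_cohomology) simp

text \<open>As \<open>G\<close> is finite, finite support is automatic and the direct sum consists
  of all families.\<close>

lemma carrier_D: "carrier D = (G \<rightarrow>\<^sub>E carrier H_R)"
  by (subst carrier_sum_group) (use finite R.is_group in auto)

lemma family_class_mem: "(\<lambda>g\<in>G. cech_class UNIV y (s g) d) \<in> carrier D"
  by (auto simp: carrier_D intro: cech_class_mem)

text \<open>Finitely many classes have a common denominator; the sum of their exponents serves as
  the exponent.\<close>

lemma family_classE:
  assumes "\<eta> \<in> carrier D"
  obtains s d where "\<eta> = (\<lambda>g\<in>G. cech_class UNIV y (s g) d)"
proof -
  have "\<forall>g. \<exists>x. g \<in> G \<longrightarrow> \<eta> g = cech_class UNIV y (fst x) (snd x)"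
  proof
    fix g
    show "\<exists>x. g \<in> G \<longrightarrow> \<eta> g = cech_class UNIV y (fst x) (snd x)"
    proof (cases "g \<in> G")
      case True
      then have "\<eta> g \<in> carrier H_R" using assms by (auto simp: carrier_D)
      then obtain r d where "\<eta> g = cech_class UNIV y r d"
        using cech_classE[OF coefficients_simps(1)] by blast
      then show ?thesis by (intro exI[of _ "(r, d)"]) simp
    qed simp
  qed
  from choice[OF this] obtain x where x: "\<And>g. g \<in> G \<Longrightarrow> \<eta> g = cech_class UNIV y (fst (x g)) (snd (x g))"
    by blast
  define d where "d = (\<Sum>g\<in>G. snd (x g))"
  have "snd (x g) \<le> d" if "g \<in> G" for g
    unfolding d_def using that finite by (intro member_le_sum) auto
  then have "\<eta> g = cech_class UNIV y (Y ^ (d - snd (x g)) * fst (x g)) d" if "g \<in> G" for g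
    using x[OF that] that cech_class_raise[OF coefficients_simps(1), of "fst (x g)" "snd (x g)" "d - snd (x g)"] by simp
  moreover have "\<eta> \<in> extensional G" using assms by (simp add: carrier_D PiE_iff)
  ultimately have "\<eta> = (\<lambda>g\<in>G. cech_class UNIV y (Y ^ (d - snd (x g)) * fst (x g)) d)"
    by (auto simp: fun_eq_iff extensional_def)
  then show ?thesis by (rule that)
qed

lemma alpha_class:
  "alpha G y (\<lambda>g\<in>G. cech_class UNIV y (s g) d) = cech_class UNIV y (\<Sum>g\<in>G. s g - act g (s g)) d"
proof -
  have "alpha G y (\<lambda>g\<in>G. cech_class UNIV y (s g) d) = 
      finprod H_R (\<lambda>g. cech_class UNIV y (s g - act g (s g)) d) G"
    unfolding alpha_def Let_def
  proof (rule R.finprod_cong')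
    fix g assume "g \<in> G"
    then show "(\<lambda>g\<in>G. cech_class UNIV y (s g) d) g \<otimes>\<^bsub>H_R\<^esub>
        inv\<^bsub>H_R\<^esub> group_action y g ((\<lambda>g\<in>G. cech_class UNIV y (s g) d) g) =
        cech_class UNIV y (s g - act g (s g)) d"
      by (simp add: group_action_class cech_class_inv cech_class_mult)
  qed (auto intro: cech_class_mem)
  also have "\<dots> = cech_class UNIV y (\<Sum>g\<in>G. s g - act g (s g)) d"
    by (rule finprod_cech_class) (simp_all add: finite)
  finally show ?thesis .
qed

lemma two_classesE:
  assumes "coefficients S" "\<eta> \<in> carrier (local_cohomology S y)" "\<eta>' \<in> carrier (local_cohomology S y)"
  obtains r r' d where "r \<in> S" "r' \<in> S" "\<eta> = cech_class S y r d" "\<eta>' = cech_class S y r' d"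
proof -
  obtain r d where r: "r \<in> S" "\<eta> = cech_class S y r d" by (rule cech_classE[OF assms(1,2)])
  obtain r' d' where r': "r' \<in> S" "\<eta>' = cech_class S y r' d'" by (rule cech_classE[OF assms(1,3)])
  have "\<eta> = cech_class S y (Y ^ d' * r) (d' + d)" "\<eta>' = cech_class S y (Y ^ d * r') (d' + d)"
    using r(2) r'(2) cech_class_raise[OF assms(1) r(1), of d d'] cech_class_raise[OF assms(1) r'(1), of d' d]
    by (simp_all only: add.commute)
  moreover have "Y ^ d' * r \<in> S" "Y ^ d * r' \<in> S"
    using r r' by (auto intro: coefficients_closed[OF assms(1)])
  ultimately show ?thesis by (rule_tac that)
qed

lemma transfer_coh_hom: "transfer_coh G y \<in> hom H_R H_I"
proof (rule homI)
  fix \<eta> assume "\<eta> \<in> carrier H_R"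
  then obtain r d where "\<eta> = cech_class UNIV y r d"
    by (rule cech_classE[OF coefficients_simps(1)])
  then show "transfer_coh G y \<eta> \<in> carrier H_I"
    by (simp add: transfer_coh_class cech_class_mem tr_invariant)
next
  fix \<eta> \<eta>' assume "\<eta> \<in> carrier H_R" "\<eta>' \<in> carrier H_R"
  then obtain r r' d where "\<eta> = cech_class UNIV y r d" "\<eta>' = cech_class UNIV y r' d"
    by (rule two_classesE[OF coefficients_simps(1)])
  then show "transfer_coh G y (\<eta> \<otimes>\<^bsub>H_R\<^esub> \<eta>') = transfer_coh G y \<eta> \<otimes>\<^bsub>H_I\<^esub> transfer_coh G y \<eta>'"
    by (simp add: cech_class_mult transfer_coh_class tr_add tr_invariant)
qed

lemma alpha_hom: "alpha G y \<in> hom D H_R"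
proof (rule homI)
  fix \<eta> assume "\<eta> \<in> carrier D"
  then obtain s d where "\<eta> = (\<lambda>g\<in>G. cech_class UNIV y (s g) d)" by (rule family_classE)
  then show "alpha G y \<eta> \<in> carrier H_R" by (simp add: alpha_class cech_class_mem)
next
  fix \<eta> \<eta>' assume "\<eta> \<in> carrier D" "\<eta>' \<in> carrier D"
  then obtain s d s' d' where s: "\<eta> = (\<lambda>g\<in>G. cech_class UNIV y (s g) d)" "\<eta>' = (\<lambda>g\<in>G. cech_class UNIV y (s' g) d')"
    by (metis family_classE)
  define t t' where "t g = Y ^ d' * s g" and "t' g = Y ^ d * s' g" for g
  have \<eta>: "\<eta> = (\<lambda>g\<in>G. cech_class UNIV y (t g) (d' + d))" "\<eta>' = (\<lambda>g\<in>G. cech_class UNIV y (t' g) (d' + d))"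
    using cech_class_raise[OF coefficients_simps(1) UNIV_I, of _ d d'] cech_class_raise[OF coefficients_simps(1) UNIV_I, of _ d' d]
    unfolding s t_def t'_def by (simp_all only: add.commute)
  have "\<eta> \<otimes>\<^bsub>D\<^esub> \<eta>' = (\<lambda>g\<in>G. cech_class UNIV y (t g + t' g) (d' + d))"
    by (auto simp: \<eta> cech_class_mult fun_eq_iff)
  moreover have "(\<Sum>g\<in>G. t g + t' g - act g (t g + t' g)) = (\<Sum>g\<in>G. t g - act g (t g)) + (\<Sum>g\<in>G. t' g - act g (t' g))"
    unfolding sum.distrib[symmetric] by (rule sum.cong) (simp_all add: act_add)
  ultimately show "alpha G y (\<eta> \<otimes>\<^bsub>D\<^esub> \<eta>') = alpha G y \<eta> \<otimes>\<^bsub>H_R\<^esub> alpha G y \<eta>'"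
    by (simp only: \<eta> alpha_class cech_class_mult coefficients_simps UNIV_I)
qed

lemma alpha_scalar:
  assumes "c \<in> invariants G" "\<eta> \<in> carrier D"
  shows "alpha G y (\<lambda>g\<in>G. scalar UNIV y c (\<eta> g)) = scalar UNIV y c (alpha G y \<eta>)"
proof -
  obtain s d where \<eta>: "\<eta> = (\<lambda>g\<in>G. cech_class UNIV y (s g) d)" using assms(2) by (rule family_classE)
  have "(\<lambda>g\<in>G. scalar UNIV y c (\<eta> g)) = (\<lambda>g\<in>G. cech_class UNIV y (c * s g) d)"
    by (auto simp: fun_eq_iff \<eta> scalar_class assms(1))
  moreover have "(\<Sum>g\<in>G. c * s g - act g (c * s g)) = c * (\<Sum>g\<in>G. s g - act g (s g))"
    unfolding sum_distrib_left
    by (rule sum.cong) (simp_all add: act_mult invariants_act[OF assms(1)] right_diff_distrib)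
  ultimately show ?thesis
    by (simp add: \<eta> alpha_class scalar_class assms(1))
qed

lemma transfer_coh_scalar:
  assumes "c \<in> invariants G" "\<eta> \<in> carrier H_R"
  shows "transfer_coh G y (scalar UNIV y c \<eta>) = scalar (invariants G) y c (transfer_coh G y \<eta>)"
proof -
  obtain r d where "\<eta> = cech_class UNIV y r d"
    using assms(2) by (rule cech_classE[OF coefficients_simps(1)])
  then show ?thesis
    by (simp add: transfer_coh_class scalar_class assms(1) tr_invariant tr_mult_invariant)
qed

text \<open>The composite vanishes because \<open>tr (act g s)\<close> equals \<open>tr s\<close>.
  The converse is \<open>transfer_kernel\<close>, where the boundary disappears in the
  class.\<close>

lemma exact_middle:
  assumes "\<forall>g\<in>G. \<not> transvection g"
  shows "alpha G y ` carrier D = kernel H_R H_I (transfer_coh G y)"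
proof (intro equalityI subsetI)
  fix \<xi> assume "\<xi> \<in> alpha G y ` carrier D"
  then obtain \<eta> where \<eta>: "\<eta> \<in> carrier D" "\<xi> = alpha G y \<eta>" by blast
  obtain s d where "\<eta> = (\<lambda>g\<in>G. cech_class UNIV y (s g) d)" using \<eta>(1) by (rule family_classE)
  then have \<xi>: "\<xi> = cech_class UNIV y (\<Sum>g\<in>G. s g - act g (s g)) d" by (simp add: \<eta>(2) alpha_class)
  have "tr (\<Sum>g\<in>G. s g - act g (s g)) = 0"
    by (simp add: tr_sum tr_diff tr_act)
  then show "\<xi> \<in> kernel H_R H_I (transfer_coh G y)"
    by (simp add: kernel_def \<xi> cech_class_mem transfer_coh_class cech_class_zero)
next
  fix \<xi> assume "\<xi> \<in> kernel H_R H_I (transfer_coh G y)"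
  then have \<xi>: "\<xi> \<in> carrier H_R" "transfer_coh G y \<xi> = \<one>\<^bsub>H_I\<^esub>" by (auto simp: kernel_def)
  obtain r d where r: "\<xi> = cech_class UNIV y r d" using \<xi>(1) by (rule cech_classE[OF coefficients_simps(1)])
  have "Fract (tr r) (Y ^ d) \<in> cech_boundaries (invariants G) y"
    using \<xi>(2) by (simp add: r transfer_coh_class cech_class_one tr_invariant)
  from transfer_kernel[OF assms this] obtain s N b where b: "b \<in> cech_boundaries UNIV y"
    "Fract r (Y ^ d) = Fract (\<Sum>g\<in>G. s g - act g (s g)) (Y ^ N) + b" by blast
  have "\<xi> = cech_class UNIV y (\<Sum>g\<in>G. s g - act g (s g)) N"
    unfolding r by (rule cech_class_cong) (simp_all add: b)
  also have "\<dots> = alpha G y (\<lambda>g\<in>G. cech_class UNIV y (s g) N)" by (simp only: alpha_class)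
  finally show "\<xi> \<in> alpha G y ` carrier D" using family_class_mem by blast
qed

lemma exact_right:
  assumes "\<forall>g\<in>G. \<not> transvection g"
  shows "transfer_coh G y ` carrier H_R = carrier H_I"
proof (intro equalityI subsetI)
  fix \<xi> assume "\<xi> \<in> transfer_coh G y ` carrier H_R"
  then show "\<xi> \<in> carrier H_I" using transfer_coh_hom by (auto simp: hom_def)
next
  fix \<xi> assume "\<xi> \<in> carrier H_I"
  then obtain a d where a: "a \<in> invariants G" "\<xi> = cech_class (invariants G) y a d"
    by (rule cech_classE[OF coefficients_simps(2)])
  from transfer_surjective[OF assms a(1)] obtain r N b where b: "b \<in> cech_boundaries (invariants G) y"
    "Fract a (Y ^ d) = Fract (tr r) (Y ^ N) + b" by blast
  have "\<xi> = cech_class (invariants G) y (tr r) N"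
    unfolding a(2) by (rule cech_class_cong) (simp_all add: b tr_invariant)
  also have "\<dots> = transfer_coh G y (cech_class UNIV y r N)" by (simp only: transfer_coh_class)
  finally show "\<xi> \<in> transfer_coh G y ` carrier H_R" using cech_class_mem[OF coefficients_simps(1)] by blast
qed

end

theorem theorem3p1:
  fixes G :: "('k::field ^ 'n::{finite,linorder} ^ 'n::{finite,linorder}) set"
    and y :: "'n \<Rightarrow> ('n, 'k) mpoly"
  assumes "subgroup G GL"
    and "finite G"
    and "\<forall>g\<in>G. \<not> transvection g"
    and "hsop G y"
  shows
    "let H\<^sub>R = local_cohomology UNIV y;
         H\<^sub>I = local_cohomology (invariants G) y;
         D = sum_group G (\<lambda>_. H\<^sub>R);
         \<alpha> = alpha G y;
         Tr = transfer_coh G y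
     in \<alpha> \<in> hom D H\<^sub>R \<and> Tr \<in> hom H\<^sub>R H\<^sub>I \<and>
        (\<forall>c \<in> invariants G. \<forall>\<eta> \<in> carrier D.
           \<alpha> (\<lambda>g\<in>G. scalar UNIV y c (\<eta> g)) = scalar UNIV y c (\<alpha> \<eta>)) \<and>
        (\<forall>c \<in> invariants G. \<forall>\<eta> \<in> carrier H\<^sub>R.
           Tr (scalar UNIV y c \<eta>) = scalar (invariants G) y c (Tr \<eta>)) \<and>
        \<alpha> ` carrier D = kernel H\<^sub>R H\<^sub>I Tr \<and>
        Tr ` carrier H\<^sub>R = carrier H\<^sub>I"
proof -
  interpret linear_group G
    using assms(1,2) by (rule linear_group.intro)
  interpret cech G y
    by unfold_locales (use assms(4) hsop_nonzero in \<open>auto simp: hsop_def\<close>)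
  show ?thesis
    unfolding Let_def
    using alpha_hom transfer_coh_hom alpha_scalar transfer_coh_scalar
      exact_middle[OF assms(3)] exact_right[OF assms(3)] by blast
qed

end
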